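(* Let $M$ be a geodesically complete manifold with linear connection $\nabla$, let $F\in\Omega_1^1(M)$ be a fixed tensor field of type $(1,1)$ everywhere different from zero, and for $k\in\mathbb{R}$ consider the equation $$\nabla_{\dot\gamma}\dot\gamma=kF\dot\gamma. \qquad ( *_k)$$ Fix $a,b\in M$ and $X_a\in T_a(M)$ such that the geodesic $\gamma_0$ with $\gamma_0(0)=a$ and $\dot\gamma_0(0)=X_a$ satisfies $\gamma_0(1)=b$, and suppose that $d\Phi_1(X_a)$ is invertible. Then the boundary value problem of finding solutions $\gamma_k$ of $( *_k)$ with $\gamma_k(0)=a$ and $\gamma_k(1)=b$ has a solution if there is a function $Y:\mathbb{R}\to T_a(M)\subset TM$, with $Y(0)=0$ and $Y$ differentiable at $0$, such that the solution $\gamma_k$ of $( *_k)$ with $\gamma_k(0)=a$ and $\dot\gamma_k(0)=X_a+Y(k)$ satisfies $\gamma_k(1)=b$. In this case the linear approximation of $Y$ at $k=0$ is given by $$Y'(0)=-Y_1 .$$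
   Context: $\Phi_t(X)$ denotes the point at time $t$ of the geodesic of $\nabla$ with initial velocity $X\in TM$; $d\Phi_1(X_a)$ denotes the differential at $X_a$ of the restriction $\Phi_1:T_a(M)\to M$, a linear map $T_{X_a}(T_a(M))\cong T_a(M)\to T_b(M)$. For $k\in\mathbb{R}$, $\Psi_k(X)$ denotes the point at time $t=1$ of the solution of $( *_k)$ with initial velocity $X\in TM$ (so $\Psi_0=\Phi_1$); solutions considered are those defined on $[0,1]$. The vector $Y_1$ is defined by $$Y_1=(d\Phi_1(X_a))^{-1}\left(\left.\frac{d}{dk}\right|_{k=0}\Psi_k(X_a)\right)\in T_{X_a}(T_a(M))\cong T_a(M).$$ *)

theory Defs
  imports "HOL-Analysis.Analysis" "HOL-Library.Function_Algebras"
begin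

instantiation "fun" :: (type, real_vector) real_vector
begin

definition scaleR_fun :: "real \<Rightarrow> ('a \<Rightarrow> 'b) \<Rightarrow> 'a \<Rightarrow> 'b"
  where "scaleR_fun r f = (\<lambda>x. r *\<^sub>R f x)"

instance
  by standard (auto simp: scaleR_fun_def fun_eq_iff scaleR_add_right scaleR_add_left)

end

text \<open>Only meant for open sets \<open>S\<close>.\<close>

primrec C_k_on ::
  "nat \<Rightarrow> ('a::euclidean_space \<Rightarrow> 'b::real_normed_vector) \<Rightarrow> 'a set \<Rightarrow> bool" where
  "C_k_on 0 f S \<longleftrightarrow> continuous_on S f"
| "C_k_on (Suc n) f S \<longleftrightarrow> (\<forall>x\<in>S. f differentiable at x) \<and>
     (\<forall>v. C_k_on n (\<lambda>x. frechet_derivative f (at x) v) S)"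

definition smooth_on ::
  "('a::euclidean_space \<Rightarrow> 'b::real_normed_vector) \<Rightarrow> 'a set \<Rightarrow> bool"
  where "smooth_on f S \<longleftrightarrow> (\<forall>n. C_k_on n f S)"

text \<open>A chart is a pair of its domain and its coordinate map; the values of the
  coordinate map outside the domain are irrelevant.\<close>

type_synonym ('a, 'e) chart = "'a set \<times> ('a \<Rightarrow> 'e)"

definition cdom :: "('a, 'e) chart \<Rightarrow> 'a set"
  where "cdom c = fst c"

definition cmap :: "('a, 'e) chart \<Rightarrow> 'a \<Rightarrow> 'e"
  where "cmap c = snd c"

definition cinv :: "('a, 'e) chart \<Rightarrow> 'e \<Rightarrow> 'a"
  where "cinv c = inv_into (cdom c) (cmap c)"

definition transition :: "('a, 'e) chart \<Rightarrow> ('a, 'e) chart \<Rightarrow> 'e \<Rightarrow> 'e"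
  where "transition c d = cmap d \<circ> cinv c"

definition is_chart :: "'a topology \<Rightarrow> ('a, 'e::euclidean_space) chart \<Rightarrow> bool"
  where "is_chart M c \<longleftrightarrow> openin M (cdom c) \<and> open (cmap c ` cdom c) \<and>
    homeomorphic_map (subtopology M (cdom c)) (top_of_set (cmap c ` cdom c)) (cmap c)"

definition smooth_atlas :: "'a topology \<Rightarrow> ('a, 'e::euclidean_space) chart set \<Rightarrow> bool"
  where "smooth_atlas M A \<longleftrightarrow>
    (\<forall>c\<in>A. is_chart M c) \<and>
    (\<Union>c\<in>A. cdom c) = topspace M \<and>
    (\<forall>c\<in>A. \<forall>d\<in>A. smooth_on (transition c d) (cmap c ` (cdom c \<inter> cdom d)))"

definition smooth_manifold :: "'a topology \<Rightarrow> ('a, 'e::euclidean_space) chart set \<Rightarrow> bool"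
  where "smooth_manifold M A \<longleftrightarrow>
    Hausdorff_space M \<and> second_countable M \<and> smooth_atlas M A"

definition charts_at :: "('a, 'e) chart set \<Rightarrow> 'a \<Rightarrow> ('a, 'e) chart set"
  where "charts_at A p = {c \<in> A. p \<in> cdom c}"

text \<open>A tangent vector at \<open>p\<close> is the family of its coordinate representations in all
  charts of the atlas around \<open>p\<close>, related by the derivatives of the transition maps.
  Components at charts that do not contain \<open>p\<close> are set to \<open>0\<close>, so that the tangent space is
  a linear subspace of the function space, isomorphic to \<open>'e\<close> through each component
  in \<open>charts_at A p\<close>. The base point is not recorded in the vector.\<close>

type_synonym ('a, 'e) tvec = "('a, 'e) chart \<Rightarrow> 'e"

definition tangent_space ::
  "('a, 'e::euclidean_space) chart set \<Rightarrow> 'a \<Rightarrow> ('a, 'e) tvec set"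
  where "tangent_space A p = {v.
    (\<forall>c. c \<notin> charts_at A p \<longrightarrow> v c = 0) \<and>
    (\<forall>c\<in>charts_at A p. \<forall>d\<in>charts_at A p.
       v d = frechet_derivative (transition c d) (at (cmap c p)) (v c))}"

definition tvec_of ::
  "('a, 'e::euclidean_space) chart set \<Rightarrow> ('a, 'e) chart \<Rightarrow> 'a \<Rightarrow> 'e \<Rightarrow> ('a, 'e) tvec"
  where "tvec_of A c p u = (\<lambda>d. if d \<in> charts_at A p
    then frechet_derivative (transition c d) (at (cmap c p)) u else 0)"

definition smooth_function ::
  "('a, 'e::euclidean_space) chart set \<Rightarrow> 'a set \<Rightarrow> ('a \<Rightarrow> real) \<Rightarrow> bool"
  where "smooth_function A U f \<longleftrightarrow>
    (\<forall>c\<in>A. smooth_on (\<lambda>x. f (cinv c x)) (cmap c ` (U \<inter> cdom c)))"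

definition smooth_vector_field ::
  "('a, 'e::euclidean_space) chart set \<Rightarrow> 'a set \<Rightarrow> ('a \<Rightarrow> ('a, 'e) tvec) \<Rightarrow> bool"
  where "smooth_vector_field A U X \<longleftrightarrow>
    (\<forall>p\<in>U. X p \<in> tangent_space A p) \<and>
    (\<forall>c\<in>A. smooth_on (\<lambda>x. X (cinv c x) c) (cmap c ` (U \<inter> cdom c)))"

text \<open>The derivative \<open>v(f)\<close> of the function \<open>f\<close> along \<open>v\<close>, computed in the chart \<open>c\<close> around \<open>p\<close>.\<close>

definition dir_deriv ::
  "('a, 'e::euclidean_space) chart \<Rightarrow> 'a \<Rightarrow> ('a, 'e) tvec \<Rightarrow> ('a \<Rightarrow> real) \<Rightarrow> real"
  where "dir_deriv c p v f = frechet_derivative (\<lambda>x. f (cinv c x)) (at (cmap c p)) (v c)"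

text \<open>For curves, \<open>S\<close> is an interval; at its end points the derivatives are one-sided.\<close>

definition velocity ::
  "('a, 'e::euclidean_space) chart set \<Rightarrow> real set \<Rightarrow> (real \<Rightarrow> 'a) \<Rightarrow> real \<Rightarrow> ('a, 'e) tvec"
  where "velocity A S \<gamma> t = (\<lambda>c. if c \<in> charts_at A (\<gamma> t)
    then vector_derivative (cmap c \<circ> \<gamma>) (at t within S) else 0)"

definition twice_differentiable_curve ::
  "'a topology \<Rightarrow> ('a, 'e::euclidean_space) chart set \<Rightarrow> real set \<Rightarrow> (real \<Rightarrow> 'a) \<Rightarrow> bool"
  where "twice_differentiable_curve M A S \<gamma> \<longleftrightarrow>
    continuous_map (top_of_set S) M \<gamma> \<and>
    (\<forall>t\<in>S. \<forall>c\<in>charts_at A (\<gamma> t).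
       (cmap c \<circ> \<gamma>) differentiable (at t within S) \<and>
       (\<lambda>s. velocity A S \<gamma> s c) differentiable (at t within S))"

definition has_tangent_derivative ::
  "('a, 'e::euclidean_space) chart set \<Rightarrow> 'a \<Rightarrow> (real \<Rightarrow> ('a, 'e) tvec) \<Rightarrow> ('a, 'e) tvec
     \<Rightarrow> real \<Rightarrow> bool"
  where "has_tangent_derivative A p Y Y' t \<longleftrightarrow> Y' \<in> tangent_space A p \<and>
    (\<forall>c\<in>charts_at A p. ((\<lambda>k. Y k c) has_vector_derivative Y' c) (at t))"

text \<open>The differential at \<open>X\<close> of a map \<open>f\<close> from the tangent space at \<open>a\<close> to the manifold, with
  \<open>T\<^sub>X (T\<^sub>a M)\<close> identified with \<open>T\<^sub>a M\<close>. The chart used for the linear coordinates on \<open>T\<^sub>a M\<close> is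
  arbitrary.\<close>

definition differential ::
  "('a, 'e::euclidean_space) chart set \<Rightarrow> 'a \<Rightarrow> (('a, 'e) tvec \<Rightarrow> 'a) \<Rightarrow> ('a, 'e) tvec
     \<Rightarrow> ('a, 'e) tvec \<Rightarrow> ('a, 'e) tvec"
  where "differential A a f X v = (let c = (SOME c. c \<in> charts_at A a) in
    (\<lambda>d. if d \<in> charts_at A (f X)
      then frechet_derivative (\<lambda>u. cmap d (f (tvec_of A c a u))) (at (X c)) (v c) else 0))"

text \<open>Koszul connections, applied to vector fields that are smooth on some open set: \<open>D p v Y\<close> is
  the covariant derivative of \<open>Y\<close> at \<open>p\<close> in the direction \<open>v\<close>. Since a field only needs to be
  smooth near \<open>p\<close>, locality is a consequence of the Leibniz rule, applied to a function that is
  \<open>1\<close> near \<open>p\<close> and \<open>0\<close> elsewhere.\<close>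

type_synonym ('a, 'e) connection =
  "'a \<Rightarrow> ('a, 'e) tvec \<Rightarrow> ('a \<Rightarrow> ('a, 'e) tvec) \<Rightarrow> ('a, 'e) tvec"

definition linear_connection ::
  "'a topology \<Rightarrow> ('a, 'e::euclidean_space) chart set \<Rightarrow> ('a, 'e) connection \<Rightarrow> bool"
  where "linear_connection M A D \<longleftrightarrow>
    (\<forall>U. openin M U \<longrightarrow>
      (\<forall>p\<in>U. \<forall>Y. smooth_vector_field A U Y \<longrightarrow>
        (\<forall>v\<in>tangent_space A p. D p v Y \<in> tangent_space A p) \<and>
        (\<forall>v\<in>tangent_space A p. \<forall>w\<in>tangent_space A p. \<forall>r.
           D p (r *\<^sub>R v + w) Y = r *\<^sub>R D p v Y + D p w Y) \<and>
        (\<forall>v\<in>tangent_space A p. \<forall>Z. smooth_vector_field A U Z \<longrightarrow>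
           D p v (\<lambda>q. Y q + Z q) = D p v Y + D p v Z) \<and>
        (\<forall>v\<in>tangent_space A p. \<forall>f. smooth_function A U f \<longrightarrow>
           (\<forall>c\<in>charts_at A p.
              D p v (\<lambda>q. f q *\<^sub>R Y q) = dir_deriv c p v f *\<^sub>R Y p + f p *\<^sub>R D p v Y))) \<and>
      (\<forall>X Y. smooth_vector_field A U X \<longrightarrow> smooth_vector_field A U Y \<longrightarrow>
         smooth_vector_field A U (\<lambda>p. D p (X p) Y)))"

definition tensor_field_1_1 ::
  "'a topology \<Rightarrow> ('a, 'e::euclidean_space) chart set \<Rightarrow> ('a \<Rightarrow> ('a, 'e) tvec \<Rightarrow> ('a, 'e) tvec)
     \<Rightarrow> bool"
  where "tensor_field_1_1 M A F \<longleftrightarrow>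
    (\<forall>p\<in>topspace M. \<forall>v\<in>tangent_space A p.
       F p v \<in> tangent_space A p \<and>
       (\<forall>w\<in>tangent_space A p. \<forall>r. F p (r *\<^sub>R v + w) = r *\<^sub>R F p v + F p w)) \<and>
    (\<forall>U X. openin M U \<longrightarrow> smooth_vector_field A U X \<longrightarrow>
       smooth_vector_field A U (\<lambda>p. F p (X p)))"

definition everywhere_nonzero ::
  "'a topology \<Rightarrow> ('a, 'e::euclidean_space) chart set \<Rightarrow> ('a \<Rightarrow> ('a, 'e) tvec \<Rightarrow> ('a, 'e) tvec)
     \<Rightarrow> bool"
  where "everywhere_nonzero M A F \<longleftrightarrow>
    (\<forall>p\<in>topspace M. \<exists>v\<in>tangent_space A p. F p v \<noteq> 0)"

text \<open>The covariant derivative of a vector field \<open>V = \<Sum>\<^sub>i V\<^sup>i \<partial>\<^sub>i\<close> along a curve is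
  \<open>\<Sum>\<^sub>i (V\<^sup>i)' \<partial>\<^sub>i + V\<^sup>i D\<^bsub>\<gamma>'\<^esub> \<partial>\<^sub>i\<close>; the component in each chart \<open>c\<close> is computed with the
  coordinate frame \<open>\<partial>\<^sub>i = (\<lambda>q. tvec_of A c q i)\<close> of \<open>c\<close> itself.\<close>

definition covariant_derivative ::
  "('a, 'e::euclidean_space) chart set \<Rightarrow> ('a, 'e) connection \<Rightarrow> real set \<Rightarrow> (real \<Rightarrow> 'a)
     \<Rightarrow> (real \<Rightarrow> ('a, 'e) tvec) \<Rightarrow> real \<Rightarrow> ('a, 'e) tvec"
  where "covariant_derivative A D S \<gamma> V t = (\<lambda>c. if c \<in> charts_at A (\<gamma> t)
    then vector_derivative (\<lambda>s. V s c) (at t within S) +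
      (\<Sum>i\<in>Basis. (V t c \<bullet> i) *\<^sub>R D (\<gamma> t) (velocity A S \<gamma> t) (\<lambda>q. tvec_of A c q i) c)
    else 0)"

definition geodesic ::
  "'a topology \<Rightarrow> ('a, 'e::euclidean_space) chart set \<Rightarrow> ('a, 'e) connection \<Rightarrow> real set
     \<Rightarrow> (real \<Rightarrow> 'a) \<Rightarrow> bool"
  where "geodesic M A D S \<gamma> \<longleftrightarrow> twice_differentiable_curve M A S \<gamma> \<and>
    (\<forall>t\<in>S. covariant_derivative A D S \<gamma> (velocity A S \<gamma>) t = 0)"

definition geodesically_complete ::
  "'a topology \<Rightarrow> ('a, 'e::euclidean_space) chart set \<Rightarrow> ('a, 'e) connection \<Rightarrow> bool"
  where "geodesically_complete M A D \<longleftrightarrow>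
    (\<forall>p\<in>topspace M. \<forall>v\<in>tangent_space A p.
       \<exists>\<gamma>. geodesic M A D UNIV \<gamma> \<and> \<gamma> 0 = p \<and> velocity A UNIV \<gamma> 0 = v)"

definition Phi ::
  "'a topology \<Rightarrow> ('a, 'e::euclidean_space) chart set \<Rightarrow> ('a, 'e) connection \<Rightarrow> real
     \<Rightarrow> 'a \<Rightarrow> ('a, 'e) tvec \<Rightarrow> 'a"
  where "Phi M A D t p v = (THE q. \<exists>\<gamma>. geodesic M A D UNIV \<gamma> \<and>
    \<gamma> 0 = p \<and> velocity A UNIV \<gamma> 0 = v \<and> \<gamma> t = q)"

text \<open>Solutions on \<open>[0,1]\<close> of \<open>D\<^bsub>\<gamma>'\<^esub> \<gamma>' = k F \<gamma>'\<close>.\<close>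

definition solution ::
  "'a topology \<Rightarrow> ('a, 'e::euclidean_space) chart set \<Rightarrow> ('a, 'e) connection
     \<Rightarrow> ('a \<Rightarrow> ('a, 'e) tvec \<Rightarrow> ('a, 'e) tvec) \<Rightarrow> real \<Rightarrow> (real \<Rightarrow> 'a) \<Rightarrow> bool"
  where "solution M A D F k \<gamma> \<longleftrightarrow> twice_differentiable_curve M A {0..1} \<gamma> \<and>
    (\<forall>t\<in>{0..1}. covariant_derivative A D {0..1} \<gamma> (velocity A {0..1} \<gamma>) t =
       k *\<^sub>R F (\<gamma> t) (velocity A {0..1} \<gamma> t))"

definition solution_from ::
  "'a topology \<Rightarrow> ('a, 'e::euclidean_space) chart set \<Rightarrow> ('a, 'e) connection
     \<Rightarrow> ('a \<Rightarrow> ('a, 'e) tvec \<Rightarrow> ('a, 'e) tvec) \<Rightarrow> real \<Rightarrow> 'a \<Rightarrow> ('a, 'e) tvec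
     \<Rightarrow> (real \<Rightarrow> 'a) \<Rightarrow> bool"
  where "solution_from M A D F k p v \<gamma> \<longleftrightarrow>
    solution M A D F k \<gamma> \<and> \<gamma> 0 = p \<and> velocity A {0..1} \<gamma> 0 = v"

text \<open>Unspecified if the solution with initial data \<open>p\<close>, \<open>v\<close> does not exist up to time \<open>1\<close>.\<close>

definition Psi ::
  "'a topology \<Rightarrow> ('a, 'e::euclidean_space) chart set \<Rightarrow> ('a, 'e) connection
     \<Rightarrow> ('a \<Rightarrow> ('a, 'e) tvec \<Rightarrow> ('a, 'e) tvec) \<Rightarrow> real \<Rightarrow> 'a \<Rightarrow> ('a, 'e) tvec \<Rightarrow> 'a"
  where "Psi M A D F k p v = (THE q. \<exists>\<gamma>. solution_from M A D F k p v \<gamma> \<and> \<gamma> 1 = q)"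

definition dPhi1 ::
  "'a topology \<Rightarrow> ('a, 'e::euclidean_space) chart set \<Rightarrow> ('a, 'e) connection
     \<Rightarrow> 'a \<Rightarrow> ('a, 'e) tvec \<Rightarrow> ('a, 'e) tvec \<Rightarrow> ('a, 'e) tvec"
  where "dPhi1 M A D a X = differential A a (Phi M A D 1 a) X"

definition Y1 ::
  "'a topology \<Rightarrow> ('a, 'e::euclidean_space) chart set \<Rightarrow> ('a, 'e) connection
     \<Rightarrow> ('a \<Rightarrow> ('a, 'e) tvec \<Rightarrow> ('a, 'e) tvec) \<Rightarrow> 'a \<Rightarrow> ('a, 'e) tvec \<Rightarrow> ('a, 'e) tvec"
  where "Y1 M A D F a X = inv_into (tangent_space A a) (dPhi1 M A D a X)
    (velocity A UNIV (\<lambda>k. Psi M A D F k a X) 0)"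

definition velocity_correction ::
  "'a topology \<Rightarrow> ('a, 'e::euclidean_space) chart set \<Rightarrow> ('a, 'e) connection
     \<Rightarrow> ('a \<Rightarrow> ('a, 'e) tvec \<Rightarrow> ('a, 'e) tvec) \<Rightarrow> 'a \<Rightarrow> 'a \<Rightarrow> ('a, 'e) tvec
     \<Rightarrow> (real \<Rightarrow> ('a, 'e) tvec) \<Rightarrow> bool"
  where "velocity_correction M A D F a b X Y \<longleftrightarrow>
    (\<forall>k. Y k \<in> tangent_space A a) \<and> Y 0 = 0 \<and>
    (\<exists>Y'. has_tangent_derivative A a Y Y' 0) \<and>
    (\<forall>k. \<exists>\<gamma>. solution_from M A D F k a (X + Y k) \<gamma> \<and> \<gamma> 1 = b)"

end

theory Submission
  imports Defs
begin

text \<open>The first half of the theorem only unpacks the notion of a velocity correction. For the second half,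
let \<open>P (k, u)\<close> be the end point, at time \<open>1\<close>, of the solution of the equation with
parameter \<open>k\<close> that starts at \<open>a\<close> with initial velocity \<open>u\<close>, read in charts around \<open>a\<close> and \<open>b\<close>.
If \<open>P\<close> is differentiable at \<open>(0, X)\<close> with derivative \<open>L\<close>, then \<open>L (0, \<cdot>)\<close> represents \<open>dPhi1\<close>, and
\<open>L (1, 0)\<close> represents the velocity of \<open>k \<mapsto> Psi k a X\<close> at \<open>0\<close>. Along \<open>k \<mapsto> (k, X + Y k)\<close> the function \<open>P\<close> has
the constant value \<open>b\<close>, so the chain rule gives \<open>L (1, 0) + L (0, Y') = 0\<close>, that is,
\<open>dPhi1 (- Y')\<close> is the velocity of \<open>Psi\<close> (lemma \<open>dPhi1_neg_correction_derivative\<close>). Injectivity of \<open>dPhi1\<close>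
turns this into \<open>Y1 = - Y'\<close>.

The work lies in showing that \<open>P\<close> is well defined near \<open>(0, X)\<close> and jointly differentiable there
(lemma \<open>Psi_differentiable\<close>). A priori the perturbed solutions might not even live up to time \<open>1\<close>:
completeness concerns geodesics only.

\<^item> In a chart the equation becomes the first-order system \<open>x' = v\<close>, \<open>v' = k F(x) v - \<Gamma>(x)(v, v)\<close>,
  whose right-hand side is smooth. Adding the equation \<open>k' = 0\<close> turns the parameter into an initial
  value, so that one autonomous system \<open>chart_ode\<close> covers parameters and initial velocities.
\<^item> The local theory of such systems is developed for short times, where the Picard operator is a
  contraction with factor \<open>1/2\<close> and every estimate can be read off at the point at which a norm is
  maximal. The derivative of the flow solves the linearized equation (lemma \<open>ode_local_flow\<close>).
\<^item> The system has the same meaning in all charts. The second derivative of the coordinate change that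
  appears when velocities are differentiated is cancelled by the one in the transformation rule
  of the Christoffel symbols, which follows from locality and the Leibniz rule
  (lemmas \<open>christoffel_change_of_chart\<close> and \<open>motion_in_change_of_chart\<close>).
\<^item> Uniqueness and existence are carried from short intervals to \<open>[0,1]\<close> by Bolzano's principle of bisection:
  a relation between times that is transitive and holds on all short intervals around each point holds
  between the end points (lemmas \<open>motion_unique\<close> and \<open>flow_to_one\<close>).\<close>

section \<open>Calculus of smooth maps between Euclidean spaces\<close>

lemma C_k_on_cong:
  assumes "open S" "\<And>x. x \<in> S \<Longrightarrow> f x = g x" "C_k_on n f S"
  shows "C_k_on n g S"
  using assms(2,3)
proof (induction n arbitrary: f g)
  case 0
  then show ?case by (simp cong: continuous_on_cong)
next
  case (Suc n)
  have dg: "g differentiable at x" and eq: "frechet_derivative f (at x) = frechet_derivative g (at x)"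
    if "x \<in> S" for x
  proof -
    have "f differentiable at x" using Suc.prems that by simp
    then show "g differentiable at x"
      using Suc.prems(1) assms(1) that
      by (meson differentiable_def has_derivative_transform_within_open)
    show "frechet_derivative f (at x) = frechet_derivative g (at x)"
      by (rule frechet_derivative_transform_within_open[OF \<open>f differentiable at x\<close> assms(1) that Suc.prems(1)])
  qed
  have "C_k_on n (\<lambda>x. frechet_derivative g (at x) v) S" for v
    by (rule Suc.IH[of "\<lambda>x. frechet_derivative f (at x) v"]) (use Suc.prems eq in auto)
  with dg show ?case by simp
qed

lemma C_k_on_SucI:
  assumes "open S" "\<And>x. x \<in> S \<Longrightarrow> (f has_derivative f' x) (at x)"
    and "\<And>v. C_k_on n (\<lambda>x. f' x v) S"
  shows "C_k_on (Suc n) f S"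
proof -
  have "C_k_on n (\<lambda>x. frechet_derivative f (at x) v) S" for v
  proof (rule C_k_on_cong[OF assms(1) _ assms(3)[of v]])
    show "f' x v = frechet_derivative f (at x) v" if "x \<in> S" for x
      using frechet_derivative_at[OF assms(2)[OF that]] by simp
  qed
  then show ?thesis using assms(2) by (auto simp: differentiable_def)
qed

lemma C_k_on_Suc_has_derivative:
  "C_k_on (Suc n) f S \<Longrightarrow> x \<in> S \<Longrightarrow> (f has_derivative frechet_derivative f (at x)) (at x)"
  by (simp add: frechet_derivative_works)

lemma C_k_on_SucD: "C_k_on (Suc n) f S \<Longrightarrow> C_k_on n f S"
proof (induction n arbitrary: f)
  case 0
  then show ?case
    by (simp add: differentiable_imp_continuous_on differentiable_on_def differentiable_at_withinI)
next
  case (Suc n)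
  then show ?case by (metis C_k_on.simps(2))
qed

lemma C_k_on_subset: "C_k_on n f S \<Longrightarrow> T \<subseteq> S \<Longrightarrow> C_k_on n f T"
  by (induction n arbitrary: f) (auto intro: continuous_on_subset)

lemma C_k_on_const:
  assumes "open S"
  shows "C_k_on n (\<lambda>x. c) S"
proof (induction n arbitrary: c)
  case (Suc n)
  show ?case by (rule C_k_on_SucI[OF assms has_derivative_const Suc.IH])
qed simp

lemma C_k_on_add:
  assumes "open S" "C_k_on n f S" "C_k_on n g S"
  shows "C_k_on n (\<lambda>x. f x + g x) S"
  using assms(2,3)
proof (induction n arbitrary: f g)
  case 0
  then show ?case by (simp add: continuous_on_add)
next
  case (Suc n)
  show ?case
    by (rule C_k_on_SucI[OF assms(1) has_derivative_add[OF C_k_on_Suc_has_derivative[OF Suc.prems(1)]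
          C_k_on_Suc_has_derivative[OF Suc.prems(2)]]])
      (use Suc in auto)
qed

lemma C_k_on_bounded_linear:
  assumes "open S" "bounded_linear L" "C_k_on n f S"
  shows "C_k_on n (\<lambda>x. L (f x)) S"
  using assms(3)
proof (induction n arbitrary: f)
  case 0
  then show ?case using assms(2) by (simp add: bounded_linear.continuous_on)
next
  case (Suc n)
  show ?case
    by (rule C_k_on_SucI[OF assms(1) bounded_linear.has_derivative[OF assms(2)
          C_k_on_Suc_has_derivative[OF Suc.prems]]])
      (use Suc in auto)
qed

lemma C_k_on_bilinear:
  assumes "open S" "bounded_bilinear h" "C_k_on n f S" "C_k_on n g S"
  shows "C_k_on n (\<lambda>x. h (f x) (g x)) S"
  using assms(3,4)
proof (induction n arbitrary: f g)
  case 0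
  then show ?case using assms(2) by (simp add: bounded_bilinear.continuous_on)
next
  case (Suc n)
  have *: "C_k_on n f S" "C_k_on n g S" using Suc.prems C_k_on_SucD by blast+
  show ?case
  proof (rule C_k_on_SucI[OF assms(1)])
    fix x assume "x \<in> S"
    then show "((\<lambda>x. h (f x) (g x)) has_derivative
        (\<lambda>v. h (f x) (frechet_derivative g (at x) v) + h (frechet_derivative f (at x) v) (g x))) (at x)"
      using Suc.prems by (intro bounded_bilinear.FDERIV[OF assms(2)]) (auto simp: frechet_derivative_works)
  next
    fix v
    show "C_k_on n (\<lambda>x. h (f x) (frechet_derivative g (at x) v) + h (frechet_derivative f (at x) v) (g x)) S"
      using Suc.prems * by (intro C_k_on_add assms(1) Suc.IH) auto
  qed
qed

lemma C_k_on_sum: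
  assumes "open S" "\<And>i. i \<in> I \<Longrightarrow> C_k_on n (f i) S"
  shows "C_k_on n (\<lambda>x. \<Sum>i\<in>I. f i x) S"
  using assms(2)
  by (induction I rule: infinite_finite_induct) (auto intro!: C_k_on_const C_k_on_add assms(1))

lemma linear_expand_basis:
  fixes L :: "'a::euclidean_space \<Rightarrow> 'b::real_vector"
  assumes "linear L"
  shows "L v = (\<Sum>i\<in>Basis. (v \<bullet> i) *\<^sub>R L i)"
proof -
  have "L v = L (\<Sum>i\<in>Basis. (v \<bullet> i) *\<^sub>R i)" by (simp add: euclidean_representation)
  also have "\<dots> = (\<Sum>i\<in>Basis. (v \<bullet> i) *\<^sub>R L i)"
    by (simp add: linear_sum[OF assms] linear_cmul[OF assms])
  finally show ?thesis .
qed

text \<open>The derivative of a composition is \<open>f' (g x) (g' x v)\<close>, which is not itself a composition of functions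
covered by the induction hypothesis. Expanding \<open>g' x v\<close> in a basis makes it a sum of
products of such functions.\<close>

lemma C_k_on_compose:
  fixes f :: "'b::euclidean_space \<Rightarrow> 'c::real_normed_vector"
    and g :: "'a::euclidean_space \<Rightarrow> 'b"
  assumes "open S" "g ` S \<subseteq> T" "C_k_on n f T" "C_k_on n g S"
  shows "C_k_on n (\<lambda>x. f (g x)) S"
  using assms(3,4)
proof (induction n arbitrary: f)
  case 0
  then show ?case using assms(2) by (auto intro: continuous_on_compose2)
next
  case (Suc n)
  have gn: "C_k_on n g S" using Suc.prems C_k_on_SucD by blast
  show ?case
  proof (rule C_k_on_SucI[OF assms(1)])
    fix x assume x: "x \<in> S"
    have *: "(f has_derivative frechet_derivative f (at (g x))) (at (g x))"
      using Suc.prems(1) assms(2) x by (auto simp: frechet_derivative_works)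
    have "((\<lambda>x. f (g x)) has_derivative
        (\<lambda>v. frechet_derivative f (at (g x)) (frechet_derivative g (at x) v))) (at x)"
      by (rule has_derivative_compose[where g = f and f = g, OF C_k_on_Suc_has_derivative[OF Suc.prems(2) x] *])
    moreover have "frechet_derivative f (at (g x)) (frechet_derivative g (at x) v) =
        (\<Sum>i\<in>Basis. (frechet_derivative g (at x) v \<bullet> i) *\<^sub>R frechet_derivative f (at (g x)) i)" for v
      by (rule linear_expand_basis) (rule has_derivative_linear[OF *])
    ultimately show "((\<lambda>x. f (g x)) has_derivative
        (\<lambda>v. \<Sum>i\<in>Basis. (frechet_derivative g (at x) v \<bullet> i) *\<^sub>R frechet_derivative f (at (g x)) i)) (at x)"
      by simp
  next
    fix v
    show "C_k_on n (\<lambda>x. \<Sum>i\<in>Basis. (frechet_derivative g (at x) v \<bullet> i) *\<^sub>R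
        frechet_derivative f (at (g x)) i) S"
      using Suc.prems gn
      by (intro C_k_on_sum assms(1) C_k_on_bilinear[OF assms(1) bounded_bilinear_scaleR]
          C_k_on_bounded_linear[OF assms(1) bounded_linear_inner_left] Suc.IH) auto
  qed
qed

lemma C_k_on_ident:
  assumes "open S"
  shows "C_k_on n (\<lambda>x. x) S"
proof (cases n)
  case (Suc m)
  show ?thesis unfolding Suc by (rule C_k_on_SucI[OF assms has_derivative_ident C_k_on_const[OF assms]])
qed simp

lemma smooth_on_eq:
  assumes "open S" "smooth_on f S" "\<And>x. x \<in> S \<Longrightarrow> f x = g x"
  shows "smooth_on g S"
  using assms C_k_on_cong unfolding smooth_on_def by blast

lemma smooth_on_subset: "smooth_on f S \<Longrightarrow> T \<subseteq> S \<Longrightarrow> smooth_on f T"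
  unfolding smooth_on_def using C_k_on_subset by blast

lemma smooth_on_const: "open S \<Longrightarrow> smooth_on (\<lambda>x. c) S"
  by (simp add: smooth_on_def C_k_on_const)

lemma smooth_on_add: "open S \<Longrightarrow> smooth_on f S \<Longrightarrow> smooth_on g S \<Longrightarrow> smooth_on (\<lambda>x. f x + g x) S"
  by (simp add: smooth_on_def C_k_on_add)

lemma smooth_on_sum:
  "open S \<Longrightarrow> (\<And>i. i \<in> I \<Longrightarrow> smooth_on (f i) S) \<Longrightarrow> smooth_on (\<lambda>x. \<Sum>i\<in>I. f i x) S"
  by (simp add: smooth_on_def C_k_on_sum)

lemma smooth_on_bounded_linear:
  "open S \<Longrightarrow> bounded_linear L \<Longrightarrow> smooth_on f S \<Longrightarrow> smooth_on (\<lambda>x. L (f x)) S"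
  by (simp add: smooth_on_def C_k_on_bounded_linear)

lemma smooth_on_bilinear:
  "open S \<Longrightarrow> bounded_bilinear h \<Longrightarrow> smooth_on f S \<Longrightarrow> smooth_on g S \<Longrightarrow> smooth_on (\<lambda>x. h (f x) (g x)) S"
  by (simp add: smooth_on_def C_k_on_bilinear)

lemmas smooth_on_scaleR = smooth_on_bilinear[OF _ bounded_bilinear_scaleR]

lemma smooth_on_compose:
  fixes f :: "'b::euclidean_space \<Rightarrow> 'c::real_normed_vector" and g :: "'a::euclidean_space \<Rightarrow> 'b"
  shows "open S \<Longrightarrow> g ` S \<subseteq> T \<Longrightarrow> smooth_on f T \<Longrightarrow> smooth_on g S \<Longrightarrow> smooth_on (\<lambda>x. f (g x)) S"
  unfolding smooth_on_def using C_k_on_compose by blast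

lemma smooth_on_linear: "open S \<Longrightarrow> bounded_linear L \<Longrightarrow> smooth_on L S"
  using smooth_on_bounded_linear[of S L "\<lambda>x. x"] by (simp add: smooth_on_def C_k_on_ident)

lemma smooth_on_has_derivative:
  "smooth_on f S \<Longrightarrow> x \<in> S \<Longrightarrow> (f has_derivative frechet_derivative f (at x)) (at x)"
  using C_k_on_Suc_has_derivative unfolding smooth_on_def by blast

lemma smooth_on_has_derivative_within:
  assumes "smooth_on f S" "K \<subseteq> S" "x \<in> K"
  shows "(f has_derivative frechet_derivative f (at x)) (at x within T)"
  by (rule has_derivative_at_withinI, rule smooth_on_has_derivative[OF assms(1)]) (use assms in blast)

lemma smooth_on_linear_derivative:
  "smooth_on f S \<Longrightarrow> x \<in> S \<Longrightarrow> linear (frechet_derivative f (at x))"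
  by (rule has_derivative_linear[OF smooth_on_has_derivative])

lemma smooth_on_frechet_derivative:
  "smooth_on f S \<Longrightarrow> smooth_on (\<lambda>x. frechet_derivative f (at x) v) S"
  unfolding smooth_on_def using C_k_on.simps(2) by blast

lemma smooth_on_continuous_on: "smooth_on f S \<Longrightarrow> continuous_on S f"
  unfolding smooth_on_def using C_k_on.simps(1) by blast

section \<open>Local flows of ordinary differential equations\<close>

text \<open>On intervals so short that \<open>(b - a) * L \<le> 1/2\<close>, this takes the place of Gronwall's inequality: at a point
where the norm of \<open>e\<close> is maximal, the mean value inequality bounds the maximum by half of itself plus the
terms on the right. The same bound yields uniqueness, Lipschitz dependence on the initial value, and the
remainder estimate for the derivative of the flow.\<close>

lemma norm_le_if_derivative_le_affine:
  fixes e :: "real \<Rightarrow> 'z::real_normed_vector"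
  assumes ab: "a \<le> b"
    and e': "\<And>t. t \<in> {a..b} \<Longrightarrow> (e has_vector_derivative e' t) (at t within {a..b})"
    and bd: "\<And>t. t \<in> {a..b} \<Longrightarrow> norm (e' t) \<le> L * norm (e t) + c"
    and L: "0 \<le> L" "(b - a) * L \<le> 1/2" and c: "0 \<le> c" and t: "t \<in> {a..b}"
  shows "norm (e t) \<le> 2 * (norm (e a) + (b - a) * c)"
proof -
  have cont: "continuous_on {a..b} e"
    using e' by (meson continuous_on_eq_continuous_within has_vector_derivative_continuous)
  have "\<exists>m\<in>{a..b}. \<forall>s\<in>{a..b}. norm (e s) \<le> norm (e m)"
    by (rule continuous_attains_sup) (use ab cont in \<open>auto intro: continuous_on_norm\<close>)
  then obtain m where m: "m \<in> {a..b}" "\<And>s. s \<in> {a..b} \<Longrightarrow> norm (e s) \<le> norm (e m)"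
    by blast
  have "norm (e m - e a) \<le> (L * norm (e m) + c) * norm (m - a)"
  proof (rule differentiable_bound[of "{a..b}" e "\<lambda>t h. h *\<^sub>R e' t"])
    show "onorm (\<lambda>h. h *\<^sub>R e' s) \<le> L * norm (e m) + c" if "s \<in> {a..b}" for s
    proof (rule onorm_bound)
      have "norm (e' s) \<le> L * norm (e m) + c"
        using bd[OF that] m(2)[OF that] L(1) by (meson add_right_mono mult_left_mono order_trans)
      then show "norm (h *\<^sub>R e' s) \<le> (L * norm (e m) + c) * norm h" for h
        by (simp add: mult.commute mult_left_mono)
    qed (use L c in auto)
  qed (use e' m ab in \<open>auto simp: has_vector_derivative_def\<close>)
  also have "\<dots> \<le> (L * norm (e m) + c) * (b - a)"
    using m(1) L c by (intro mult_left_mono) auto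
  also have "\<dots> = ((b - a) * L) * norm (e m) + (b - a) * c"
    by (simp add: algebra_simps)
  also have "\<dots> \<le> 1/2 * norm (e m) + (b - a) * c"
    using L(2) by (intro add_right_mono mult_right_mono) auto
  finally have "norm (e m) \<le> 2 * (norm (e a) + (b - a) * c)"
    using norm_triangle_sub[of "e m" "e a"] by simp
  with m(2)[OF t] show ?thesis by linarith
qed

text \<open>The Picard operator is made to act on bounded continuous functions on the whole line by freezing time
outside \<open>[0,T]\<close>. There it is a contraction, since \<open>T * L \<le> 1/2\<close>.\<close>

lemma picard_lindeloef:
  fixes g :: "real \<Rightarrow> 'z::euclidean_space \<Rightarrow> 'z"
  assumes T: "0 \<le> T" and L: "0 \<le> L" "T * L \<le> 1/2"
    and cont: "continuous_on ({0..T} \<times> UNIV) (\<lambda>(t, x). g t x)"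
    and lip: "\<And>t x y. t \<in> {0..T} \<Longrightarrow> norm (g t x - g t y) \<le> L * norm (x - y)"
  shows "\<exists>z. z 0 = z0 \<and> (\<forall>t\<in>{0..T}. (z has_vector_derivative g t (z t)) (at t within {0..T}))"
proof -
  define cl where "cl u = max 0 (min T u)" for u
  have cl: "cl u \<in> {0..T}" "u \<in> {0..T} \<Longrightarrow> cl u = u" for u
    using T by (auto simp: cl_def)
  have ccl: "continuous_on UNIV cl" unfolding cl_def by (intro continuous_intros)
  have gcont: "continuous_on {0..T} (\<lambda>s. g s (z s))" if "continuous_on {0..T} z" for z :: "real \<Rightarrow> 'z"
  proof -
    have "continuous_on {0..T} (\<lambda>s. (s, z s))" by (intro continuous_intros that)
    then have "continuous_on {0..T} (\<lambda>s. (\<lambda>(t, x). g t x) (s, z s))"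
      by (rule continuous_on_compose2[OF cont]) auto
    then show ?thesis by simp
  qed
  define P where "P z u = z0 + integral {0..cl u} (\<lambda>s. g s (apply_bcontfun z s))" for z u
  have P: "P z \<in> bcontfun" for z
  proof -
    have *: "continuous_on {0..T} (\<lambda>u. z0 + integral {0..u} (\<lambda>s. g s (apply_bcontfun z s)))"
      by (intro continuous_intros indefinite_integral_continuous_1 integrable_continuous_interval gcont) auto
    have c: "continuous_on UNIV (P z)"
      unfolding P_def by (rule continuous_on_compose2[OF * ccl]) (use cl(1) in blast)
    have "range (P z) \<subseteq> (\<lambda>u. z0 + integral {0..u} (\<lambda>s. g s (apply_bcontfun z s))) ` {0..T}"
      unfolding P_def using cl(1) by blast
    moreover have "bounded ((\<lambda>u. z0 + integral {0..u} (\<lambda>s. g s (apply_bcontfun z s))) ` {0..T})"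
      by (intro compact_imp_bounded compact_continuous_image * compact_Icc)
    ultimately have "bounded (range (P z))" by (rule bounded_subset[rotated])
    with c show ?thesis by (simp add: bcontfun_def)
  qed
  have "\<exists>!z. Bcontfun (P z) = z"
  proof (rule banach_fix_type[where c = "1/2"])
    show "\<forall>z y. dist (Bcontfun (P z)) (Bcontfun (P y)) \<le> 1/2 * dist z y"
    proof (intro allI dist_bound)
      fix z y :: "real \<Rightarrow>\<^sub>C 'z" and u
      let ?z = "apply_bcontfun z" and ?y = "apply_bcontfun y"
      have i: "(\<lambda>s. g s (apply_bcontfun x s)) integrable_on {0..cl u}" for x
        by (rule integrable_continuous_interval, rule continuous_on_subset[OF gcont]) (use cl(1)[of u] in auto)
      have "norm (integral {0..cl u} (\<lambda>s. g s (?z s) - g s (?y s))) \<le> (L * dist z y) * (cl u - 0)"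
      proof (rule integral_bound)
        show "norm (g s (?z s) - g s (?y s)) \<le> L * dist z y" if "s \<in> {0..cl u}" for s
        proof -
          have "norm (g s (?z s) - g s (?y s)) \<le> L * norm (?z s - ?y s)"
            using lip[of s] that cl(1)[of u] by auto
          also have "\<dots> \<le> L * dist z y"
            using dist_bounded[of z s y] L by (simp add: dist_norm mult_left_mono)
          finally show ?thesis .
        qed
        show "continuous_on {0..cl u} (\<lambda>s. g s (?z s) - g s (?y s))"
          by (rule continuous_on_subset[of "{0..T}"], intro continuous_on_diff gcont) (use cl(1)[of u] in auto)
      qed (use cl(1)[of u] in auto)
      also have "\<dots> = dist z y * (cl u * L)" by simp
      also have "\<dots> \<le> dist z y * (1/2)"
        using cl(1)[of u] L mult_right_mono[of "cl u" T L] by (intro mult_left_mono) auto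
      finally show "dist (apply_bcontfun (Bcontfun (P z)) u) (apply_bcontfun (Bcontfun (P y)) u) \<le> 1/2 * dist z y"
        using P by (simp add: Bcontfun_inverse P_def dist_norm integral_diff[OF i i])
    qed
  qed auto
  then obtain z where "Bcontfun (P z) = z" by blast
  then have z: "apply_bcontfun z u = P z u" for u
    by (metis P Bcontfun_inverse)
  let ?z = "\<lambda>u. z0 + integral {0..u} (\<lambda>s. g s (apply_bcontfun z s))"
  have eq: "apply_bcontfun z u = ?z u" if "u \<in> {0..T}" for u
    using z[of u] unfolding P_def cl(2)[OF that] .
  have "(?z has_vector_derivative g t (?z t)) (at t within {0..T})" if t: "t \<in> {0..T}" for t
    using has_vector_derivative_add[OF has_vector_derivative_const[of z0]
        integral_has_vector_derivative[OF gcont t, of "apply_bcontfun z"]] eq[OF t]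
    by simp
  then show ?thesis by (intro exI[of _ ?z]) auto
qed

lemma norm_linear_le_basis:
  fixes A :: "'z::euclidean_space \<Rightarrow> 'w::real_normed_vector"
  assumes "linear A"
  shows "norm (A v) \<le> (\<Sum>i\<in>Basis. norm (A i)) * norm v"
proof -
  have "norm (A v) = norm (\<Sum>i\<in>Basis. (v \<bullet> i) *\<^sub>R A i)" by (simp flip: linear_expand_basis[OF assms])
  also have "\<dots> \<le> (\<Sum>i\<in>Basis. norm (A i) * norm v)"
    by (rule sum_norm_le) (simp add: Basis_le_norm mult.commute[of _ "norm v"] mult_right_mono)
  finally show ?thesis by (simp add: sum_distrib_right)
qed

lemma smooth_on_bound_derivative:
  fixes f :: "'z::euclidean_space \<Rightarrow> 'w::real_normed_vector"
  assumes "smooth_on f W" "compact K" "K \<subseteq> W"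
  obtains L where "0 \<le> L" "\<And>x v. x \<in> K \<Longrightarrow> norm (frechet_derivative f (at x) v) \<le> L * norm v"
proof -
  let ?s = "\<lambda>x. \<Sum>i\<in>Basis. norm (frechet_derivative f (at x) i)"
  have "continuous_on K ?s"
    using assms by (intro continuous_intros continuous_on_subset[OF smooth_on_continuous_on[OF
          smooth_on_frechet_derivative]])
  then have "bounded (?s ` K)" using assms(2) by (intro compact_imp_bounded compact_continuous_image)
  then obtain L where L: "\<And>x. x \<in> K \<Longrightarrow> norm (?s x) \<le> L" "0 < L"
    by (auto simp: bounded_pos)
  show ?thesis
  proof (rule that[of L])
    show "norm (frechet_derivative f (at x) v) \<le> L * norm v" if x: "x \<in> K" for x v
    proof -
      have "linear (frechet_derivative f (at x))"
        using smooth_on_linear_derivative[OF assms(1)] assms(3) x by blast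
      then have "norm (frechet_derivative f (at x) v) \<le> ?s x * norm v" by (rule norm_linear_le_basis)
      also have "\<dots> \<le> L * norm v" using L(1)[OF x] by (intro mult_right_mono) auto
      finally show ?thesis .
    qed
  qed (use L in auto)
qed

lemma smooth_on_lipschitz:
  fixes f :: "'z::euclidean_space \<Rightarrow> 'w::real_normed_vector"
  assumes "smooth_on f W" "convex K" "K \<subseteq> W" "0 \<le> L"
    and L: "\<And>x v. x \<in> K \<Longrightarrow> norm (frechet_derivative f (at x) v) \<le> L * norm v"
    and "x \<in> K" "y \<in> K"
  shows "norm (f x - f y) \<le> L * norm (x - y)"
proof (rule differentiable_bound[OF \<open>convex K\<close>])
  show "(f has_derivative frechet_derivative f (at z)) (at z within K)" if "z \<in> K" for z
    by (rule smooth_on_has_derivative_within[OF assms(1,3) that])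
  show "onorm (frechet_derivative f (at z)) \<le> L" if "z \<in> K" for z
    by (rule onorm_bound[OF \<open>0 \<le> L\<close>]) (rule L[OF that])
qed (rule assms)+

text \<open>By uniform continuity of the derivative on \<open>K\<close>, the error of the linear approximation is small uniformly
in the base point. This uniformity is needed for linearization along a whole curve.\<close>

lemma smooth_on_uniform_linearization:
  fixes f :: "'z::euclidean_space \<Rightarrow> 'w::real_normed_vector"
  assumes f: "smooth_on f W" "compact K" "convex K" "K \<subseteq> W" and \<epsilon>: "0 < \<epsilon>"
  obtains \<eta> where "0 < \<eta>"
    "\<And>x y. x \<in> K \<Longrightarrow> y \<in> K \<Longrightarrow> norm (y - x) < \<eta> \<Longrightarrow>
       norm (f y - f x - frechet_derivative f (at x) (y - x)) \<le> \<epsilon> * norm (y - x)"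
proof -
  let ?f' = "\<lambda>x. frechet_derivative f (at x)"
  \<comment> \<open>The operator norm is bounded by the sum of the norms on the \<open>DIM('z)\<close> basis vectors.\<close>
  define \<epsilon>' where "\<epsilon>' = \<epsilon> / DIM('z)"
  have \<epsilon>': "\<epsilon>' > 0" using \<epsilon> by (simp add: \<epsilon>'_def)
  have lin: "linear (?f' x)" if "x \<in> K" for x
    using smooth_on_linear_derivative[OF f(1)] f(4) that by blast
  have "\<forall>i\<in>Basis. \<exists>\<eta>>0. \<forall>x\<in>K. \<forall>y\<in>K. dist y x < \<eta> \<longrightarrow> dist (?f' y i) (?f' x i) < \<epsilon>'"
  proof
    fix i
    have "uniformly_continuous_on K (\<lambda>x. ?f' x i)"
      by (rule compact_uniformly_continuous[OF continuous_on_subset[OF smooth_on_continuous_on[OF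
              smooth_on_frechet_derivative[OF f(1)]] f(4)] f(2)])
    then show "\<exists>\<eta>>0. \<forall>x\<in>K. \<forall>y\<in>K. dist y x < \<eta> \<longrightarrow> dist (?f' y i) (?f' x i) < \<epsilon>'"
      using \<epsilon>' unfolding uniformly_continuous_on_def by blast
  qed
  then obtain h where h: "\<And>i. i \<in> Basis \<Longrightarrow> h i > 0"
    "\<And>i x y. i \<in> Basis \<Longrightarrow> x \<in> K \<Longrightarrow> y \<in> K \<Longrightarrow> dist y x < h i \<Longrightarrow> dist (?f' y i) (?f' x i) < \<epsilon>'"
    by metis
  define \<eta> where "\<eta> = Min (h ` (Basis :: 'z set))"
  have \<eta>: "\<eta> > 0" "\<And>i. i \<in> Basis \<Longrightarrow> \<eta> \<le> h i"
    using h(1) by (auto simp: \<eta>_def)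
  show ?thesis
  proof (rule that[OF \<eta>(1)])
    fix x y assume xy: "x \<in> K" "y \<in> K" "norm (y - x) < \<eta>"
    have "norm (f y - f x - ?f' x (y - x)) \<le> norm (y - x) * \<epsilon>"
    proof (rule differentiable_bound_linearization[where S = "K \<inter> ball x \<eta>" and f' = ?f'])
      show "x + t *\<^sub>R (y - x) \<in> K \<inter> ball x \<eta>" if t: "t \<in> {0..1}" for t
      proof -
        have "x + t *\<^sub>R (y - x) = (1 - t) *\<^sub>R x + t *\<^sub>R y" by (simp add: algebra_simps)
        then have "x + t *\<^sub>R (y - x) \<in> K" using \<open>convex K\<close> xy t by (simp add: convex_def)
        moreover have "norm (t *\<^sub>R (y - x)) \<le> norm (y - x)"
          using t by (auto intro: mult_left_le_one_le)
        ultimately show ?thesis using xy(3) by (simp add: dist_norm norm_minus_commute)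
      qed
      show "(f has_derivative ?f' z) (at z within K \<inter> ball x \<eta>)" if "z \<in> K \<inter> ball x \<eta>" for z
        by (rule smooth_on_has_derivative_within[OF f(1,4)]) (use that in simp)
      show "onorm (?f' z - ?f' x) \<le> \<epsilon>" if z: "z \<in> K \<inter> ball x \<eta>" for z
      proof (rule onorm_bound)
        fix v
        have "linear (\<lambda>v. ?f' z v - ?f' x v)" using lin z xy by (intro linear_compose_sub) auto
        then have "norm (?f' z v - ?f' x v) \<le> (\<Sum>i\<in>Basis. norm (?f' z i - ?f' x i)) * norm v"
          by (rule norm_linear_le_basis)
        also have "(\<Sum>i\<in>Basis. norm (?f' z i - ?f' x i)) \<le> (\<Sum>i\<in>(Basis::'z set). \<epsilon>')"
        proof (rule sum_mono)
          fix i :: 'z assume i: "i \<in> Basis"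
          have "dist z x < h i" using z \<eta>(2)[OF i] by (simp add: dist_commute)
          then show "norm (?f' z i - ?f' x i) \<le> \<epsilon>'"
            using h(2)[OF i xy(1), of z] z by (simp add: dist_norm)
        qed
        also have "\<dots> = \<epsilon>" by (simp add: \<epsilon>'_def)
        finally show "norm ((?f' z - ?f' x) v) \<le> \<epsilon> * norm v" by (simp add: mult_right_mono)
      qed (use \<epsilon> in auto)
    qed (use xy \<eta> in auto)
    then show "norm (f y - f x - ?f' x (y - x)) \<le> \<epsilon> * norm (y - x)" by (simp add: mult.commute)
  qed
qed

lemma ode_locally_unique:
  fixes f :: "'z::euclidean_space \<Rightarrow> 'z"
  assumes "open W" "smooth_on f W" "w \<in> W"
  obtains r \<delta> where "0 < r" "0 < \<delta>"
    "\<And>a b z1 z2. a \<le> b \<Longrightarrow> b - a \<le> \<delta> \<Longrightarrow>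
       (\<And>t. t \<in> {a..b} \<Longrightarrow> z1 t \<in> ball w r \<and> (z1 has_vector_derivative f (z1 t)) (at t within {a..b})) \<Longrightarrow>
       (\<And>t. t \<in> {a..b} \<Longrightarrow> z2 t \<in> ball w r \<and> (z2 has_vector_derivative f (z2 t)) (at t within {a..b})) \<Longrightarrow>
       z1 a = z2 a \<Longrightarrow> z1 b = z2 b"
proof -
  obtain r where r: "0 < r" "cball w r \<subseteq> W" using assms by (auto simp: open_contains_cball)
  obtain L where L: "0 \<le> L" "\<And>x v. x \<in> cball w r \<Longrightarrow> norm (frechet_derivative f (at x) v) \<le> L * norm v"
    using smooth_on_bound_derivative[OF assms(2) compact_cball r(2)] by blast
  define \<delta> where "\<delta> = 1 / (2 * (L + 1))"
  have \<delta>: "0 < \<delta>" "\<delta> * L \<le> 1/2" using L by (auto simp: \<delta>_def field_simps)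
  show ?thesis
  proof (rule that[OF r(1) \<delta>(1)])
    fix a b z1 z2
    assume ab: "a \<le> b" "b - a \<le> \<delta>"
      and z1: "\<And>t. t \<in> {a..b} \<Longrightarrow> z1 t \<in> ball w r \<and> (z1 has_vector_derivative f (z1 t)) (at t within {a..b})"
      and z2: "\<And>t. t \<in> {a..b} \<Longrightarrow> z2 t \<in> ball w r \<and> (z2 has_vector_derivative f (z2 t)) (at t within {a..b})"
      and eq: "z1 a = z2 a"
    have "norm (z1 b - z2 b) \<le> 2 * (norm (z1 a - z2 a) + (b - a) * 0)"
    proof (rule norm_le_if_derivative_le_affine[where e = "\<lambda>t. z1 t - z2 t" and L = L])
      show "((\<lambda>t. z1 t - z2 t) has_vector_derivative f (z1 t) - f (z2 t)) (at t within {a..b})"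
        if "t \<in> {a..b}" for t
        using z1 z2 that by (intro has_vector_derivative_diff) auto
      show "norm (f (z1 t) - f (z2 t)) \<le> L * norm (z1 t - z2 t) + 0" if "t \<in> {a..b}" for t
        using smooth_on_lipschitz[OF assms(2) convex_cball r(2) L, of "z1 t" "z2 t"] z1[OF that] z2[OF that]
        by simp
      show "(b - a) * L \<le> 1/2" using ab(2) \<delta>(2) L(1) by (meson mult_right_mono order_trans)
    qed (use ab L in auto)
    with eq show "z1 b = z2 b" by simp
  qed
qed

text \<open>The Lipschitz constant \<open>L\<close> and the bound \<open>B\<close> of \<open>f\<close> on a compact ball determine \<open>\<delta>\<close>: solutions that start in the
concentric ball of half the radius cannot leave the large one before time \<open>\<delta>\<close>, so there the equation may be
replaced by one that is globally Lipschitz.\<close>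

lemma ode_local_flow:
  fixes f :: "'z::euclidean_space \<Rightarrow> 'z"
  assumes "open W" "smooth_on f W" "w \<in> W"
  obtains r \<delta> \<phi> where "0 < r" "0 < \<delta>" "\<And>z. z \<in> ball w r \<Longrightarrow> \<phi> z 0 = z"
    "\<And>z t. z \<in> ball w r \<Longrightarrow> t \<in> {0..\<delta>} \<Longrightarrow> \<phi> z t \<in> W"
    "\<And>z t. z \<in> ball w r \<Longrightarrow> t \<in> {0..\<delta>} \<Longrightarrow> (\<phi> z has_vector_derivative f (\<phi> z t)) (at t within {0..\<delta>})"
    "\<And>z t. z \<in> ball w r \<Longrightarrow> t \<in> {0..\<delta>} \<Longrightarrow> (\<lambda>z. \<phi> z t) differentiable (at z)"
proof -
  let ?f' = "\<lambda>x. frechet_derivative f (at x)"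
  obtain r0 where r0: "0 < r0" "cball w r0 \<subseteq> W" using assms by (auto simp: open_contains_cball)
  define K where "K = cball w r0"
  define r where "r = r0 / 2"
  have K: "compact K" "convex K" "closed K" "K \<noteq> {}" "K \<subseteq> W" using r0 by (auto simp: K_def)
  obtain L where L: "0 \<le> L" "\<And>x v. x \<in> K \<Longrightarrow> norm (?f' x v) \<le> L * norm v"
    using smooth_on_bound_derivative[OF assms(2) K(1,5)] by blast
  have contK: "continuous_on K f"
    using smooth_on_continuous_on[OF assms(2)] K(5) continuous_on_subset by blast
  obtain B where B: "\<And>x. x \<in> K \<Longrightarrow> norm (f x) \<le> B" "0 < B"
    using compact_imp_bounded[OF compact_continuous_image[OF contK K(1)]] by (auto simp: bounded_pos)
  \<comment> \<open>Composing with the projection onto \<open>K\<close> makes the right-hand side globally Lipschitz.\<close>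
  define F where "F x = f (closest_point K x)" for x
  have cK: "closest_point K x \<in> K" for x using K by (simp add: closest_point_in_set)
  have Flip: "norm (F x - F y) \<le> L * norm (x - y)" for x y
  proof -
    have "norm (F x - F y) \<le> L * norm (closest_point K x - closest_point K y)"
      unfolding F_def by (rule smooth_on_lipschitz[OF assms(2) K(2,5) L cK cK])
    also have "\<dots> \<le> L * norm (x - y)"
      using closest_point_lipschitz[OF K(2-4), of x y] L(1) by (simp add: dist_norm mult_left_mono)
    finally show ?thesis .
  qed
  have FB: "norm (F x) \<le> B" for x unfolding F_def using B(1) cK by blast
  have FK: "x \<in> K \<Longrightarrow> F x = f x" for x by (simp add: F_def closest_point_self)
  \<comment> \<open>The first bound makes the Picard operator contract, the second confines solutions to \<open>K\<close>.\<close>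
  define \<delta> where "\<delta> = min (1 / (2 * (L + 1))) (r / (2 * B))"
  have r: "0 < r" using r0 by (simp add: r_def)
  have "1 / (2 * (L + 1)) * L \<le> 1/2" using L by (simp add: field_simps)
  moreover have "\<delta> * L \<le> 1 / (2 * (L + 1)) * L" using L by (intro mult_right_mono) (auto simp: \<delta>_def)
  moreover have "\<delta> * B \<le> r / (2 * B) * B" using B by (intro mult_right_mono) (auto simp: \<delta>_def)
  moreover have "r / (2 * B) * B = r / 2" using B by simp
  moreover have "0 < \<delta>" using L B r by (simp add: \<delta>_def)
  ultimately have \<delta>: "0 < \<delta>" "\<delta> * L \<le> 1/2" "2 * (\<delta> * B) \<le> r" by linarith+
  have Fcont: "continuous_on X F" for X
    unfolding F_def
    by (rule continuous_on_compose2[OF contK continuous_on_closest_point[OF K(2-4)]]) (use cK in blast)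
  have "\<exists>\<phi>. \<phi> 0 = z \<and> (\<forall>t\<in>{0..\<delta>}. (\<phi> has_vector_derivative F (\<phi> t)) (at t within {0..\<delta>}))" for z
    by (rule picard_lindeloef[where L = L])
      (use \<delta> L Flip in \<open>auto intro!: continuous_on_compose2[OF Fcont[of UNIV]] continuous_intros
         simp: case_prod_unfold\<close>)
  then obtain \<phi> where \<phi>0: "\<And>z. \<phi> z 0 = z"
    and \<phi>F: "\<And>z t. t \<in> {0..\<delta>} \<Longrightarrow> (\<phi> z has_vector_derivative F (\<phi> z t)) (at t within {0..\<delta>})"
    by metis
  have \<phi>K: "\<phi> z t \<in> K" if z: "z \<in> ball w r" and t: "t \<in> {0..\<delta>}" for z t
  proof -
    have "norm (\<phi> z t - z) \<le> 2 * (norm (\<phi> z 0 - z) + (\<delta> - 0) * B)"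
    proof (rule norm_le_if_derivative_le_affine[where e = "\<lambda>t. \<phi> z t - z" and L = 0 and c = B])
      show "((\<lambda>t. \<phi> z t - z) has_vector_derivative F (\<phi> z s)) (at s within {0..\<delta>})"
        if "s \<in> {0..\<delta>}" for s
        using has_vector_derivative_diff[OF \<phi>F[OF that] has_vector_derivative_const[of z]] by simp
    qed (use t \<delta> B FB in auto)
    then have "norm (\<phi> z t - z) \<le> r" using \<delta>(3) by (simp add: \<phi>0)
    moreover have "dist w z < r" using z by simp
    ultimately have "dist w (\<phi> z t) \<le> r0"
      using dist_triangle[of w "\<phi> z t" z] by (simp add: r_def dist_norm norm_minus_commute)
    then show ?thesis by (simp add: K_def)
  qed
  have \<phi>f: "(\<phi> z has_vector_derivative f (\<phi> z t)) (at t within {0..\<delta>})"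
    if "z \<in> ball w r" "t \<in> {0..\<delta>}" for z t
    using \<phi>F[OF that(2)] FK[OF \<phi>K[OF that]] by metis
  have diff: "(\<lambda>z. \<phi> z \<tau>) differentiable (at z1)" if z1: "z1 \<in> ball w r" and \<tau>: "\<tau> \<in> {0..\<delta>}" for z1 \<tau>
  proof -
    \<comment> \<open>The derivative is the solution operator of the linearized equation along \<open>\<phi> z1\<close>.\<close>
    let ?A = "\<lambda>s. ?f' (\<phi> z1 s)"
    have linA: "linear (?A s)" if "s \<in> {0..\<delta>}" for s
      using \<phi>K[OF z1 that] K(5) smooth_on_linear_derivative[OF assms(2)] by blast
    have c\<phi>: "continuous_on {0..\<delta>} (\<phi> z1)"
      using \<phi>F by (meson continuous_on_eq_continuous_within has_vector_derivative_continuous)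
    have cA: "continuous_on {0..\<delta>} (\<lambda>s. ?A s i)" for i
      by (rule continuous_on_compose2[OF smooth_on_continuous_on[OF smooth_on_frechet_derivative[OF
              assms(2)]] c\<phi>]) (use \<phi>K[OF z1] K(5) in auto)
    have "\<exists>u. u 0 = i \<and> (\<forall>t\<in>{0..\<delta>}. (u has_vector_derivative ?A t (u t)) (at t within {0..\<delta>}))" for i
    proof (rule picard_lindeloef[where L = L])
      show "norm (?A t x - ?A t y) \<le> L * norm (x - y)" if "t \<in> {0..\<delta>}" for t x y
        using L(2)[OF \<phi>K[OF z1 that], of "x - y"] linear_diff[OF linA[OF that]] by simp
      have "continuous_on ({0..\<delta>} \<times> UNIV) (\<lambda>p. \<Sum>i\<in>Basis. (snd p \<bullet> i) *\<^sub>R ?A (fst p) i)"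
        by (intro continuous_intros continuous_on_compose2[OF cA]) auto
      then show "continuous_on ({0..\<delta>} \<times> UNIV) (\<lambda>(t, x). ?A t x)"
        by (rule continuous_on_eq) (use linear_expand_basis[OF linA] in auto)
    qed (use \<delta> L in auto)
    then obtain u where u0: "\<And>i. u i 0 = i"
      and u': "\<And>i t. t \<in> {0..\<delta>} \<Longrightarrow> (u i has_vector_derivative ?A t (u i t)) (at t within {0..\<delta>})"
      by metis
    \<comment> \<open>Superposing the solutions for the basis vectors makes the linearity in \<open>h\<close> evident.\<close>
    define v where "v h t = (\<Sum>i\<in>Basis. (h \<bullet> i) *\<^sub>R u i t)" for h t
    have v0: "v h 0 = h" for h by (simp add: v_def u0 euclidean_representation)
    have v': "(v h has_vector_derivative ?A t (v h t)) (at t within {0..\<delta>})" if t: "t \<in> {0..\<delta>}" for h t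
    proof -
      have "((\<lambda>t. \<Sum>i\<in>Basis. (h \<bullet> i) *\<^sub>R u i t) has_vector_derivative
          (\<Sum>i\<in>Basis. (h \<bullet> i) *\<^sub>R ?A t (u i t))) (at t within {0..\<delta>})"
        by (intro has_vector_derivative_sum bounded_linear.has_vector_derivative[OF
              bounded_linear_scaleR_right] u' t)
      also have "(\<Sum>i\<in>Basis. (h \<bullet> i) *\<^sub>R ?A t (u i t)) = ?A t (v h t)"
        by (simp add: v_def linear_sum[OF linA[OF t]] linear_cmul[OF linA[OF t]])
      finally show ?thesis by (simp add: v_def[abs_def])
    qed
    have "((\<lambda>z. \<phi> z \<tau>) has_derivative (\<lambda>h. v h \<tau>)) (at z1)"
      unfolding has_derivative_within_alt
    proof (intro conjI allI impI)
      show "bounded_linear (\<lambda>h. v h \<tau>)" unfolding v_def by (intro bounded_linear_intros)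
      fix \<epsilon> :: real assume \<epsilon>: "0 < \<epsilon>"
      \<comment> \<open>The remainder estimate below loses a factor \<open>4 * \<delta>\<close>.\<close>
      define \<epsilon>1 where "\<epsilon>1 = \<epsilon> / (4 * \<delta>)"
      have \<epsilon>1: "0 < \<epsilon>1" using \<epsilon> \<delta> by (simp add: \<epsilon>1_def)
      obtain \<eta> where \<eta>: "0 < \<eta>" "\<And>x y. x \<in> K \<Longrightarrow> y \<in> K \<Longrightarrow> norm (y - x) < \<eta> \<Longrightarrow>
          norm (f y - f x - ?f' x (y - x)) \<le> \<epsilon>1 * norm (y - x)"
        using smooth_on_uniform_linearization[OF assms(2) K(1,2,5) \<epsilon>1] by blast
      obtain \<rho> where \<rho>: "0 < \<rho>" "ball z1 \<rho> \<subseteq> ball w r"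
        using z1 openE[OF open_ball] by blast
      show "\<exists>d>0. \<forall>y\<in>UNIV. norm (y - z1) < d \<longrightarrow> norm (\<phi> y \<tau> - \<phi> z1 \<tau> - v (y - z1) \<tau>) \<le> \<epsilon> * norm (y - z1)"
      proof (intro exI[of _ "min \<rho> (\<eta> / 2)"] conjI ballI impI)
        fix y assume y: "norm (y - z1) < min \<rho> (\<eta> / 2)"
        then have "y \<in> ball z1 \<rho>" by (simp add: dist_norm norm_minus_commute)
        then have yb: "y \<in> ball w r" using \<rho>(2) by blast
        have near: "norm (\<phi> y s - \<phi> z1 s) \<le> 2 * norm (y - z1)" if "s \<in> {0..\<delta>}" for s
        proof -
          have "norm (\<phi> y s - \<phi> z1 s) \<le> 2 * (norm (\<phi> y 0 - \<phi> z1 0) + (\<delta> - 0) * 0)"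
          proof (rule norm_le_if_derivative_le_affine[where e = "\<lambda>t. \<phi> y t - \<phi> z1 t" and L = L])
            show "((\<lambda>t. \<phi> y t - \<phi> z1 t) has_vector_derivative F (\<phi> y t) - F (\<phi> z1 t)) (at t within {0..\<delta>})"
              if "t \<in> {0..\<delta>}" for t
              by (intro has_vector_derivative_diff \<phi>F that)
          qed (use that \<delta> L Flip in auto)
          then show ?thesis by (simp add: \<phi>0)
        qed
        let ?e = "\<lambda>t. \<phi> y t - \<phi> z1 t - v (y - z1) t"
        have "norm (?e \<tau>) \<le> 2 * (norm (?e 0) + (\<delta> - 0) * (\<epsilon>1 * (2 * norm (y - z1))))"
        proof (rule norm_le_if_derivative_le_affine[where e = ?e and L = L])
          show "(?e has_vector_derivative f (\<phi> y t) - f (\<phi> z1 t) - ?A t (v (y - z1) t)) (at t within {0..\<delta>})"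
            if "t \<in> {0..\<delta>}" for t
            by (intro has_vector_derivative_diff \<phi>f v' that yb z1)
          show "norm (f (\<phi> y t) - f (\<phi> z1 t) - ?A t (v (y - z1) t)) \<le>
              L * norm (?e t) + \<epsilon>1 * (2 * norm (y - z1))" if t: "t \<in> {0..\<delta>}" for t
          proof -
            have "norm (\<phi> y t - \<phi> z1 t) < \<eta>" using near[OF t] y by simp
            then have "norm (f (\<phi> y t) - f (\<phi> z1 t) - ?A t (\<phi> y t - \<phi> z1 t)) \<le> \<epsilon>1 * norm (\<phi> y t - \<phi> z1 t)"
              using \<eta>(2)[OF \<phi>K[OF z1 t] \<phi>K[OF yb t]] by blast
            also have "\<dots> \<le> \<epsilon>1 * (2 * norm (y - z1))" using near[OF t] \<epsilon>1 by (intro mult_left_mono) auto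
            finally have "norm (f (\<phi> y t) - f (\<phi> z1 t) - ?A t (\<phi> y t - \<phi> z1 t)) \<le> \<epsilon>1 * (2 * norm (y - z1))" .
            moreover have "norm (?A t (?e t)) \<le> L * norm (?e t)" by (rule L(2)[OF \<phi>K[OF z1 t]])
            moreover have "f (\<phi> y t) - f (\<phi> z1 t) - ?A t (v (y - z1) t) =
                (f (\<phi> y t) - f (\<phi> z1 t) - ?A t (\<phi> y t - \<phi> z1 t)) + ?A t (?e t)"
              by (simp add: linear_diff[OF linA[OF t]])
            ultimately show ?thesis by (smt (verit) norm_triangle_ineq)
          qed
        qed (use \<delta> L \<tau> \<epsilon>1 in auto)
        also have "\<dots> = \<epsilon> * norm (y - z1)"
          using \<delta>(1) by (simp add: \<phi>0 v0 \<epsilon>1_def)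
        finally show "norm (?e \<tau>) \<le> \<epsilon> * norm (y - z1)" .
      qed (use \<rho> \<eta> in auto)
    qed
    then show ?thesis by (auto simp: differentiable_def)
  qed
  show ?thesis
    by (rule that[OF r \<delta>(1), of \<phi>]) (use \<phi>0 \<phi>K K(5) \<phi>f diff in auto)
qed

section \<open>Charts, tangent vectors and coordinate frames\<close>

locale atlas_manifold =
  fixes M :: "'a topology" and A :: "('a, 'e::euclidean_space) chart set"
  assumes manifold: "smooth_manifold M A"
begin

abbreviation dtr :: "('a, 'e) chart \<Rightarrow> ('a, 'e) chart \<Rightarrow> 'a \<Rightarrow> 'e \<Rightarrow> 'e"
  where "dtr c d p \<equiv> frechet_derivative (transition c d) (at (cmap c p))"

lemma is_chart_atlas: "c \<in> A \<Longrightarrow> is_chart M c"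
  using manifold by (simp add: smooth_manifold_def smooth_atlas_def)

lemma chart_openin: "c \<in> A \<Longrightarrow> openin M (cdom c)"
  using is_chart_atlas by (simp add: is_chart_def)

lemma chart_subset: "c \<in> A \<Longrightarrow> cdom c \<subseteq> topspace M"
  using chart_openin openin_subset by blast

lemma chart_homeomorphic:
  "c \<in> A \<Longrightarrow> homeomorphic_map (subtopology M (cdom c)) (top_of_set (cmap c ` cdom c)) (cmap c)"
  using is_chart_atlas by (simp add: is_chart_def)

lemma chart_inj: "c \<in> A \<Longrightarrow> inj_on (cmap c) (cdom c)"
  using homeomorphic_imp_injective_map[OF chart_homeomorphic[of c]] chart_subset[of c]
  by (simp add: Int_absorb1)

lemma chart_image_open:
  assumes "c \<in> A" "openin M U"
  shows "open (cmap c ` (U \<inter> cdom c))"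
proof -
  have "openin (subtopology M (cdom c)) (U \<inter> cdom c)"
    using assms(2) by (rule openin_subtopology_Int)
  then have "openin (top_of_set (cmap c ` cdom c)) (cmap c ` (U \<inter> cdom c))"
    using homeomorphic_imp_open_map[OF chart_homeomorphic[OF assms(1)]] unfolding open_map_def by blast
  moreover have "open (cmap c ` cdom c)" using is_chart_atlas[OF assms(1)] by (simp add: is_chart_def)
  ultimately show ?thesis using openin_open_trans by blast
qed

lemma chart_range_open: "c \<in> A \<Longrightarrow> open (cmap c ` cdom c)"
  using is_chart_atlas by (simp add: is_chart_def)

lemma cinv_cmap: "c \<in> A \<Longrightarrow> p \<in> cdom c \<Longrightarrow> cinv c (cmap c p) = p"
  by (simp add: cinv_def chart_inj)

lemma transition_cmap: "c \<in> A \<Longrightarrow> p \<in> cdom c \<Longrightarrow> transition c d (cmap c p) = cmap d p"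
  by (simp add: transition_def cinv_cmap)

lemma overlap_open: "c \<in> A \<Longrightarrow> d \<in> A \<Longrightarrow> open (cmap c ` (cdom c \<inter> cdom d))"
  using chart_image_open[of c "cdom d"] chart_openin by (simp add: Int_commute)

lemma transition_smooth:
  "c \<in> A \<Longrightarrow> d \<in> A \<Longrightarrow> smooth_on (transition c d) (cmap c ` (cdom c \<inter> cdom d))"
  using manifold by (simp add: smooth_manifold_def smooth_atlas_def)

lemma transition_has_derivative:
  assumes "c \<in> A" "d \<in> A" "p \<in> cdom c" "p \<in> cdom d"
  shows "(transition c d has_derivative dtr c d p) (at (cmap c p))"
  using smooth_on_has_derivative[OF transition_smooth[OF assms(1,2)]] assms by blast

lemma dtr_linear: "c \<in> A \<Longrightarrow> d \<in> A \<Longrightarrow> p \<in> cdom c \<Longrightarrow> p \<in> cdom d \<Longrightarrow> linear (dtr c d p)"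
  using transition_has_derivative has_derivative_linear by blast

lemma dtr_refl:
  assumes "c \<in> A" "p \<in> cdom c"
  shows "dtr c c p u = u"
proof -
  have "(transition c c has_derivative (\<lambda>u. u)) (at (cmap c p))"
  proof (rule has_derivative_transform_within_open[OF has_derivative_ident chart_range_open[OF assms(1)]])
    show "cmap c p \<in> cmap c ` cdom c" using assms(2) by blast
    show "x = transition c c x" if "x \<in> cmap c ` cdom c" for x
      using that transition_cmap[OF assms(1)] by (elim imageE) simp
  qed
  from frechet_derivative_at[OF this] show ?thesis by metis
qed

lemma dtr_trans:
  assumes "c \<in> A" "d \<in> A" "e \<in> A" "p \<in> cdom c" "p \<in> cdom d" "p \<in> cdom e"
  shows "dtr d e p (dtr c d p u) = dtr c e p u"
proof -
  let ?W = "cmap c ` ((cdom d \<inter> cdom e) \<inter> cdom c)"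
  have W: "open ?W"
    by (rule chart_image_open[OF assms(1)]) (intro openin_Int chart_openin assms)
  have 1: "(transition d e has_derivative dtr d e p) (at (transition c d (cmap c p)))"
    using transition_has_derivative[of d e p] assms by (simp add: transition_cmap)
  have "((\<lambda>x. transition d e (transition c d x)) has_derivative (\<lambda>u. dtr d e p (dtr c d p u))) (at (cmap c p))"
    by (rule has_derivative_compose[where g = "transition d e" and f = "transition c d",
          OF transition_has_derivative[OF assms(1,2,4,5)] 1])
  then have "(transition c e has_derivative (\<lambda>u. dtr d e p (dtr c d p u))) (at (cmap c p))"
    by (rule has_derivative_transform_within_open[OF _ W]) (auto simp: transition_cmap assms)
  from frechet_derivative_at[OF this] show ?thesis by metis
qed

lemma charts_at_iff: "c \<in> charts_at A p \<longleftrightarrow> c \<in> A \<and> p \<in> cdom c"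
  by (simp add: charts_at_def)

lemma charts_at_nonempty:
  assumes "p \<in> topspace M"
  shows "\<exists>c. c \<in> charts_at A p"
proof -
  have "(\<Union>c\<in>A. cdom c) = topspace M"
    using manifold by (simp add: smooth_manifold_def smooth_atlas_def)
  then obtain c where "c \<in> A" "p \<in> cdom c" using assms by blast
  then show ?thesis using charts_at_iff by blast
qed

lemma tangent_component:
  "v \<in> tangent_space A p \<Longrightarrow> c \<in> charts_at A p \<Longrightarrow> d \<in> charts_at A p \<Longrightarrow> v d = dtr c d p (v c)"
  unfolding tangent_space_def by blast

lemma tangent_outside: "v \<in> tangent_space A p \<Longrightarrow> c \<notin> charts_at A p \<Longrightarrow> v c = 0"
  unfolding tangent_space_def by blast

lemma tangentI:
  assumes "\<And>c. c \<notin> charts_at A p \<Longrightarrow> v c = 0"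
    and "\<And>c d. c \<in> charts_at A p \<Longrightarrow> d \<in> charts_at A p \<Longrightarrow> v d = dtr c d p (v c)"
  shows "v \<in> tangent_space A p"
  using assms unfolding tangent_space_def by blast

text \<open>A tangent vector is determined by its component in any single chart around the base point.\<close>

lemma tangent_eqI:
  assumes "v \<in> tangent_space A p" "w \<in> tangent_space A p" "c \<in> charts_at A p" "v c = w c"
  shows "v = w"
proof
  fix d
  show "v d = w d"
  proof (cases "d \<in> charts_at A p")
    case True
    then show ?thesis
      using tangent_component[OF assms(1,3) True] tangent_component[OF assms(2,3) True] assms(4) by simp
  next
    case False
    then show ?thesis using tangent_outside assms(1,2) by metis
  qed
qed

lemma dtr_linear_at: "c \<in> charts_at A p \<Longrightarrow> d \<in> charts_at A p \<Longrightarrow> linear (dtr c d p)"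
  by (simp add: charts_at_iff dtr_linear)

lemma tangent_zero: "0 \<in> tangent_space A p"
  by (rule tangentI) (simp_all add: linear_0[OF dtr_linear_at])

lemma tangent_add:
  assumes "v \<in> tangent_space A p" "w \<in> tangent_space A p"
  shows "v + w \<in> tangent_space A p"
proof (rule tangentI)
  show "(v + w) d = dtr c d p ((v + w) c)" if "c \<in> charts_at A p" "d \<in> charts_at A p" for c d
    using tangent_component[OF assms(1) that] tangent_component[OF assms(2) that]
    by (simp add: linear_add[OF dtr_linear_at[OF that]])
qed (simp add: tangent_outside[OF assms(1)] tangent_outside[OF assms(2)])

lemma tangent_scaleR:
  assumes "v \<in> tangent_space A p"
  shows "r *\<^sub>R v \<in> tangent_space A p"
proof (rule tangentI)
  show "(r *\<^sub>R v) d = dtr c d p ((r *\<^sub>R v) c)" if "c \<in> charts_at A p" "d \<in> charts_at A p" for c d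
    using tangent_component[OF assms(1) that]
    by (simp add: scaleR_fun_def linear_cmul[OF dtr_linear_at[OF that]])
qed (simp add: scaleR_fun_def tangent_outside[OF assms(1)])

lemma tangent_sum:
  "(\<And>i. i \<in> I \<Longrightarrow> v i \<in> tangent_space A p) \<Longrightarrow> (\<Sum>i\<in>I. v i) \<in> tangent_space A p"
  by (induction I rule: infinite_finite_induct) (auto simp: tangent_zero tangent_add)

lemma tvec_of_apply:
  "d \<in> charts_at A p \<Longrightarrow> tvec_of A c p u d = dtr c d p u"
  by (simp add: tvec_of_def)

lemma tvec_of_self: "c \<in> charts_at A p \<Longrightarrow> tvec_of A c p u c = u"
  by (simp add: tvec_of_apply dtr_refl charts_at_iff)

lemma tvec_of_tangent:
  assumes "c \<in> charts_at A p"
  shows "tvec_of A c p u \<in> tangent_space A p"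
proof (rule tangentI)
  show "tvec_of A c p u e = dtr d e p (tvec_of A c p u d)"
    if "d \<in> charts_at A p" "e \<in> charts_at A p" for d e
    using that assms by (simp add: tvec_of_apply dtr_trans charts_at_iff)
qed (simp add: tvec_of_def)

lemma tvec_of_component:
  assumes "v \<in> tangent_space A p" "c \<in> charts_at A p"
  shows "tvec_of A c p (v c) = v"
  by (rule tangent_eqI[OF tvec_of_tangent[OF assms(2)] assms]) (simp add: tvec_of_self[OF assms(2)])

lemma sum_fun_apply: "(\<Sum>i\<in>I. f i) x = (\<Sum>i\<in>I. f i x)"
  by (induction I rule: infinite_finite_induct) auto

lemma tangent_expand:
  assumes "v \<in> tangent_space A p" "c \<in> charts_at A p"
  shows "v = (\<Sum>i\<in>Basis. (v c \<bullet> i) *\<^sub>R tvec_of A c p i)"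
proof (rule tangent_eqI[OF assms(1) _ assms(2)])
  show "(\<Sum>i\<in>Basis. (v c \<bullet> i) *\<^sub>R tvec_of A c p i) \<in> tangent_space A p"
    by (intro tangent_sum tangent_scaleR tvec_of_tangent assms)
  show "v c = (\<Sum>i\<in>Basis. (v c \<bullet> i) *\<^sub>R tvec_of A c p i) c"
    by (simp add: sum_fun_apply scaleR_fun_def tvec_of_self[OF assms(2)] euclidean_representation)
qed

lemma dtr_smooth:
  assumes "c \<in> A" "d \<in> A" "e \<in> A" "openin M U" "U \<subseteq> cdom c \<inter> cdom d"
  shows "smooth_on (\<lambda>x. dtr c d (cinv e x) i) (cmap e ` (U \<inter> cdom e))"
proof -
  let ?W = "cmap e ` (U \<inter> cdom e)"
  have W: "open ?W" by (rule chart_image_open[OF assms(3,4)])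
  have "smooth_on (\<lambda>x. frechet_derivative (transition c d) (at (transition e c x)) i) ?W"
  proof (rule smooth_on_compose[where g = "transition e c", OF W])
    show "transition e c ` ?W \<subseteq> cmap c ` (cdom c \<inter> cdom d)"
      using assms(5) by (auto simp: transition_cmap[OF assms(3), of _ c])
    show "smooth_on (\<lambda>x. frechet_derivative (transition c d) (at x) i) (cmap c ` (cdom c \<inter> cdom d))"
      by (rule smooth_on_frechet_derivative[OF transition_smooth[OF assms(1,2)]])
    show "smooth_on (transition e c) ?W"
      by (rule smooth_on_subset[OF transition_smooth[OF assms(3,1)]]) (use assms(5) in auto)
  qed
  then show ?thesis
    by (rule smooth_on_eq[OF W]) (auto simp: transition_cmap cinv_cmap assms(3))
qed

text \<open>In another chart, the components of the frame of \<open>c\<close> are derivatives of a transition map, composed with a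
further transition map.\<close>

lemma frame_smooth:
  assumes "c \<in> A" "openin M U" "U \<subseteq> cdom c"
  shows "smooth_vector_field A U (\<lambda>q. tvec_of A c q i)"
  unfolding smooth_vector_field_def
proof (intro conjI ballI)
  show "tvec_of A c p i \<in> tangent_space A p" if "p \<in> U" for p
    using assms that by (intro tvec_of_tangent) (auto simp: charts_at_iff)
  fix d assume d: "d \<in> A"
  have W: "open (cmap d ` (U \<inter> cdom d))" by (rule chart_image_open[OF d assms(2)])
  have "smooth_on (\<lambda>x. dtr c d (cinv d x) i) (cmap d ` ((U \<inter> cdom d) \<inter> cdom d))"
    by (rule dtr_smooth[OF assms(1) d d openin_Int[OF assms(2) chart_openin[OF d]]]) (use assms in blast)
  then have "smooth_on (\<lambda>x. dtr c d (cinv d x) i) (cmap d ` (U \<inter> cdom d))" by (simp add: Int_assoc)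
  then show "smooth_on (\<lambda>x. tvec_of A c (cinv d x) i d) (cmap d ` (U \<inter> cdom d))"
    by (rule smooth_on_eq[OF W]) (auto simp: cinv_cmap d tvec_of_apply charts_at_iff)
qed

lemma smooth_vector_fieldI:
  assumes "\<And>p. p \<in> U \<Longrightarrow> X p \<in> tangent_space A p"
    and "\<And>c. c \<in> A \<Longrightarrow> smooth_on (\<lambda>x. X (cinv c x) c) (cmap c ` (U \<inter> cdom c))"
  shows "smooth_vector_field A U X"
  using assms unfolding smooth_vector_field_def by blast

lemma smooth_vector_fieldD:
  assumes "smooth_vector_field A U X"
  shows "p \<in> U \<Longrightarrow> X p \<in> tangent_space A p"
    and "c \<in> A \<Longrightarrow> smooth_on (\<lambda>x. X (cinv c x) c) (cmap c ` (U \<inter> cdom c))"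
  using assms unfolding smooth_vector_field_def by blast+

lemma smooth_vector_field_cong:
  assumes "openin M U" "smooth_vector_field A U X" "\<And>q. q \<in> U \<Longrightarrow> X q = Y q"
  shows "smooth_vector_field A U Y"
proof (rule smooth_vector_fieldI)
  show "Y p \<in> tangent_space A p" if "p \<in> U" for p
    using smooth_vector_fieldD(1)[OF assms(2) that] assms(3)[OF that] by simp
  fix c assume c: "c \<in> A"
  show "smooth_on (\<lambda>x. Y (cinv c x) c) (cmap c ` (U \<inter> cdom c))"
    by (rule smooth_on_eq[OF chart_image_open[OF c assms(1)] smooth_vector_fieldD(2)[OF assms(2) c]])
      (auto simp: assms(3) cinv_cmap[OF c])
qed

lemma smooth_vector_field_add:
  assumes "openin M U" "smooth_vector_field A U X" "smooth_vector_field A U Y"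
  shows "smooth_vector_field A U (\<lambda>q. X q + Y q)"
proof (rule smooth_vector_fieldI)
  fix c assume c: "c \<in> A"
  show "smooth_on (\<lambda>x. (X (cinv c x) + Y (cinv c x)) c) (cmap c ` (U \<inter> cdom c))"
    unfolding plus_fun_apply
    by (intro smooth_on_add chart_image_open c assms smooth_vector_fieldD)
qed (intro tangent_add smooth_vector_fieldD[OF assms(2)] smooth_vector_fieldD[OF assms(3)])

lemma smooth_vector_field_scaleR:
  assumes "openin M U" "smooth_function A U f" "smooth_vector_field A U Y"
  shows "smooth_vector_field A U (\<lambda>q. f q *\<^sub>R Y q)"
proof (rule smooth_vector_fieldI)
  fix c assume c: "c \<in> A"
  have "smooth_on (\<lambda>x. f (cinv c x)) (cmap c ` (U \<inter> cdom c))"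
    using assms(2) c unfolding smooth_function_def by blast
  then show "smooth_on (\<lambda>x. (f (cinv c x) *\<^sub>R Y (cinv c x)) c) (cmap c ` (U \<inter> cdom c))"
    unfolding scaleR_fun_def
    by (intro smooth_on_scaleR chart_image_open c assms smooth_vector_fieldD)
qed (intro tangent_scaleR smooth_vector_fieldD[OF assms(3)])

lemma smooth_vector_field_zero: "openin M U \<Longrightarrow> smooth_vector_field A U (\<lambda>q. 0)"
  by (rule smooth_vector_fieldI) (simp_all add: tangent_zero smooth_on_const chart_image_open)

lemma smooth_vector_field_sum:
  "openin M U \<Longrightarrow> (\<And>i. i \<in> I \<Longrightarrow> smooth_vector_field A U (Y i)) \<Longrightarrow>
    smooth_vector_field A U (\<lambda>q. \<Sum>i\<in>I. Y i q)"
  by (induction I rule: infinite_finite_induct)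
    (auto simp: smooth_vector_field_zero smooth_vector_field_add)

end

section \<open>Linear connections in charts\<close>

locale manifold_with_connection = atlas_manifold M A
  for M :: "'a topology" and A :: "('a, 'e::euclidean_space) chart set" +
  fixes D :: "('a, 'e) connection"
  assumes connection: "linear_connection M A D"
begin

lemma connection_axioms_at:
  assumes "openin M U" "p \<in> U" "smooth_vector_field A U Y"
  shows "(\<forall>v\<in>tangent_space A p. D p v Y \<in> tangent_space A p) \<and>
    (\<forall>v\<in>tangent_space A p. \<forall>w\<in>tangent_space A p. \<forall>r.
       D p (r *\<^sub>R v + w) Y = r *\<^sub>R D p v Y + D p w Y) \<and>
    (\<forall>v\<in>tangent_space A p. \<forall>Z. smooth_vector_field A U Z \<longrightarrow>
       D p v (\<lambda>q. Y q + Z q) = D p v Y + D p v Z) \<and>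
    (\<forall>v\<in>tangent_space A p. \<forall>f. smooth_function A U f \<longrightarrow>
       (\<forall>c\<in>charts_at A p.
          D p v (\<lambda>q. f q *\<^sub>R Y q) = dir_deriv c p v f *\<^sub>R Y p + f p *\<^sub>R D p v Y))"
  by (rule connection[unfolded linear_connection_def, THEN spec, THEN mp, OF assms(1), THEN conjunct1,
        THEN bspec, OF assms(2), THEN spec, THEN mp, OF assms(3)])

lemma connection_tangent:
  assumes "openin M U" "p \<in> U" "smooth_vector_field A U Y" "v \<in> tangent_space A p"
  shows "D p v Y \<in> tangent_space A p"
  by (rule connection_axioms_at[OF assms(1-3), THEN conjunct1, THEN bspec, OF assms(4)])

lemma connection_linear:
  assumes "openin M U" "p \<in> U" "smooth_vector_field A U Y" "v \<in> tangent_space A p" "w \<in> tangent_space A p"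
  shows "D p (r *\<^sub>R v + w) Y = r *\<^sub>R D p v Y + D p w Y"
  by (rule connection_axioms_at[OF assms(1-3), THEN conjunct2, THEN conjunct1, THEN bspec, OF assms(4),
        THEN bspec, OF assms(5), THEN spec])

lemma connection_add:
  assumes "openin M U" "p \<in> U" "smooth_vector_field A U Y" "smooth_vector_field A U Z" "v \<in> tangent_space A p"
  shows "D p v (\<lambda>q. Y q + Z q) = D p v Y + D p v Z"
  by (rule connection_axioms_at[OF assms(1-3), THEN conjunct2, THEN conjunct2, THEN conjunct1, THEN bspec,
        OF assms(5), THEN spec, THEN mp, OF assms(4)])

lemma connection_leibniz:
  assumes "openin M U" "p \<in> U" "smooth_vector_field A U Y" "smooth_function A U f"
    "v \<in> tangent_space A p" "c \<in> charts_at A p"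
  shows "D p v (\<lambda>q. f q *\<^sub>R Y q) = dir_deriv c p v f *\<^sub>R Y p + f p *\<^sub>R D p v Y"
  by (rule connection_axioms_at[OF assms(1-3), THEN conjunct2, THEN conjunct2, THEN conjunct2, THEN bspec,
        OF assms(5), THEN spec, THEN mp, OF assms(4), THEN bspec, OF assms(6)])

lemma connection_smooth:
  assumes "openin M U" "smooth_vector_field A U X" "smooth_vector_field A U Y"
  shows "smooth_vector_field A U (\<lambda>p. D p (X p) Y)"
  by (rule connection[unfolded linear_connection_def, THEN spec, THEN mp, OF assms(1), THEN conjunct2,
        THEN spec, THEN spec, THEN mp, OF assms(2), THEN mp, OF assms(3)])

text \<open>Fields that agree on \<open>U\<close> become globally equal when multiplied by the indicator function of \<open>U\<close>. That
function is smooth on \<open>U\<close>, where it is constantly \<open>1\<close>, so by the Leibniz rule the multiplication does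
not change covariant derivatives at points of \<open>U\<close>.\<close>

lemma connection_local:
  assumes U: "openin M U" "p \<in> U" and Y: "smooth_vector_field A U Y"
    and eq: "\<And>q. q \<in> U \<Longrightarrow> Y q = Z q" and v: "v \<in> tangent_space A p"
  shows "D p v Y = D p v Z"
proof -
  let ?f = "\<lambda>q. if q \<in> U then 1 else 0 :: real"
  have f: "smooth_function A U ?f"
    unfolding smooth_function_def
  proof
    fix c assume c: "c \<in> A"
    show "smooth_on (\<lambda>x. ?f (cinv c x)) (cmap c ` (U \<inter> cdom c))"
      by (rule smooth_on_eq[OF chart_image_open[OF c U(1)] smooth_on_const[OF chart_image_open[OF c U(1)], of 1]])
        (auto simp: cinv_cmap[OF c])
  qed
  obtain c where c: "c \<in> charts_at A p" using charts_at_nonempty U openin_subset by blast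
  then have cA: "c \<in> A" "p \<in> cdom c" by (auto simp: charts_at_iff)
  have d: "dir_deriv c p v ?f = 0"
  proof -
    have "((\<lambda>x. ?f (cinv c x)) has_derivative (\<lambda>_. 0)) (at (cmap c p))"
    proof (rule has_derivative_transform_within_open[OF has_derivative_const[of 1]])
      show "open (cmap c ` (U \<inter> cdom c))" by (rule chart_image_open[OF cA(1) U(1)])
      show "cmap c p \<in> cmap c ` (U \<inter> cdom c)" using c U by (simp add: charts_at_iff)
    qed (auto simp: cinv_cmap[OF cA(1)])
    from frechet_derivative_at[OF this] show ?thesis unfolding dir_deriv_def by metis
  qed
  have *: "D p v (\<lambda>q. ?f q *\<^sub>R W q) = D p v W" if W: "smooth_vector_field A U W" for W
    using connection_leibniz[OF U W f v c] d U(2) by simp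
  have Z: "smooth_vector_field A U Z" by (rule smooth_vector_field_cong[OF U(1) Y eq])
  have "(\<lambda>q. ?f q *\<^sub>R Y q) = (\<lambda>q. ?f q *\<^sub>R Z q)" using eq by auto
  then show ?thesis using *[OF Y] *[OF Z] by metis
qed

lemma connection_zero:
  assumes "openin M U" "p \<in> U" "v \<in> tangent_space A p"
  shows "D p v (\<lambda>q. 0) = 0"
  using connection_add[OF assms(1,2) smooth_vector_field_zero smooth_vector_field_zero assms(3)] assms(1)
  by simp

lemma connection_sum:
  assumes "openin M U" "p \<in> U" "v \<in> tangent_space A p"
    and Y: "\<And>i. i \<in> I \<Longrightarrow> smooth_vector_field A U (Y i)"
  shows "D p v (\<lambda>q. \<Sum>i\<in>I. Y i q) = (\<Sum>i\<in>I. D p v (Y i))"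
  using Y
proof (induction I rule: infinite_finite_induct)
  case (insert i I)
  have "D p v (\<lambda>q. Y i q + (\<Sum>i\<in>I. Y i q)) = D p v (Y i) + D p v (\<lambda>q. \<Sum>i\<in>I. Y i q)"
    using insert.prems
    by (intro connection_add[OF assms(1,2) _ _ assms(3)] smooth_vector_field_sum[OF assms(1)]) simp_all
  with insert show ?case by (simp only: sum.insert[OF insert.hyps] insertI2)
qed (use connection_zero[OF assms(1-3)] in auto)

lemma connection_linear_zero:
  assumes "openin M U" "p \<in> U" "smooth_vector_field A U Y"
  shows "D p 0 Y = 0"
  using connection_linear[OF assms tangent_zero tangent_zero, of 1] by simp

lemma connection_linear_sum:
  assumes "openin M U" "p \<in> U" "smooth_vector_field A U Y"
    and v: "\<And>i. i \<in> I \<Longrightarrow> v i \<in> tangent_space A p"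
  shows "D p (\<Sum>i\<in>I. r i *\<^sub>R v i) Y = (\<Sum>i\<in>I. r i *\<^sub>R D p (v i) Y)"
  using v
proof (induction I rule: infinite_finite_induct)
  case (insert i I)
  have "D p (r i *\<^sub>R v i + (\<Sum>i\<in>I. r i *\<^sub>R v i)) Y = r i *\<^sub>R D p (v i) Y + D p (\<Sum>i\<in>I. r i *\<^sub>R v i) Y"
    using insert.prems by (intro connection_linear[OF assms(1-3)] tangent_sum tangent_scaleR) auto
  with insert show ?case by (simp only: sum.insert[OF insert.hyps] insertI2)
qed (use connection_linear_zero[OF assms(1-3)] in auto)

text \<open>In coordinates this is the quadratic form \<open>\<Gamma>(x)(v, v)\<close> of the Christoffel symbols, so that
geodesics satisfy \<open>x'' = - \<Gamma>(x)(x', x')\<close>.\<close>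

definition christoffel :: "('a, 'e) chart \<Rightarrow> 'a \<Rightarrow> ('a, 'e) tvec \<Rightarrow> 'e"
  where "christoffel c p v = (\<Sum>i\<in>Basis. (v c \<bullet> i) *\<^sub>R D p v (\<lambda>q. tvec_of A c q i) c)"

abbreviation ddtr :: "('a, 'e) chart \<Rightarrow> ('a, 'e) chart \<Rightarrow> 'a \<Rightarrow> 'e \<Rightarrow> 'e \<Rightarrow> 'e"
  where "ddtr c d p i \<equiv> frechet_derivative (\<lambda>x. frechet_derivative (transition c d) (at x) i) (at (cmap c p))"

text \<open>On the overlap of two charts, the frame of \<open>c\<close> is a combination of the frame of \<open>d\<close> with
the derivatives of the transition map as coefficients. Differentiating these coefficients by the Leibniz rule
produces the second derivative of the transition map.\<close>

lemma connection_change_of_frame: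
  assumes c: "c \<in> charts_at A p" and d: "d \<in> charts_at A p" and v: "v \<in> tangent_space A p"
  shows "D p v (\<lambda>q. tvec_of A c q i) d =
    ddtr c d p i (v c) + (\<Sum>j\<in>Basis. (dtr c d p i \<bullet> j) *\<^sub>R D p v (\<lambda>q. tvec_of A d q j) d)"
proof -
  have cA: "c \<in> A" "p \<in> cdom c" and dA: "d \<in> A" "p \<in> cdom d" using c d by (auto simp: charts_at_iff)
  let ?U = "cdom c \<inter> cdom d"
  let ?f = "\<lambda>j q. dtr c d q i \<bullet> j"
  have U: "openin M ?U" "p \<in> ?U" using openin_Int[OF chart_openin[OF cA(1)] chart_openin[OF dA(1)]] cA dA by auto
  have f: "smooth_function A ?U (?f j)" for j
    unfolding smooth_function_def
  proof
    fix e assume e: "e \<in> A"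
    show "smooth_on (\<lambda>x. dtr c d (cinv e x) i \<bullet> j) (cmap e ` (?U \<inter> cdom e))"
      by (rule smooth_on_bounded_linear[OF chart_image_open[OF e U(1)] bounded_linear_inner_left
            dtr_smooth[OF cA(1) dA(1) e U(1)]]) simp
  qed
  have sc: "smooth_vector_field A ?U (\<lambda>q. tvec_of A c q i)"
    by (rule frame_smooth[OF cA(1) U(1)]) simp
  have sd: "smooth_vector_field A ?U (\<lambda>q. tvec_of A d q j)" for j
    by (rule frame_smooth[OF dA(1) U(1)]) simp
  have sfd: "smooth_vector_field A ?U (\<lambda>q. ?f j q *\<^sub>R tvec_of A d q j)" for j
    by (rule smooth_vector_field_scaleR[OF U(1) f sd])
  have "D p v (\<lambda>q. tvec_of A c q i) = D p v (\<lambda>q. \<Sum>j\<in>Basis. ?f j q *\<^sub>R tvec_of A d q j)"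
  proof (rule connection_local[OF U sc _ v])
    fix q assume "q \<in> ?U"
    then have q: "c \<in> charts_at A q" "d \<in> charts_at A q" using cA dA by (auto simp: charts_at_iff)
    show "tvec_of A c q i = (\<Sum>j\<in>Basis. ?f j q *\<^sub>R tvec_of A d q j)"
      using tangent_expand[OF tvec_of_tangent[OF q(1), of i] q(2)] by (simp add: tvec_of_apply[OF q(2)])
  qed
  also have "\<dots> = (\<Sum>j\<in>Basis. D p v (\<lambda>q. ?f j q *\<^sub>R tvec_of A d q j))"
    by (rule connection_sum[OF U v sfd])
  also have "\<dots> = (\<Sum>j\<in>Basis. dir_deriv c p v (?f j) *\<^sub>R tvec_of A d p j + ?f j p *\<^sub>R D p v (\<lambda>q. tvec_of A d q j))"
    by (intro sum.cong refl connection_leibniz[OF U sd f v c])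
  finally have eq: "D p v (\<lambda>q. tvec_of A c q i) d =
      (\<Sum>j\<in>Basis. dir_deriv c p v (?f j) *\<^sub>R j + ?f j p *\<^sub>R D p v (\<lambda>q. tvec_of A d q j) d)"
    by (simp add: sum_fun_apply scaleR_fun_def tvec_of_self[OF d])
  have dd: "dir_deriv c p v (?f j) = ddtr c d p i (v c) \<bullet> j" for j
  proof -
    have W: "open (cmap c ` ?U)" by (rule overlap_open[OF cA(1) dA(1)])
    have "((\<lambda>x. frechet_derivative (transition c d) (at x) i \<bullet> j) has_derivative (\<lambda>u. ddtr c d p i u \<bullet> j)) (at (cmap c p))"
      by (rule bounded_linear.has_derivative[OF bounded_linear_inner_left],
          rule smooth_on_has_derivative[OF smooth_on_frechet_derivative[OF transition_smooth[OF cA(1) dA(1)]]])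
        (use U in blast)
    then have "((\<lambda>x. ?f j (cinv c x)) has_derivative (\<lambda>u. ddtr c d p i u \<bullet> j)) (at (cmap c p))"
      by (rule has_derivative_transform_within_open[OF _ W]) (use U in \<open>auto simp: cinv_cmap[OF cA(1)]\<close>)
    from frechet_derivative_at[OF this] show ?thesis unfolding dir_deriv_def by metis
  qed
  show ?thesis unfolding eq dd by (simp add: sum.distrib euclidean_representation)
qed

lemma connection_frame_tangent:
  assumes "c \<in> charts_at A p" "v \<in> tangent_space A p"
  shows "D p v (\<lambda>q. tvec_of A c q i) \<in> tangent_space A p"
proof -
  have c: "c \<in> A" "p \<in> cdom c" using assms by (auto simp: charts_at_iff)
  show ?thesis
    by (rule connection_tangent[OF chart_openin[OF c(1)] c(2) frame_smooth[OF c(1) chart_openin[OF c(1)] order_refl] assms(2)])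
qed

text \<open>The familiar inhomogeneous transformation rule of the Christoffel symbols, contracted twice with \<open>v\<close>.\<close>

lemma christoffel_change_of_chart:
  assumes c: "c \<in> charts_at A p" and d: "d \<in> charts_at A p" and v: "v \<in> tangent_space A p"
  shows "dtr c d p (christoffel c p v) = (\<Sum>i\<in>Basis. (v c \<bullet> i) *\<^sub>R ddtr c d p i (v c)) + christoffel d p v"
proof -
  have l: "linear (dtr c d p)" by (rule dtr_linear_at[OF c d])
  let ?Dd = "\<lambda>j. D p v (\<lambda>q. tvec_of A d q j) d"
  have "dtr c d p (christoffel c p v) = (\<Sum>i\<in>Basis. (v c \<bullet> i) *\<^sub>R D p v (\<lambda>q. tvec_of A c q i) d)"
    unfolding christoffel_def
    by (simp add: linear_sum[OF l] linear_cmul[OF l] tangent_component[OF connection_frame_tangent[OF c v] c d])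
  also have "\<dots> = (\<Sum>i\<in>Basis. (v c \<bullet> i) *\<^sub>R ddtr c d p i (v c)) +
      (\<Sum>i\<in>Basis. (v c \<bullet> i) *\<^sub>R (\<Sum>j\<in>Basis. (dtr c d p i \<bullet> j) *\<^sub>R ?Dd j))"
    by (simp add: connection_change_of_frame[OF c d v] scaleR_add_right sum.distrib)
  also have "(\<Sum>i\<in>Basis. (v c \<bullet> i) *\<^sub>R (\<Sum>j\<in>Basis. (dtr c d p i \<bullet> j) *\<^sub>R ?Dd j)) =
      (\<Sum>j\<in>Basis. \<Sum>i\<in>Basis. ((v c \<bullet> i) * (dtr c d p i \<bullet> j)) *\<^sub>R ?Dd j)"
    by (subst sum.swap) (simp add: scaleR_sum_right)
  also have "\<dots> = (\<Sum>j\<in>Basis. ((\<Sum>i\<in>Basis. (v c \<bullet> i) *\<^sub>R dtr c d p i) \<bullet> j) *\<^sub>R ?Dd j)"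
    by (simp add: inner_sum_left scaleR_sum_left)
  also have "(\<Sum>i\<in>Basis. (v c \<bullet> i) *\<^sub>R dtr c d p i) = v d"
    by (simp add: tangent_component[OF v c d] flip: linear_expand_basis[OF l])
  finally show ?thesis by (simp add: christoffel_def)
qed

end

section \<open>The equation of motion in charts\<close>

lemma has_vector_derivative_chain:
  assumes "(g has_vector_derivative g') (at t within S)" "(f has_derivative f') (at (g t))"
  shows "((\<lambda>s. f (g s)) has_vector_derivative f' g') (at t within S)"
proof -
  have "((\<lambda>s. f (g s)) has_derivative (\<lambda>h. f' (h *\<^sub>R g'))) (at t within S)"
    by (rule has_derivative_compose[where g = f and f = g,
          OF assms(1)[unfolded has_vector_derivative_def] assms(2)])
  then show ?thesis
    unfolding has_vector_derivative_def by (simp add: linear_cmul[OF has_derivative_linear[OF assms(2)]])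
qed

lemma has_vector_derivative_transform_eventually:
  assumes "(f has_vector_derivative f') (at t within S)" "\<forall>\<^sub>F s in at t within S. f s = g s" "t \<in> S" "f t = g t"
  shows "(g has_vector_derivative f') (at t within S)"
  using has_derivative_transform_eventually[OF assms(1)[unfolded has_vector_derivative_def] assms(2,4,3)]
  unfolding has_vector_derivative_def .

locale forced_connection = manifold_with_connection M A D
  for M :: "'a topology" and A :: "('a, 'e::euclidean_space) chart set" and D :: "('a, 'e) connection" +
  fixes F :: "'a \<Rightarrow> ('a, 'e) tvec \<Rightarrow> ('a, 'e) tvec"
  assumes tensor: "tensor_field_1_1 M A F"
begin

lemma tensor_tangent:
  assumes "p \<in> topspace M" "v \<in> tangent_space A p"
  shows "F p v \<in> tangent_space A p"
  using tensor assms unfolding tensor_field_1_1_def by blast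

lemma tensor_linear:
  assumes "p \<in> topspace M" "v \<in> tangent_space A p" "w \<in> tangent_space A p"
  shows "F p (r *\<^sub>R v + w) = r *\<^sub>R F p v + F p w"
  using tensor assms unfolding tensor_field_1_1_def by blast

lemma tensor_smooth:
  assumes "openin M U" "smooth_vector_field A U X"
  shows "smooth_vector_field A U (\<lambda>p. F p (X p))"
  using tensor assms unfolding tensor_field_1_1_def by blast

lemma tensor_sum:
  assumes p: "p \<in> topspace M" and v: "\<And>i. i \<in> I \<Longrightarrow> v i \<in> tangent_space A p"
  shows "F p (\<Sum>i\<in>I. r i *\<^sub>R v i) = (\<Sum>i\<in>I. r i *\<^sub>R F p (v i))"
proof -
  have 0: "F p 0 = 0"
    using tensor_linear[OF p tangent_zero tangent_zero, of 1] by simp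
  show ?thesis
    using v
  proof (induction I rule: infinite_finite_induct)
    case (insert i I)
    have "F p (r i *\<^sub>R v i + (\<Sum>i\<in>I. r i *\<^sub>R v i)) = r i *\<^sub>R F p (v i) + F p (\<Sum>i\<in>I. r i *\<^sub>R v i)"
      using insert.prems by (intro tensor_linear[OF p] tangent_sum tangent_scaleR) auto
    with insert show ?case by (simp only: sum.insert[OF insert.hyps] insertI2)
  qed (use 0 in auto)
qed

text \<open>The second derivative \<open>v'\<close> that the equation with parameter \<open>k\<close> prescribes in the chart \<open>c\<close>.\<close>

definition accel :: "real \<Rightarrow> ('a, 'e) chart \<Rightarrow> 'a \<Rightarrow> ('a, 'e) tvec \<Rightarrow> 'e"
  where "accel k c p v = k *\<^sub>R F p v c - christoffel c p v"

lemma charts_at_topspace: "c \<in> charts_at A p \<Longrightarrow> p \<in> topspace M"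
  using chart_subset charts_at_iff by blast

lemma accel_change_of_chart:
  assumes c: "c \<in> charts_at A p" and d: "d \<in> charts_at A p" and v: "v \<in> tangent_space A p"
  shows "accel k d p v = dtr c d p (accel k c p v) + (\<Sum>i\<in>Basis. (v c \<bullet> i) *\<^sub>R ddtr c d p i (v c))"
proof -
  have l: "linear (dtr c d p)" by (rule dtr_linear_at[OF c d])
  have "F p v d = dtr c d p (F p v c)"
    by (rule tangent_component[OF tensor_tangent[OF charts_at_topspace[OF c] v] c d])
  then show ?thesis
    using christoffel_change_of_chart[OF c d v]
    by (simp add: accel_def linear_diff[OF l] linear_cmul[OF l])
qed

text \<open>The equation in the chart \<open>c\<close> as an autonomous first-order system for \<open>z = (x, v, k)\<close>. The constant
parameter \<open>k\<close> is part of the state, so that dependence on it is dependence on an initial value.\<close>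

definition chart_ode :: "('a, 'e) chart \<Rightarrow> 'e \<times> 'e \<times> real \<Rightarrow> 'e \<times> 'e \<times> real"
  where "chart_ode c z = (fst (snd z),
    accel (snd (snd z)) c (cinv c (fst z)) (tvec_of A c (cinv c (fst z)) (fst (snd z))), 0)"

lemma chart_ode_state:
  assumes "c \<in> charts_at A p" "v \<in> tangent_space A p"
  shows "chart_ode c (cmap c p, v c, k) = (v c, accel k c p v, 0)"
  using assms by (simp add: chart_ode_def charts_at_iff cinv_cmap tvec_of_component[OF assms(2,1)])

text \<open>By linearity, the force and the Christoffel term are polynomials in the components of \<open>v\<close> whose coefficients
are the values of \<open>F\<close> and \<open>D\<close> on the coordinate frame, and these are smooth by assumption.\<close>

lemma chart_ode_smooth:
  assumes c: "c \<in> A"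
  shows "smooth_on (chart_ode c) ((cmap c ` cdom c) \<times> UNIV)"
proof -
  let ?W = "cmap c ` cdom c" and ?S = "(cmap c ` cdom c) \<times> (UNIV :: ('e \<times> real) set)"
  let ?E = "\<lambda>j q. tvec_of A c q j"
  have U: "openin M (cdom c)" by (rule chart_openin[OF c])
  have E: "smooth_vector_field A (cdom c) (?E j)" for j
    by (rule frame_smooth[OF c U order_refl])
  have S: "open ?S" by (intro open_Times chart_range_open c open_UNIV)
  let ?f = "\<lambda>j x. F (cinv c x) (?E j (cinv c x)) c"
  let ?g = "\<lambda>i j x. D (cinv c x) (?E j (cinv c x)) (?E i) c"
  have f: "smooth_on (?f j) ?W" for j
    using smooth_vector_fieldD(2)[OF tensor_smooth[OF U E] c] by simp
  have g: "smooth_on (?g i j) ?W" for i j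
    using smooth_vector_fieldD(2)[OF connection_smooth[OF U E E] c] by simp
  let ?u = "\<lambda>z::'e \<times> 'e \<times> real. fst (snd z)"
  have bl: "bounded_linear ?u" "bounded_linear (\<lambda>z::'e \<times> 'e \<times> real. snd (snd z))"
    "bounded_linear (\<lambda>z::'e \<times> 'e \<times> real. fst z)"
    using bounded_linear_compose[OF bounded_linear_fst bounded_linear_snd]
      bounded_linear_compose[OF bounded_linear_snd bounded_linear_snd] bounded_linear_fst by auto
  have proj: "smooth_on (\<lambda>z. ?u z \<bullet> i) ?S" "smooth_on ?u ?S" "smooth_on (\<lambda>z. snd (snd z)) ?S"
    "smooth_on (\<lambda>z. fst z) ?S" for i
    by (rule smooth_on_bounded_linear[OF S bounded_linear_inner_left] smooth_on_linear[OF S] bl)+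
  have comp: "smooth_on (\<lambda>z. h (fst z)) ?S" if "smooth_on h ?W" for h :: "'e \<Rightarrow> 'e"
    by (rule smooth_on_compose[where g = fst and f = h, OF S _ that]) (use proj(4) in auto)
  let ?F = "\<lambda>z. \<Sum>j\<in>Basis. (?u z \<bullet> j) *\<^sub>R ?f j (fst z)"
  let ?G = "\<lambda>z. \<Sum>i\<in>Basis. (?u z \<bullet> i) *\<^sub>R (\<Sum>j\<in>Basis. (?u z \<bullet> j) *\<^sub>R ?g i j (fst z))"
  have F: "smooth_on ?F ?S"
    by (rule smooth_on_sum[OF S]) (rule smooth_on_scaleR[OF S proj(1) comp[OF f]])
  have G: "smooth_on ?G ?S"
    by (rule smooth_on_sum[OF S], rule smooth_on_scaleR[OF S proj(1)], rule smooth_on_sum[OF S],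
        rule smooth_on_scaleR[OF S proj(1) comp[OF g]])
  have bl1: "bounded_linear (\<lambda>u::'e. (u, 0::'e, 0::real))" "bounded_linear (\<lambda>u::'e. (0::'e, u, 0::real))"
    by (intro bounded_linear_Pair bounded_linear_ident bounded_linear_zero)+
  have "smooth_on (\<lambda>z. (?u z, 0, 0 :: real) + (0, snd (snd z) *\<^sub>R ?F z + (- 1) *\<^sub>R ?G z, 0)) ?S"
  proof -
    have 1: "smooth_on (\<lambda>z. (?u z, 0 :: 'e, 0 :: real)) ?S"
      by (rule smooth_on_bounded_linear[OF S bl1(1) proj(2)])
    have "smooth_on (\<lambda>z. snd (snd z) *\<^sub>R ?F z) ?S" by (rule smooth_on_scaleR[OF S proj(3) F])
    moreover have "smooth_on (\<lambda>z. (- 1) *\<^sub>R ?G z) ?S"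
      by (rule smooth_on_bounded_linear[OF S bounded_linear_scaleR_right G])
    ultimately have "smooth_on (\<lambda>z. snd (snd z) *\<^sub>R ?F z + (- 1) *\<^sub>R ?G z) ?S"
      by (rule smooth_on_add[OF S])
    then have 2: "smooth_on (\<lambda>z. (0 :: 'e, snd (snd z) *\<^sub>R ?F z + (- 1) *\<^sub>R ?G z, 0 :: real)) ?S"
      by (rule smooth_on_bounded_linear[OF S bl1(2)])
    show ?thesis by (rule smooth_on_add[OF S 1 2])
  qed
  then show ?thesis
  proof (rule smooth_on_eq[OF S])
    fix z :: "'e \<times> 'e \<times> real" assume z: "z \<in> ?S"
    let ?q = "cinv c (fst z)"
    have q: "?q \<in> cdom c" using z cinv_cmap[OF c] by (elim SigmaE imageE) simp
    have cq: "c \<in> charts_at A ?q" using c q by (simp add: charts_at_iff)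
    have T: "?E i ?q \<in> tangent_space A ?q" for i by (rule tvec_of_tangent[OF cq])
    have ex: "tvec_of A c ?q (?u z) = (\<Sum>j\<in>Basis. (?u z \<bullet> j) *\<^sub>R ?E j ?q)"
      using tangent_expand[OF tvec_of_tangent[OF cq] cq, of "?u z"] by (simp add: tvec_of_self[OF cq])
    have 1: "F ?q (tvec_of A c ?q (?u z)) c = ?F z"
      unfolding ex tensor_sum[OF charts_at_topspace[OF cq] T] by (simp add: sum_fun_apply scaleR_fun_def)
    have 2: "D ?q (tvec_of A c ?q (?u z)) (?E i) c = (\<Sum>j\<in>Basis. (?u z \<bullet> j) *\<^sub>R ?g i j (fst z))" for i
      unfolding ex connection_linear_sum[OF U q E T] by (simp add: sum_fun_apply scaleR_fun_def)
    have 3: "christoffel c ?q (tvec_of A c ?q (?u z)) = ?G z"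
      unfolding christoffel_def 2 by (simp add: tvec_of_self[OF cq])
    show "(?u z, 0, 0) + (0, snd (snd z) *\<^sub>R ?F z + (- 1) *\<^sub>R ?G z, 0) = chart_ode c z"
      unfolding chart_ode_def accel_def 1 3 by simp
  qed
qed

text \<open>A solution is treated as a curve \<open>\<gamma>\<close> together with its velocity \<open>V\<close>, subject to pointwise first-order
conditions. In contrast to the equation for \<open>\<gamma>\<close> alone, these conditions pass directly to concatenations
and also make sense on the degenerate interval at which the construction of solutions starts.\<close>

definition motion_in :: "real \<Rightarrow> real set \<Rightarrow> (real \<Rightarrow> 'a) \<Rightarrow> (real \<Rightarrow> ('a, 'e) tvec) \<Rightarrow> ('a, 'e) chart \<Rightarrow> real \<Rightarrow> bool"
  where "motion_in k S \<gamma> V c t \<longleftrightarrow> (\<forall>\<^sub>F s in at t within S. \<gamma> s \<in> cdom c) \<and>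
    ((\<lambda>s. cmap c (\<gamma> s)) has_vector_derivative V t c) (at t within S) \<and>
    ((\<lambda>s. V s c) has_vector_derivative accel k c (\<gamma> t) (V t)) (at t within S)"

definition motion :: "real \<Rightarrow> real set \<Rightarrow> (real \<Rightarrow> 'a) \<Rightarrow> (real \<Rightarrow> ('a, 'e) tvec) \<Rightarrow> bool"
  where "motion k S \<gamma> V \<longleftrightarrow> (\<forall>t\<in>S. \<gamma> t \<in> topspace M \<and> V t \<in> tangent_space A (\<gamma> t) \<and>
    (\<forall>c\<in>charts_at A (\<gamma> t). motion_in k S \<gamma> V c t))"

lemma motionD:
  assumes "motion k S \<gamma> V" "t \<in> S"
  shows "\<gamma> t \<in> topspace M" "V t \<in> tangent_space A (\<gamma> t)"
    and "c \<in> charts_at A (\<gamma> t) \<Longrightarrow> \<forall>\<^sub>F s in at t within S. \<gamma> s \<in> cdom c"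
    and "c \<in> charts_at A (\<gamma> t) \<Longrightarrow> ((\<lambda>s. cmap c (\<gamma> s)) has_vector_derivative V t c) (at t within S)"
    and "c \<in> charts_at A (\<gamma> t) \<Longrightarrow> ((\<lambda>s. V s c) has_vector_derivative accel k c (\<gamma> t) (V t)) (at t within S)"
  using assms unfolding motion_def motion_in_def by blast+

text \<open>Differentiability of the coordinates, together with staying in the chart, gives continuity in the
topology of the manifold.\<close>

lemma eventually_in_open:
  assumes c: "c \<in> charts_at A (\<gamma> t)" and ev: "\<forall>\<^sub>F s in at t within S. \<gamma> s \<in> cdom c"
    and d: "((\<lambda>s. cmap c (\<gamma> s)) has_vector_derivative v) (at t within S)"
    and U: "openin M U" "\<gamma> t \<in> U"
  shows "\<forall>\<^sub>F s in at t within S. \<gamma> s \<in> U"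
proof -
  have cA: "c \<in> A" "\<gamma> t \<in> cdom c" using c by (simp_all add: charts_at_iff)
  have "((\<lambda>s. cmap c (\<gamma> s)) \<longlongrightarrow> cmap c (\<gamma> t)) (at t within S)"
    using has_vector_derivative_continuous[OF d] by (simp add: continuous_within)
  then have "\<forall>\<^sub>F s in at t within S. cmap c (\<gamma> s) \<in> cmap c ` (U \<inter> cdom c)"
    by (rule topological_tendstoD[OF _ chart_image_open[OF cA(1) U(1)]]) (use U(2) cA(2) in blast)
  with ev show ?thesis
  proof eventually_elim
    case (elim s)
    then obtain p where p: "p \<in> U" "p \<in> cdom c" "cmap c (\<gamma> s) = cmap c p" by blast
    have "\<gamma> s = p" by (rule inj_onD[OF chart_inj[OF cA(1)] p(3) elim(1) p(2)])
    then show ?case using p(1) by simp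
  qed
qed

lemma chart_curve_change:
  assumes c: "c \<in> charts_at A (\<gamma> t)" and d: "d \<in> charts_at A (\<gamma> t)"
    and ev: "\<forall>\<^sub>F s in at t within S. \<gamma> s \<in> cdom c" and t: "t \<in> S"
    and v: "((\<lambda>s. cmap c (\<gamma> s)) has_vector_derivative v) (at t within S)"
  shows "((\<lambda>s. cmap d (\<gamma> s)) has_vector_derivative dtr c d (\<gamma> t) v) (at t within S)"
proof -
  have cA: "c \<in> A" "\<gamma> t \<in> cdom c" using c by (simp_all add: charts_at_iff)
  have dA: "d \<in> A" "\<gamma> t \<in> cdom d" using d by (simp_all add: charts_at_iff)
  have "((\<lambda>s. transition c d (cmap c (\<gamma> s))) has_vector_derivative dtr c d (\<gamma> t) v) (at t within S)"
    by (rule has_vector_derivative_chain[OF v transition_has_derivative[OF cA(1) dA(1) cA(2) dA(2)]])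
  moreover have "\<forall>\<^sub>F s in at t within S. transition c d (cmap c (\<gamma> s)) = cmap d (\<gamma> s)"
    using ev by eventually_elim (simp add: transition_cmap[OF cA(1)])
  ultimately show ?thesis
    by (rule has_vector_derivative_transform_eventually[OF _ _ t]) (rule transition_cmap[OF cA])
qed

text \<open>Differentiating \<open>V d = D\<tau>(x) (V c)\<close>, where \<open>\<tau>\<close> is the transition map, gives a term with the second
derivative of \<open>\<tau>\<close>. It is exactly the inhomogeneous term of \<open>accel_change_of_chart\<close>.\<close>

lemma motion_in_change_of_chart:
  assumes V: "\<And>s. s \<in> S \<Longrightarrow> V s \<in> tangent_space A (\<gamma> s)" and t: "t \<in> S"
    and c: "c \<in> charts_at A (\<gamma> t)" and d: "d \<in> charts_at A (\<gamma> t)" and m: "motion_in k S \<gamma> V c t"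
  shows "motion_in k S \<gamma> V d t"
proof -
  let ?p = "\<gamma> t"
  have cA: "c \<in> A" "?p \<in> cdom c" using c by (simp_all add: charts_at_iff)
  have dA: "d \<in> A" "?p \<in> cdom d" using d by (simp_all add: charts_at_iff)
  have mc: "\<forall>\<^sub>F s in at t within S. \<gamma> s \<in> cdom c"
    "((\<lambda>s. cmap c (\<gamma> s)) has_vector_derivative V t c) (at t within S)"
    "((\<lambda>s. V s c) has_vector_derivative accel k c (\<gamma> t) (V t)) (at t within S)"
    using m unfolding motion_in_def by blast+
  have ev: "\<forall>\<^sub>F s in at t within S. \<gamma> s \<in> cdom d"
    by (rule eventually_in_open[OF c mc(1,2) chart_openin[OF dA(1)] dA(2)])
  have x: "((\<lambda>s. cmap d (\<gamma> s)) has_vector_derivative V t d) (at t within S)"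
    using chart_curve_change[OF c d mc(1) t mc(2)] by (simp add: tangent_component[OF V[OF t] c d])
  let ?H = "\<lambda>i x. frechet_derivative (transition c d) (at x) i"
  have H: "(?H i has_derivative ddtr c d ?p i) (at (cmap c ?p))" for i
    by (rule smooth_on_has_derivative[OF smooth_on_frechet_derivative[OF transition_smooth[OF cA(1) dA(1)]]])
      (use cA dA in blast)
  have "((\<lambda>s. (V s c \<bullet> i) *\<^sub>R ?H i (cmap c (\<gamma> s))) has_vector_derivative
      (V t c \<bullet> i) *\<^sub>R ddtr c d ?p i (V t c) + (accel k c ?p (V t) \<bullet> i) *\<^sub>R ?H i (cmap c ?p)) (at t within S)" for i
  proof -
    have 1: "((\<lambda>s. V s c \<bullet> i) has_vector_derivative accel k c ?p (V t) \<bullet> i) (at t within S)"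
      by (rule bounded_linear.has_vector_derivative[OF bounded_linear_inner_left mc(3)])
    have 2: "((\<lambda>s. ?H i (cmap c (\<gamma> s))) has_vector_derivative ddtr c d ?p i (V t c)) (at t within S)"
      by (rule has_vector_derivative_chain[OF mc(2) H])
    show ?thesis
      by (rule bounded_bilinear.has_vector_derivative[OF bounded_bilinear_scaleR 1 2])
  qed
  then have "((\<lambda>s. \<Sum>i\<in>Basis. (V s c \<bullet> i) *\<^sub>R ?H i (cmap c (\<gamma> s))) has_vector_derivative
      (\<Sum>i\<in>Basis. (V t c \<bullet> i) *\<^sub>R ddtr c d ?p i (V t c) + (accel k c ?p (V t) \<bullet> i) *\<^sub>R ?H i (cmap c ?p))) (at t within S)"
    by (rule has_vector_derivative_sum)
  also have "(\<Sum>i\<in>Basis. (V t c \<bullet> i) *\<^sub>R ddtr c d ?p i (V t c) + (accel k c ?p (V t) \<bullet> i) *\<^sub>R ?H i (cmap c ?p)) =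
      accel k d ?p (V t)"
    unfolding accel_change_of_chart[OF c d V[OF t]] sum.distrib
    by (simp flip: linear_expand_basis[OF dtr_linear_at[OF c d]])
  finally have y: "((\<lambda>s. \<Sum>i\<in>Basis. (V s c \<bullet> i) *\<^sub>R ?H i (cmap c (\<gamma> s))) has_vector_derivative accel k d ?p (V t)) (at t within S)" .
  have eq: "(\<Sum>i\<in>Basis. (V s c \<bullet> i) *\<^sub>R ?H i (cmap c (\<gamma> s))) = V s d"
    if s: "s \<in> S" "\<gamma> s \<in> cdom c" "\<gamma> s \<in> cdom d" for s
  proof -
    have cd: "c \<in> charts_at A (\<gamma> s)" "d \<in> charts_at A (\<gamma> s)"
      using s cA dA by (simp_all add: charts_at_iff)
    show ?thesis
      unfolding tangent_component[OF V[OF s(1)] cd] by (rule linear_expand_basis[OF dtr_linear_at[OF cd], symmetric])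
  qed
  have "\<forall>\<^sub>F s in at t within S. s \<in> S" by (simp add: eventually_at_topological, blast)
  then have "\<forall>\<^sub>F s in at t within S. (\<Sum>i\<in>Basis. (V s c \<bullet> i) *\<^sub>R ?H i (cmap c (\<gamma> s))) = V s d"
    using mc(1) ev by eventually_elim (rule eq)
  then have "((\<lambda>s. V s d) has_vector_derivative accel k d ?p (V t)) (at t within S)"
    by (rule has_vector_derivative_transform_eventually[where g = "\<lambda>s. V s d", OF y _ t eq[OF t cA(2) dA(2)]])
  with ev x show ?thesis unfolding motion_in_def by blast
qed

text \<open>Thanks to the invariance under changes of charts, one chart at each time suffices.\<close>

lemma motionI:
  assumes "\<And>t. t \<in> S \<Longrightarrow> V t \<in> tangent_space A (\<gamma> t)"
    and "\<And>t. t \<in> S \<Longrightarrow> \<exists>c\<in>charts_at A (\<gamma> t). motion_in k S \<gamma> V c t"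
  shows "motion k S \<gamma> V"
  unfolding motion_def
proof (intro ballI conjI)
  fix t assume t: "t \<in> S"
  then obtain c where c: "c \<in> charts_at A (\<gamma> t)" "motion_in k S \<gamma> V c t" using assms(2) by blast
  show "\<gamma> t \<in> topspace M" by (rule charts_at_topspace[OF c(1)])
  show "V t \<in> tangent_space A (\<gamma> t)" by (rule assms(1)[OF t])
  show "motion_in k S \<gamma> V d t" if "d \<in> charts_at A (\<gamma> t)" for d
    by (rule motion_in_change_of_chart[OF assms(1) t c(1) that c(2)])
qed

lemma motion_in_subset:
  assumes "motion_in k S \<gamma> V c t" "T \<subseteq> S"
  shows "motion_in k T \<gamma> V c t"
  unfolding motion_in_def
proof (intro conjI)
  have m: "\<forall>\<^sub>F s in at t within S. \<gamma> s \<in> cdom c"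
    "((\<lambda>s. cmap c (\<gamma> s)) has_vector_derivative V t c) (at t within S)"
    "((\<lambda>s. V s c) has_vector_derivative accel k c (\<gamma> t) (V t)) (at t within S)"
    using assms(1) unfolding motion_in_def by blast+
  show "\<forall>\<^sub>F s in at t within T. \<gamma> s \<in> cdom c" by (rule filter_leD[OF at_le[OF assms(2)] m(1)])
  show "((\<lambda>s. cmap c (\<gamma> s)) has_vector_derivative V t c) (at t within T)"
    by (rule has_vector_derivative_within_subset[OF m(2) assms(2)])
  show "((\<lambda>s. V s c) has_vector_derivative accel k c (\<gamma> t) (V t)) (at t within T)"
    by (rule has_vector_derivative_within_subset[OF m(3) assms(2)])
qed

lemma motion_subset: "motion k S \<gamma> V \<Longrightarrow> T \<subseteq> S \<Longrightarrow> motion k T \<gamma> V"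
  unfolding motion_def using motion_in_subset by blast

lemma motion_eventually_in_open:
  assumes m: "motion k S \<gamma> V" "t \<in> S" and U: "openin M U" "\<gamma> t \<in> U"
  shows "\<forall>\<^sub>F s in at t within S. \<gamma> s \<in> U"
proof -
  obtain c where c: "c \<in> charts_at A (\<gamma> t)" using charts_at_nonempty[OF motionD(1)[OF m]] by blast
  show ?thesis by (rule eventually_in_open[OF c motionD(3,4)[OF m c] U])
qed

lemma motion_continuous:
  assumes m: "motion k S \<gamma> V"
  shows "continuous_map (top_of_set S) M \<gamma>"
  unfolding continuous_map_def
proof (intro conjI allI impI)
  show "\<gamma> \<in> topspace (top_of_set S) \<rightarrow> topspace M" using motionD(1)[OF m] by simp
  fix U assume U: "openin M U"
  show "openin (top_of_set S) {x \<in> topspace (top_of_set S). \<gamma> x \<in> U}"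
    unfolding openin_euclidean_subtopology_iff
  proof (intro conjI ballI)
    fix x assume "x \<in> {x \<in> topspace (top_of_set S). \<gamma> x \<in> U}"
    then have x: "x \<in> S" "\<gamma> x \<in> U" by simp_all
    from motion_eventually_in_open[OF m x(1) U x(2)] obtain e
      where e: "e > 0" "\<And>s. s \<in> S \<Longrightarrow> s \<noteq> x \<Longrightarrow> dist s x < e \<Longrightarrow> \<gamma> s \<in> U"
      unfolding eventually_at by blast
    show "\<exists>e>0. \<forall>s\<in>S. dist s x < e \<longrightarrow> s \<in> {x \<in> topspace (top_of_set S). \<gamma> x \<in> U}"
    proof (intro exI[of _ e] conjI ballI impI e(1))
      fix s assume "s \<in> S" "dist s x < e"
      then show "s \<in> {x \<in> topspace (top_of_set S). \<gamma> x \<in> U}" using e(2)[of s] x by (cases "s = x") simp_all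
    qed
  qed simp
qed

text \<open>The common form of \<open>geodesic\<close> (with \<open>k = 0\<close>) and \<open>solution\<close> (with \<open>S = {0..1}\<close>).\<close>

definition curve_equation :: "real \<Rightarrow> real set \<Rightarrow> (real \<Rightarrow> 'a) \<Rightarrow> bool"
  where "curve_equation k S \<gamma> \<longleftrightarrow> twice_differentiable_curve M A S \<gamma> \<and>
    (\<forall>t\<in>S. covariant_derivative A D S \<gamma> (velocity A S \<gamma>) t = k *\<^sub>R F (\<gamma> t) (velocity A S \<gamma> t))"

lemma solution_iff: "solution M A D F k \<gamma> \<longleftrightarrow> curve_equation k {0..1} \<gamma>"
  by (simp add: solution_def curve_equation_def)

lemma geodesic_iff: "geodesic M A D S \<gamma> \<longleftrightarrow> curve_equation 0 S \<gamma>"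
  by (simp add: geodesic_def curve_equation_def)

lemma velocity_apply:
  "c \<in> charts_at A (\<gamma> t) \<Longrightarrow> velocity A S \<gamma> t c = vector_derivative (\<lambda>s. cmap c (\<gamma> s)) (at t within S)"
  by (simp add: velocity_def comp_def)

lemma covariant_derivative_velocity_apply:
  "c \<in> charts_at A (\<gamma> t) \<Longrightarrow> covariant_derivative A D S \<gamma> (velocity A S \<gamma>) t c =
    vector_derivative (\<lambda>s. velocity A S \<gamma> s c) (at t within S) + christoffel c (\<gamma> t) (velocity A S \<gamma> t)"
  by (simp add: covariant_derivative_def christoffel_def)

lemma curve_equation_motion:
  assumes S: "\<And>t. t \<in> S \<Longrightarrow> at t within S \<noteq> bot" and eq: "curve_equation k S \<gamma>"
  shows "motion k S \<gamma> (velocity A S \<gamma>)"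
proof -
  let ?V = "velocity A S \<gamma>"
  have cont: "continuous_map (top_of_set S) M \<gamma>"
    using eq unfolding curve_equation_def twice_differentiable_curve_def by blast
  have ev: "\<forall>\<^sub>F s in at t within S. \<gamma> s \<in> cdom c" if t: "t \<in> S" and c: "c \<in> charts_at A (\<gamma> t)" for t c
  proof -
    have cA: "c \<in> A" "\<gamma> t \<in> cdom c" using c by (simp_all add: charts_at_iff)
    have "openin (top_of_set S) {s \<in> topspace (top_of_set S). \<gamma> s \<in> cdom c}"
      by (rule openin_continuous_map_preimage[OF cont chart_openin[OF cA(1)]])
    then obtain e where "e > 0" "\<And>s. s \<in> S \<Longrightarrow> dist s t < e \<Longrightarrow> \<gamma> s \<in> cdom c"
      unfolding openin_euclidean_subtopology_iff using t cA(2) by force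
    then show ?thesis unfolding eventually_at by blast
  qed
  have dx: "((\<lambda>s. cmap c (\<gamma> s)) has_vector_derivative ?V t c) (at t within S)"
    if t: "t \<in> S" and c: "c \<in> charts_at A (\<gamma> t)" for t c
  proof -
    have "(cmap c \<circ> \<gamma>) differentiable (at t within S)"
      using eq t c unfolding curve_equation_def twice_differentiable_curve_def by blast
    then show ?thesis by (simp add: velocity_apply[where \<gamma> = \<gamma> and t = t, OF c] comp_def flip: vector_derivative_works)
  qed
  show ?thesis
  proof (rule motionI)
    fix t assume t: "t \<in> S"
    show "?V t \<in> tangent_space A (\<gamma> t)"
    proof (rule tangentI)
      show "?V t c = 0" if "c \<notin> charts_at A (\<gamma> t)" for c using that by (simp add: velocity_def)
      show "?V t d = dtr c d (\<gamma> t) (?V t c)" if c: "c \<in> charts_at A (\<gamma> t)" and d: "d \<in> charts_at A (\<gamma> t)" for c d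
        by (rule vector_derivative_unique_within[OF S[OF t] dx[OF t d]
              chart_curve_change[OF c d ev[OF t c] t dx[OF t c]]])
    qed
    have "\<gamma> t \<in> topspace M" using continuous_map_image_subset_topspace[OF cont] t by auto
    then obtain c where c: "c \<in> charts_at A (\<gamma> t)" using charts_at_nonempty by blast
    have "(\<lambda>s. ?V s c) differentiable (at t within S)"
      using eq t c unfolding curve_equation_def twice_differentiable_curve_def by blast
    then have "((\<lambda>s. ?V s c) has_vector_derivative vector_derivative (\<lambda>s. ?V s c) (at t within S)) (at t within S)"
      by (simp add: vector_derivative_works)
    moreover have "vector_derivative (\<lambda>s. ?V s c) (at t within S) = accel k c (\<gamma> t) (?V t)"
    proof -
      have "covariant_derivative A D S \<gamma> ?V t = k *\<^sub>R F (\<gamma> t) (?V t)"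
        using eq t unfolding curve_equation_def by blast
      then have "covariant_derivative A D S \<gamma> ?V t c = k *\<^sub>R F (\<gamma> t) (?V t) c"
        by (simp add: scaleR_fun_def)
      then show ?thesis
        unfolding covariant_derivative_velocity_apply[where \<gamma> = \<gamma> and t = t, OF c] accel_def by (simp add: algebra_simps)
    qed
    ultimately show "\<exists>c\<in>charts_at A (\<gamma> t). motion_in k S \<gamma> ?V c t"
      using ev[OF t c] dx[OF t c] c unfolding motion_in_def by (intro bexI[of _ c]) simp_all
  qed
qed

lemma motion_velocity:
  assumes m: "motion k S \<gamma> V" and S: "\<And>t. t \<in> S \<Longrightarrow> at t within S \<noteq> bot" and t: "t \<in> S"
  shows "velocity A S \<gamma> t = V t"
proof
  fix c
  show "velocity A S \<gamma> t c = V t c"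
  proof (cases "c \<in> charts_at A (\<gamma> t)")
    case True
    show ?thesis
      unfolding velocity_apply[where \<gamma> = \<gamma> and t = t, OF True] by (rule vector_derivative_within[OF S[OF t] motionD(4)[OF m t True]])
  next
    case False
    then show ?thesis
      using tangent_outside[OF motionD(2)[OF m t] False] by (simp add: velocity_def)
  qed
qed

lemma motion_curve_equation:
  assumes m: "motion k S \<gamma> V" and S: "\<And>t. t \<in> S \<Longrightarrow> at t within S \<noteq> bot"
  shows "curve_equation k S \<gamma>"
proof -
  have V: "velocity A S \<gamma> t = V t" if "t \<in> S" for t by (rule motion_velocity[OF m S that])
  have dV: "((\<lambda>s. velocity A S \<gamma> s c) has_vector_derivative accel k c (\<gamma> t) (V t)) (at t within S)"
    if t: "t \<in> S" and c: "c \<in> charts_at A (\<gamma> t)" for t c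
    by (rule has_vector_derivative_transform[OF t _ motionD(5)[OF m t c]]) (simp add: V)
  show ?thesis
    unfolding curve_equation_def twice_differentiable_curve_def
  proof (intro conjI ballI)
    show "continuous_map (top_of_set S) M \<gamma>" by (rule motion_continuous[OF m])
    fix t assume t: "t \<in> S"
    show "(cmap c \<circ> \<gamma>) differentiable (at t within S)" if c: "c \<in> charts_at A (\<gamma> t)" for c
      using motionD(4)[OF m t c] unfolding comp_def by (rule differentiableI_vector)
    show "(\<lambda>s. velocity A S \<gamma> s c) differentiable (at t within S)" if c: "c \<in> charts_at A (\<gamma> t)" for c
      using dV[OF t c] by (rule differentiableI_vector)
    show "covariant_derivative A D S \<gamma> (velocity A S \<gamma>) t = k *\<^sub>R F (\<gamma> t) (velocity A S \<gamma> t)"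
    proof
      fix c
      show "covariant_derivative A D S \<gamma> (velocity A S \<gamma>) t c = (k *\<^sub>R F (\<gamma> t) (velocity A S \<gamma> t)) c"
      proof (cases "c \<in> charts_at A (\<gamma> t)")
        case True
        show ?thesis
          unfolding covariant_derivative_velocity_apply[where \<gamma> = \<gamma> and t = t, OF True] vector_derivative_within[OF S[OF t] dV[OF t True]]
          by (simp add: accel_def V[OF t] scaleR_fun_def)
      next
        case False
        then show ?thesis
          using tangent_outside[OF tensor_tangent[OF motionD(1,2)[OF m t]] False]
          by (simp add: covariant_derivative_def V[OF t] scaleR_fun_def)
      qed
    qed
  qed
qed

end

section \<open>Uniqueness and dependence on initial data\<close>

lemma at_within_outside_closed:
  assumes "closed S" "t \<notin> S"
  shows "at t within S = bot"
proof -
  have "\<not> t islimpt S" using assms closed_limpt by blast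
  then show ?thesis by (simp add: trivial_limit_within)
qed

lemma has_vector_derivative_bot:
  assumes "at t within S = bot"
  shows "(f has_vector_derivative v) (at t within S)"
  unfolding has_vector_derivative_def assms has_derivative_def
  by (simp add: bounded_linear_scaleR_left)

lemma has_vector_derivative_Un:
  assumes "(f has_vector_derivative v) (at t within S)" "(f has_vector_derivative v) (at t within T)"
  shows "(f has_vector_derivative v) (at t within (S \<union> T))"
  using assms Lim_Un unfolding has_vector_derivative_def has_derivative_within by blast

lemma has_vector_derivative_glue:
  fixes f g :: "real \<Rightarrow> 'z::real_normed_vector"
  assumes abc: "a \<le> b" "b \<le> c" and t: "t \<in> {a..c}" and eq: "f b = g b"
    and f: "t \<le> b \<Longrightarrow> (f has_vector_derivative v) (at t within {a..b})"
    and g: "b \<le> t \<Longrightarrow> (g has_vector_derivative v) (at t within {b..c})"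
  shows "((\<lambda>s. if s \<le> b then f s else g s) has_vector_derivative v) (at t within {a..c})"
proof -
  let ?h = "\<lambda>s. if s \<le> b then f s else g s"
  have "(?h has_vector_derivative v) (at t within {a..b})"
  proof (cases "t \<le> b")
    case True
    show ?thesis by (rule has_vector_derivative_transform[OF _ _ f[OF True]]) (use True t in auto)
  next
    case False
    show ?thesis
      by (rule has_vector_derivative_bot, rule at_within_outside_closed) (use False in auto)
  qed
  moreover have "(?h has_vector_derivative v) (at t within {b..c})"
  proof (cases "b \<le> t")
    case True
    show ?thesis by (rule has_vector_derivative_transform[OF _ _ g[OF True]]) (use True t eq in auto)
  next
    case False
    show ?thesis
      by (rule has_vector_derivative_bot, rule at_within_outside_closed) (use False in auto)
  qed
  ultimately have "(?h has_vector_derivative v) (at t within ({a..b} \<union> {b..c}))"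
    by (rule has_vector_derivative_Un)
  then show ?thesis using ivl_disj_un_two_touch(4)[OF abc] by simp
qed

lemma isCont_eventually_nhds:
  assumes "isCont f x" "open B" "f x \<in> B"
  shows "\<forall>\<^sub>F y in nhds x. f y \<in> B"
  using assms topological_tendstoD unfolding isCont_def eventually_nhds_conv_at by blast

context forced_connection
begin

lemma motion_chart_ode:
  assumes m: "motion k S \<gamma> V" "t \<in> S" and c: "c \<in> charts_at A (\<gamma> t)"
  shows "((\<lambda>s. (cmap c (\<gamma> s), V s c, k)) has_vector_derivative chart_ode c (cmap c (\<gamma> t), V t c, k)) (at t within S)"
  unfolding chart_ode_state[OF c motionD(2)[OF m]]
  by (intro has_vector_derivative_Pair motionD(4)[OF m c] motionD(5)[OF m c] has_vector_derivative_const)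

lemma chart_ode_motion:
  assumes c: "c \<in> A" and W: "\<And>s. s \<in> S \<Longrightarrow> fst (z s) \<in> cmap c ` cdom c"
    and k: "\<And>s. s \<in> S \<Longrightarrow> snd (snd (z s)) = k"
    and z: "\<And>s. s \<in> S \<Longrightarrow> (z has_vector_derivative chart_ode c (z s)) (at s within S)"
  shows "motion k S (\<lambda>s. cinv c (fst (z s))) (\<lambda>s. tvec_of A c (cinv c (fst (z s))) (fst (snd (z s))))"
proof (rule motionI)
  let ?\<gamma> = "\<lambda>s. cinv c (fst (z s))"
  let ?V = "\<lambda>s. tvec_of A c (?\<gamma> s) (fst (snd (z s)))"
  have g: "?\<gamma> s \<in> cdom c" "cmap c (?\<gamma> s) = fst (z s)" if s: "s \<in> S" for s
  proof -
    obtain p where p: "p \<in> cdom c" "fst (z s) = cmap c p" using W[OF s] by blast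
    show "?\<gamma> s \<in> cdom c" "cmap c (?\<gamma> s) = fst (z s)"
      unfolding p(2) cinv_cmap[OF c p(1)] using p(1) by simp_all
  qed
  have cg: "c \<in> charts_at A (?\<gamma> s)" if "s \<in> S" for s using c g(1)[OF that] by (simp add: charts_at_iff)
  have V: "?V s c = fst (snd (z s))" if "s \<in> S" for s by (rule tvec_of_self[OF cg[OF that]])
  fix t assume t: "t \<in> S"
  show "?V t \<in> tangent_space A (?\<gamma> t)" by (rule tvec_of_tangent[OF cg[OF t]])
  have "\<forall>\<^sub>F s in at t within S. s \<in> S" by (simp add: eventually_at_topological, blast)
  then have 1: "\<forall>\<^sub>F s in at t within S. ?\<gamma> s \<in> cdom c" by eventually_elim (rule g(1))
  have ode: "chart_ode c (z t) = (?V t c, accel k c (?\<gamma> t) (?V t), 0)"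
    unfolding chart_ode_def k[OF t] V[OF t] by simp
  have bl: "bounded_linear (\<lambda>z::'e \<times> 'e \<times> real. fst (snd z))"
    by (rule bounded_linear_compose[OF bounded_linear_fst bounded_linear_snd])
  have "((\<lambda>s. fst (z s)) has_vector_derivative ?V t c) (at t within S)"
    using bounded_linear.has_vector_derivative[OF bounded_linear_fst z[OF t]] unfolding ode by simp
  then have 2: "((\<lambda>s. cmap c (?\<gamma> s)) has_vector_derivative ?V t c) (at t within S)"
    by (rule has_vector_derivative_transform[OF t, rotated]) (rule g(2))
  have "((\<lambda>s. fst (snd (z s))) has_vector_derivative accel k c (?\<gamma> t) (?V t)) (at t within S)"
    using bounded_linear.has_vector_derivative[OF bl z[OF t]] unfolding ode by simp
  then have 3: "((\<lambda>s. ?V s c) has_vector_derivative accel k c (?\<gamma> t) (?V t)) (at t within S)"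
    by (rule has_vector_derivative_transform[OF t, rotated]) (rule V)
  show "\<exists>c\<in>charts_at A (?\<gamma> t). motion_in k S ?\<gamma> ?V c t"
    using 1 2 3 cg[OF t] unfolding motion_in_def by blast
qed

text \<open>Different states can be separated: different points by the Hausdorff property, different velocities at
the same point by their components in a chart.\<close>

lemma motion_eventually_differ:
  assumes m1: "motion k S \<gamma>1 V1" and m2: "motion k S \<gamma>2 V2" and x: "x \<in> S"
    and ne: "\<not> (\<gamma>1 x = \<gamma>2 x \<and> V1 x = V2 x)"
  shows "\<forall>\<^sub>F s in at x within S. \<not> (\<gamma>1 s = \<gamma>2 s \<and> V1 s = V2 s)"
proof (cases "\<gamma>1 x = \<gamma>2 x")
  case False
  have "Hausdorff_space M" using manifold by (simp add: smooth_manifold_def)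
  then obtain U1 U2 where U: "openin M U1" "openin M U2" "\<gamma>1 x \<in> U1" "\<gamma>2 x \<in> U2" "disjnt U1 U2"
    using False motionD(1)[OF m1 x] motionD(1)[OF m2 x] unfolding Hausdorff_space_def by blast
  show ?thesis
    using motion_eventually_in_open[OF m1 x U(1,3)] motion_eventually_in_open[OF m2 x U(2,4)]
  proof eventually_elim
    case (elim s)
    then show ?case using U(5) by (auto simp: disjnt_iff)
  qed
next
  case True
  obtain c where c: "c \<in> charts_at A (\<gamma>1 x)" using charts_at_nonempty[OF motionD(1)[OF m1 x]] by blast
  have c2: "c \<in> charts_at A (\<gamma>2 x)" using c True by simp
  have "V1 x c \<noteq> V2 x c"
    using tangent_eqI[OF motionD(2)[OF m1 x] _ c] motionD(2)[OF m2 x] True ne by metis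
  then have n: "V1 x c - V2 x c \<in> - {0}" by simp
  have "((\<lambda>s. V1 s c - V2 s c) \<longlongrightarrow> V1 x c - V2 x c) (at x within S)"
    using has_vector_derivative_continuous[OF motionD(5)[OF m1 x c]]
      has_vector_derivative_continuous[OF motionD(5)[OF m2 x c2]]
    by (intro tendsto_diff) (simp_all add: continuous_within)
  from topological_tendstoD[OF this open_Compl[OF closed_singleton] n]
  have "\<forall>\<^sub>F s in at x within S. V1 s c - V2 s c \<in> - {0}" .
  then show ?thesis by eventually_elim auto
qed

lemma motion_eventually_in_chart_ball:
  assumes m: "motion k S \<gamma> V" "x \<in> S" and c: "c \<in> charts_at A (\<gamma> x)"
    and B: "open B" "(cmap c (\<gamma> x), V x c, k) \<in> B"
  shows "\<exists>e>0. \<forall>s\<in>S. \<bar>s - x\<bar> < e \<longrightarrow> \<gamma> s \<in> cdom c \<and> (cmap c (\<gamma> s), V s c, k) \<in> B"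
proof -
  have "((\<lambda>s. (cmap c (\<gamma> s), V s c, k)) \<longlongrightarrow> (cmap c (\<gamma> x), V x c, k)) (at x within S)"
    using has_vector_derivative_continuous[OF motion_chart_ode[OF m c]] by (simp add: continuous_within)
  from topological_tendstoD[OF this B]
  have "\<forall>\<^sub>F s in at x within S. \<gamma> s \<in> cdom c \<and> (cmap c (\<gamma> s), V s c, k) \<in> B"
    using motionD(3)[OF m c] by eventually_elim simp
  then obtain e where e: "e > 0"
    "\<And>s. s \<in> S \<Longrightarrow> s \<noteq> x \<Longrightarrow> dist s x < e \<Longrightarrow> \<gamma> s \<in> cdom c \<and> (cmap c (\<gamma> s), V s c, k) \<in> B"
    unfolding eventually_at by blast
  have "\<gamma> x \<in> cdom c" using c by (simp add: charts_at_iff)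
  then have "\<gamma> s \<in> cdom c \<and> (cmap c (\<gamma> s), V s c, k) \<in> B" if "s \<in> S" "\<bar>s - x\<bar> < e" for s
    using e(2)[of s] that B(2) by (cases "s = x") (simp_all add: dist_real_def)
  with e(1) show ?thesis by blast
qed

text \<open>Agreement at one time allows both motions to be read in one chart, where local uniqueness for
\<open>chart_ode\<close> applies.\<close>

lemma motion_agree_locally:
  assumes m1: "motion k S \<gamma>1 V1" and m2: "motion k S \<gamma>2 V2" and x: "x \<in> S"
    and eq: "\<gamma>1 x = \<gamma>2 x" "V1 x = V2 x"
  shows "\<exists>e>0. \<forall>t. x \<le> t \<and> t < x + e \<and> {x..t} \<subseteq> S \<longrightarrow> \<gamma>1 t = \<gamma>2 t \<and> V1 t = V2 t"
proof -
  obtain c where c: "c \<in> charts_at A (\<gamma>1 x)" using charts_at_nonempty[OF motionD(1)[OF m1 x]] by blast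
  then have cA: "c \<in> A" "\<gamma>1 x \<in> cdom c" by (simp_all add: charts_at_iff)
  have c2: "c \<in> charts_at A (\<gamma>2 x)" using c eq by simp
  let ?z1 = "\<lambda>s. (cmap c (\<gamma>1 s), V1 s c, k)" and ?z2 = "\<lambda>s. (cmap c (\<gamma>2 s), V2 s c, k)"
  have W: "open ((cmap c ` cdom c) \<times> (UNIV :: ('e \<times> real) set))"
    by (intro open_Times chart_range_open cA open_UNIV)
  have w: "?z1 x \<in> (cmap c ` cdom c) \<times> UNIV" using cA(2) by simp
  obtain r \<delta> where r: "0 < r" "0 < \<delta>" and unique:
    "\<And>a b z1 z2. a \<le> b \<Longrightarrow> b - a \<le> \<delta> \<Longrightarrow>
       (\<And>t. t \<in> {a..b} \<Longrightarrow> z1 t \<in> ball (?z1 x) r \<and> (z1 has_vector_derivative chart_ode c (z1 t)) (at t within {a..b})) \<Longrightarrow>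
       (\<And>t. t \<in> {a..b} \<Longrightarrow> z2 t \<in> ball (?z1 x) r \<and> (z2 has_vector_derivative chart_ode c (z2 t)) (at t within {a..b})) \<Longrightarrow>
       z1 a = z2 a \<Longrightarrow> z1 b = z2 b"
    using ode_locally_unique[OF W chart_ode_smooth[OF cA(1)] w] by metis
  obtain e1 where e1: "e1 > 0" "\<And>s. s \<in> S \<Longrightarrow> \<bar>s - x\<bar> < e1 \<Longrightarrow> \<gamma>1 s \<in> cdom c \<and> ?z1 s \<in> ball (?z1 x) r"
    using motion_eventually_in_chart_ball[OF m1 x c open_ball, of "?z1 x" r] r(1) by (metis centre_in_ball)
  have zx: "?z2 x \<in> ball (?z1 x) r" using r(1) eq by simp
  obtain e2 where e2: "e2 > 0" "\<And>s. s \<in> S \<Longrightarrow> \<bar>s - x\<bar> < e2 \<Longrightarrow> \<gamma>2 s \<in> cdom c \<and> ?z2 s \<in> ball (?z1 x) r"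
    using motion_eventually_in_chart_ball[OF m2 x c2 open_ball zx] by metis
  show ?thesis
  proof (intro exI[of _ "min \<delta> (min e1 e2)"] conjI allI impI)
    show "0 < min \<delta> (min e1 e2)" using r e1 e2 by simp
    fix t assume t: "x \<le> t \<and> t < x + min \<delta> (min e1 e2) \<and> {x..t} \<subseteq> S"
    have S: "s \<in> S" "\<bar>s - x\<bar> < e1" "\<bar>s - x\<bar> < e2" if "s \<in> {x..t}" for s using t that by auto
    have d1: "(?z1 has_vector_derivative chart_ode c (?z1 s)) (at s within {x..t})" if "s \<in> {x..t}" for s
      by (rule has_vector_derivative_within_subset[OF motion_chart_ode[OF m1 S(1)[OF that]]])
        (use e1(2)[OF S(1)[OF that] S(2)[OF that]] cA t in \<open>simp_all add: charts_at_iff\<close>)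
    have d2: "(?z2 has_vector_derivative chart_ode c (?z2 s)) (at s within {x..t})" if "s \<in> {x..t}" for s
      by (rule has_vector_derivative_within_subset[OF motion_chart_ode[OF m2 S(1)[OF that]]])
        (use e2(2)[OF S(1)[OF that] S(3)[OF that]] cA t in \<open>simp_all add: charts_at_iff\<close>)
    have "?z1 t = ?z2 t"
    proof (rule unique[of x t ?z1 ?z2])
      show "x \<le> t" "t - x \<le> \<delta>" using t by auto
      show "?z1 s \<in> ball (?z1 x) r \<and> (?z1 has_vector_derivative chart_ode c (?z1 s)) (at s within {x..t})"
        if "s \<in> {x..t}" for s using e1(2)[OF S(1)[OF that] S(2)[OF that]] d1[OF that] by blast
      show "?z2 s \<in> ball (?z1 x) r \<and> (?z2 has_vector_derivative chart_ode c (?z2 s)) (at s within {x..t})"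
        if "s \<in> {x..t}" for s using e2(2)[OF S(1)[OF that] S(3)[OF that]] d2[OF that] by blast
      show "?z1 x = ?z2 x" using eq by simp
    qed
    then have z: "cmap c (\<gamma>1 t) = cmap c (\<gamma>2 t)" "V1 t c = V2 t c" by simp_all
    have tt: "t \<in> {x..t}" using t by simp
    have g: "\<gamma>1 t \<in> cdom c" "\<gamma>2 t \<in> cdom c"
      using e1(2)[OF S(1)[OF tt] S(2)[OF tt]] e2(2)[OF S(1)[OF tt] S(3)[OF tt]] by simp_all
    show gt: "\<gamma>1 t = \<gamma>2 t" by (rule inj_onD[OF chart_inj[OF cA(1)] z(1) g])
    show "V1 t = V2 t"
    proof (rule tangent_eqI[where c = c])
      show "V1 t \<in> tangent_space A (\<gamma>1 t)" by (rule motionD(2)[OF m1 S(1)[OF tt]])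
      show "V2 t \<in> tangent_space A (\<gamma>1 t)" unfolding gt by (rule motionD(2)[OF m2 S(1)[OF tt]])
      show "c \<in> charts_at A (\<gamma>1 t)" using cA(1) g(1) by (simp add: charts_at_iff)
      show "V1 t c = V2 t c" by (rule z(2))
    qed
  qed
qed

text \<open>By bisection it suffices that agreement propagates across short intervals around each \<open>x\<close>. If the motions agree
at \<open>x\<close>, this is \<open>motion_agree_locally\<close> for the part of the interval after \<open>x\<close>. If they differ at \<open>x\<close>, then they differ
at the left end point as well, and nothing has to be propagated.\<close>

lemma motion_unique:
  assumes m1: "motion k {a..b} \<gamma>1 V1" and m2: "motion k {a..b} \<gamma>2 V2"
    and eq: "\<gamma>1 a = \<gamma>2 a" "V1 a = V2 a" and t: "t \<in> {a..b}"
  shows "\<gamma>1 t = \<gamma>2 t \<and> V1 t = V2 t"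
proof -
  \<comment> \<open>The name \<open>J\<close> keeps the interval fixed while \<open>Bolzano\<close> varies its end points.\<close>
  define J where "J = {a..b}"
  have m1: "motion k J \<gamma>1 V1" and m2: "motion k J \<gamma>2 V2" and t: "t \<in> {a..b}"
    using assms by (simp_all add: J_def)
  let ?E = "\<lambda>s. \<gamma>1 s = \<gamma>2 s \<and> V1 s = V2 s"
  have at: "a \<le> t" "a \<in> J" "t \<in> J" using t by (simp_all add: J_def)
  from at(1)
  have "a \<in> J \<and> t \<in> J \<and> ?E a \<longrightarrow> ?E t"
  proof (induction rule: Bolzano)
    case (trans p q r)
    show ?case
    proof
      assume pr: "p \<in> J \<and> r \<in> J \<and> ?E p"
      then have "q \<in> J" using trans(3,4) by (simp add: J_def)
      then show "?E r" using trans(1,2) pr by blast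
    qed
  next
    case (local x)
    then have x: "x \<in> J" using t by (simp add: J_def)
    show ?case
    proof (cases "?E x")
      case True
      then have gx: "\<gamma>1 x = \<gamma>2 x" and vx: "V1 x = V2 x" by simp_all
      obtain e where e: "e > 0" "\<And>s. x \<le> s \<Longrightarrow> s < x + e \<Longrightarrow> {x..s} \<subseteq> J \<Longrightarrow> ?E s"
        using motion_agree_locally[OF m1 m2 x gx vx] by metis
      show ?thesis
      proof (intro exI[of _ e] conjI e(1) allI impI)
        fix p q assume pq: "p \<le> x \<and> x \<le> q \<and> q - p < e" and "p \<in> J \<and> q \<in> J \<and> ?E p"
        then have "x \<le> q" "q < x + e" "{x..q} \<subseteq> J" using x by (auto simp: J_def)
        then show "\<gamma>1 q = \<gamma>2 q" "V1 q = V2 q" using e(2) by simp_all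
      qed
    next
      case False
      obtain e where e: "e > 0" "\<And>s. s \<in> J \<Longrightarrow> s \<noteq> x \<Longrightarrow> dist s x < e \<Longrightarrow> \<not> ?E s"
        using motion_eventually_differ[OF m1 m2 x False] unfolding eventually_at by blast
      show ?thesis
      proof (intro exI[of _ e] conjI[OF e(1)] allI impI)
        fix p q assume pq: "p \<le> x \<and> x \<le> q \<and> q - p < e" and p: "p \<in> J \<and> q \<in> J \<and> ?E p"
        have "dist p x < e" using pq by (simp add: dist_real_def)
        then have False using e(2)[of p] p False by blast
        then show "?E q" ..
      qed
    qed
  qed
  then show ?thesis using eq at by blast
qed

lemma motion_glue:
  assumes m1: "motion k {a..b} \<gamma>1 V1" and m2: "motion k {b..c} \<gamma>2 V2"
    and abc: "a \<le> b" "b \<le> c" and eq: "\<gamma>1 b = \<gamma>2 b" "V1 b = V2 b"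
  shows "motion k {a..c} (\<lambda>s. if s \<le> b then \<gamma>1 s else \<gamma>2 s) (\<lambda>s. if s \<le> b then V1 s else V2 s)"
proof (rule motionI)
  let ?\<gamma> = "\<lambda>s. if s \<le> b then \<gamma>1 s else \<gamma>2 s" and ?V = "\<lambda>s. if s \<le> b then V1 s else V2 s"
  fix t assume t: "t \<in> {a..c}"
  have l: "t \<in> {a..b}" "?\<gamma> t = \<gamma>1 t" "?V t = V1 t" if "t \<le> b" using t that by simp_all
  have r: "t \<in> {b..c}" "?\<gamma> t = \<gamma>2 t" "?V t = V2 t" if "b \<le> t" using t that eq by auto
  show T: "?V t \<in> tangent_space A (?\<gamma> t)"
  proof (cases "t \<le> b")
    case True then show ?thesis using motionD(2)[OF m1 l(1)[OF True]] by simp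
  next
    case False
    then have "b \<le> t" by simp
    from motionD(2)[OF m2 r(1)[OF this]] show ?thesis unfolding r(2,3)[OF \<open>b \<le> t\<close>] .
  qed
  have "?\<gamma> t \<in> topspace M"
  proof (cases "t \<le> b")
    case True then show ?thesis using motionD(1)[OF m1 l(1)[OF True]] by simp
  next
    case False
    then have "b \<le> t" by simp
    from motionD(1)[OF m2 r(1)[OF this]] show ?thesis unfolding r(2)[OF \<open>b \<le> t\<close>] .
  qed
  then obtain d where d: "d \<in> charts_at A (?\<gamma> t)" using charts_at_nonempty by blast
  have d1: "d \<in> charts_at A (\<gamma>1 t)" if "t \<le> b" using d unfolding l(2)[OF that] .
  have d2: "d \<in> charts_at A (\<gamma>2 t)" if "b \<le> t" using d unfolding r(2)[OF that] .
  have "motion_in k {a..c} ?\<gamma> ?V d t"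
    unfolding motion_in_def
  proof (intro conjI)
    have "\<forall>\<^sub>F s in at t within {a..b}. ?\<gamma> s \<in> cdom d"
    proof (cases "t \<le> b")
      case True
      have "\<forall>\<^sub>F s in at t within {a..b}. s \<in> {a..b}" by (simp add: eventually_at_topological, blast)
      then show ?thesis using motionD(3)[OF m1 l(1)[OF True] d1[OF True]] by eventually_elim simp
    next
      case False
      have "at t within {a..b} = bot" by (rule at_within_outside_closed) (use False in auto)
      then show ?thesis by simp
    qed
    moreover have "\<forall>\<^sub>F s in at t within {b..c}. ?\<gamma> s \<in> cdom d"
    proof (cases "b \<le> t")
      case True
      have "\<forall>\<^sub>F s in at t within {b..c}. s \<in> {b..c}" by (simp add: eventually_at_topological, blast)
      then show ?thesis using motionD(3)[OF m2 r(1)[OF True] d2[OF True]]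
        by eventually_elim (use eq in auto)
    next
      case False
      have "at t within {b..c} = bot" by (rule at_within_outside_closed) (use False in auto)
      then show ?thesis by simp
    qed
    ultimately have "\<forall>\<^sub>F s in at t within ({a..b} \<union> {b..c}). ?\<gamma> s \<in> cdom d"
      unfolding at_within_union by (rule eventually_sup[THEN iffD2, OF conjI])
    then show "\<forall>\<^sub>F s in at t within {a..c}. ?\<gamma> s \<in> cdom d"
      using ivl_disj_un_two_touch(4)[OF abc] by simp
    have "((\<lambda>s. if s \<le> b then cmap d (\<gamma>1 s) else cmap d (\<gamma>2 s)) has_vector_derivative ?V t d) (at t within {a..c})"
    proof (rule has_vector_derivative_glue[OF abc t])
      show "((\<lambda>s. cmap d (\<gamma>1 s)) has_vector_derivative ?V t d) (at t within {a..b})" if "t \<le> b"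
        unfolding l(3)[OF that] by (rule motionD(4)[OF m1 l(1)[OF that] d1[OF that]])
      show "((\<lambda>s. cmap d (\<gamma>2 s)) has_vector_derivative ?V t d) (at t within {b..c})" if "b \<le> t"
        unfolding r(3)[OF that] by (rule motionD(4)[OF m2 r(1)[OF that] d2[OF that]])
    qed (simp add: eq)
    then show "((\<lambda>s. cmap d (?\<gamma> s)) has_vector_derivative ?V t d) (at t within {a..c})"
      by (rule has_vector_derivative_transform[OF t, rotated]) simp
    have "((\<lambda>s. if s \<le> b then V1 s d else V2 s d) has_vector_derivative accel k d (?\<gamma> t) (?V t)) (at t within {a..c})"
    proof (rule has_vector_derivative_glue[OF abc t])
      show "((\<lambda>s. V1 s d) has_vector_derivative accel k d (?\<gamma> t) (?V t)) (at t within {a..b})" if "t \<le> b"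
        unfolding l(2,3)[OF that] by (rule motionD(5)[OF m1 l(1)[OF that] d1[OF that]])
      show "((\<lambda>s. V2 s d) has_vector_derivative accel k d (?\<gamma> t) (?V t)) (at t within {b..c})" if "b \<le> t"
        unfolding r(2,3)[OF that] by (rule motionD(5)[OF m2 r(1)[OF that] d2[OF that]])
    qed (simp add: eq)
    then show "((\<lambda>s. ?V s d) has_vector_derivative accel k d (?\<gamma> t) (?V t)) (at t within {a..c})"
      by (rule has_vector_derivative_transform[OF t, rotated]) simp
  qed
  with d show "\<exists>d\<in>charts_at A (?\<gamma> t). motion_in k {a..c} ?\<gamma> ?V d t" by blast
qed

end

section \<open>Differentiable dependence on parameter and initial velocity\<close>

lemma differentiable_transform_eventually:
  assumes "f differentiable (at x)" "\<forall>\<^sub>F y in nhds x. f y = g y"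
  shows "g differentiable (at x)"
proof -
  obtain f' where f': "(f has_derivative f') (at x)" using assms(1) by (auto simp: differentiable_def)
  have "\<forall>\<^sub>F y in at x. f y = g y" "f x = g x"
    using assms(2) by (simp_all add: eventually_nhds_conv_at)
  then have "(g has_derivative f') (at x)"
    by (intro has_derivative_transform_eventually[OF f']) simp_all
  then show ?thesis by (auto simp: differentiable_def)
qed

lemma differentiable_sum_scaleR:
  fixes h :: "'i \<Rightarrow> 'p::real_normed_vector \<Rightarrow> 'w::real_normed_vector"
  assumes "\<And>i. i \<in> I \<Longrightarrow> r i differentiable (at x)" "\<And>i. i \<in> I \<Longrightarrow> h i differentiable (at x)"
  shows "(\<lambda>y. \<Sum>i\<in>I. (r i y :: real) *\<^sub>R h i y) differentiable (at x)"
  using assms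
  by (induction I rule: infinite_finite_induct) (auto intro!: differentiable_add differentiable_scaleR)

context forced_connection
begin

text \<open>Differentiability of a family of states in one chart carries over to any other chart at the base
point, since coordinate changes of the tangent bundle are differentiable.\<close>

lemma state_chart_change:
  fixes p :: "'p::real_normed_vector \<Rightarrow> 'a"
  assumes T: "\<forall>\<^sub>F q in nhds q0. v q \<in> tangent_space A (p q)"
    and c: "c \<in> charts_at A (p q0)" and d: "d \<in> charts_at A (p q0)"
    and ev: "\<forall>\<^sub>F q in nhds q0. p q \<in> cdom c"
    and diff: "(\<lambda>q. (cmap c (p q), v q c)) differentiable (at q0)"
  shows "(\<forall>\<^sub>F q in nhds q0. p q \<in> cdom d) \<and> (\<lambda>q. (cmap d (p q), v q d)) differentiable (at q0)"
proof -
  have cA: "c \<in> A" "p q0 \<in> cdom c" using c by (simp_all add: charts_at_iff)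
  have dA: "d \<in> A" "p q0 \<in> cdom d" using d by (simp_all add: charts_at_iff)
  have dx: "(\<lambda>q. cmap c (p q)) differentiable (at q0)"
    using bounded_linear_imp_differentiable[OF bounded_linear_fst, THEN differentiable_chain_at[OF diff]]
    by (simp add: comp_def)
  have dv: "(\<lambda>q. v q c) differentiable (at q0)"
    using bounded_linear_imp_differentiable[OF bounded_linear_snd, THEN differentiable_chain_at[OF diff]]
    by (simp add: comp_def)
  have evo: "\<forall>\<^sub>F q in nhds q0. cmap c (p q) \<in> cmap c ` (cdom c \<inter> cdom d)"
    by (rule isCont_eventually_nhds[OF differentiable_imp_continuous_within[OF dx] overlap_open[OF cA(1) dA(1)]])
      (use cA(2) dA(2) in blast)
  have evd: "\<forall>\<^sub>F q in nhds q0. p q \<in> cdom d"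
    using ev evo
  proof eventually_elim
    case (elim q)
    then obtain y where y: "y \<in> cdom c" "y \<in> cdom d" "cmap c (p q) = cmap c y" by blast
    have "p q = y" by (rule inj_onD[OF chart_inj[OF cA(1)] y(3) elim(1) y(1)])
    then show ?case using y(2) by simp
  qed
  let ?H = "\<lambda>i x. frechet_derivative (transition c d) (at x) i"
  have "transition c d differentiable (at (cmap c (p q0)))"
    using transition_has_derivative[OF cA(1) dA(1) cA(2) dA(2)] by (rule differentiableI)
  then have 1: "(\<lambda>q. transition c d (cmap c (p q))) differentiable (at q0)"
    using differentiable_chain_at[OF dx] by (simp add: comp_def)
  have x: "(\<lambda>q. cmap d (p q)) differentiable (at q0)"
  proof (rule differentiable_transform_eventually[OF 1])
    show "\<forall>\<^sub>F q in nhds q0. transition c d (cmap c (p q)) = cmap d (p q)"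
      using ev by eventually_elim (rule transition_cmap[OF cA(1)])
  qed
  have H: "(\<lambda>q. ?H i (cmap c (p q))) differentiable (at q0)" for i
  proof -
    have "?H i differentiable (at (cmap c (p q0)))"
      by (rule differentiableI, rule smooth_on_has_derivative[OF smooth_on_frechet_derivative[OF
              transition_smooth[OF cA(1) dA(1)]]]) (use cA dA in blast)
    then show ?thesis using differentiable_chain_at[OF dx] by (simp add: comp_def)
  qed
  have vi: "(\<lambda>q. v q c \<bullet> i) differentiable (at q0)" for i
    using differentiable_chain_at[OF dv bounded_linear_imp_differentiable[OF bounded_linear_inner_left]]
    by (simp add: comp_def)
  have "(\<lambda>q. \<Sum>i\<in>Basis. (v q c \<bullet> i) *\<^sub>R ?H i (cmap c (p q))) differentiable (at q0)"
    by (rule differentiable_sum_scaleR[OF vi H])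
  then have "(\<lambda>q. v q d) differentiable (at q0)"
  proof (rule differentiable_transform_eventually)
    show "\<forall>\<^sub>F q in nhds q0. (\<Sum>i\<in>Basis. (v q c \<bullet> i) *\<^sub>R ?H i (cmap c (p q))) = v q d"
      using ev evd T
    proof eventually_elim
      case (elim q)
      then have cd: "c \<in> charts_at A (p q)" "d \<in> charts_at A (p q)"
        using cA(1) dA(1) by (simp_all add: charts_at_iff)
      show ?case
        unfolding tangent_component[OF elim(3) cd] by (rule linear_expand_basis[OF dtr_linear_at[OF cd], symmetric])
    qed
  qed
  with evd x show ?thesis by (intro conjI differentiable_Pair)
qed

text \<open>With \<open>q = (k, u)\<close>, the curve \<open>\<Gamma> q\<close> solves the equation with parameter \<open>k\<close> and initial velocity \<open>u\<close>
(in the chart \<open>c0\<close>). This is the statement that is carried along the reference geodesic: for \<open>q\<close> near \<open>q0\<close> the solutions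
reach time \<open>s\<close>, and the states reached there depend differentiably on \<open>q\<close> at \<open>q0\<close>.\<close>

definition flow_to ::
  "'a \<Rightarrow> ('a, 'e) chart \<Rightarrow> real \<times> 'e \<Rightarrow> real \<Rightarrow> (real \<times> 'e \<Rightarrow> real \<Rightarrow> 'a) \<Rightarrow> (real \<times> 'e \<Rightarrow> real \<Rightarrow> ('a, 'e) tvec) \<Rightarrow> bool"
  where "flow_to p0 c0 q0 s \<Gamma> V \<longleftrightarrow>
    (\<forall>\<^sub>F q in nhds q0. motion (fst q) {0..s} (\<Gamma> q) (V q) \<and> \<Gamma> q 0 = p0 \<and> V q 0 = tvec_of A c0 p0 (snd q)) \<and>
    (\<forall>c\<in>charts_at A (\<Gamma> q0 s). (\<forall>\<^sub>F q in nhds q0. \<Gamma> q s \<in> cdom c) \<and>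
      (\<lambda>q. (cmap c (\<Gamma> q s), V q s c)) differentiable (at q0))"

lemma flow_to_zero:
  assumes c0: "c0 \<in> charts_at A p0"
  shows "flow_to p0 c0 q0 0 (\<lambda>q t. p0) (\<lambda>q t. tvec_of A c0 p0 (snd q))"
  unfolding flow_to_def
proof (intro conjI ballI)
  have "motion k {0..0} (\<lambda>t. p0) (\<lambda>t. tvec_of A c0 p0 u)" for k u
  proof (rule motionI)
    fix t :: real assume "t \<in> {0..0}"
    then have b: "at t within {0..0} = bot" by (simp add: at_within_eq_bot_iff)
    show "tvec_of A c0 p0 u \<in> tangent_space A p0" by (rule tvec_of_tangent[OF c0])
    have "motion_in k {0..0} (\<lambda>t. p0) (\<lambda>t. tvec_of A c0 p0 u) c0 t"
      unfolding motion_in_def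
      by (intro conjI has_vector_derivative_bot[OF b]) (use c0 in \<open>simp add: charts_at_iff\<close>)
    with c0 show "\<exists>c\<in>charts_at A p0. motion_in k {0..0} (\<lambda>t. p0) (\<lambda>t. tvec_of A c0 p0 u) c t" by blast
  qed
  then show "\<forall>\<^sub>F q in nhds q0. motion (fst q) {0..0} (\<lambda>t. p0) (\<lambda>t. tvec_of A c0 p0 (snd q)) \<and>
      p0 = p0 \<and> tvec_of A c0 p0 (snd q) = tvec_of A c0 p0 (snd q)" by simp
  fix c assume c: "c \<in> charts_at A p0"
  show "\<forall>\<^sub>F q in nhds q0. p0 \<in> cdom c" using c by (simp add: charts_at_iff)
  have "bounded_linear (\<lambda>q :: real \<times> 'e. dtr c0 c p0 (snd q))"
    by (rule bounded_linear_compose[OF linear_linear[THEN iffD2, OF dtr_linear_at[OF c0 c]] bounded_linear_snd])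
  then show "(\<lambda>q. (cmap c p0, tvec_of A c0 p0 (snd q) c)) differentiable (at q0)"
    unfolding tvec_of_apply[OF c]
    by (intro differentiable_Pair differentiable_const bounded_linear_imp_differentiable)
qed

lemma ode_solution_motion:
  fixes \<phi> :: "'e \<times> 'e \<times> real \<Rightarrow> real \<Rightarrow> 'e \<times> 'e \<times> real"
  assumes c: "c \<in> A" and st: "s \<le> t" "t - s \<le> \<delta>" and h: "snd (snd h) = k"
    and \<phi>0: "\<phi> h 0 = h"
    and W: "\<And>\<tau>. \<tau> \<in> {0..\<delta>} \<Longrightarrow> \<phi> h \<tau> \<in> (cmap c ` cdom c) \<times> UNIV"
    and ode: "\<And>\<tau>. \<tau> \<in> {0..\<delta>} \<Longrightarrow> (\<phi> h has_vector_derivative chart_ode c (\<phi> h \<tau>)) (at \<tau> within {0..\<delta>})"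
  shows "motion k {s..t} (\<lambda>\<tau>. cinv c (fst (\<phi> h (\<tau> - s))))
    (\<lambda>\<tau>. tvec_of A c (cinv c (fst (\<phi> h (\<tau> - s)))) (fst (snd (\<phi> h (\<tau> - s)))))"
proof -
  let ?z = "\<lambda>\<tau>. \<phi> h (\<tau> - s)"
  have sh: "\<tau> - s \<in> {0..\<delta>}" if "\<tau> \<in> {s..t}" for \<tau> using that st by auto
  have z: "(?z has_vector_derivative chart_ode c (?z \<tau>)) (at \<tau> within {s..t})" if \<tau>: "\<tau> \<in> {s..t}" for \<tau>
  proof -
    have 1: "((\<lambda>\<tau>. \<tau> - s) has_vector_derivative 1) (at \<tau> within {s..t})"
      by (auto intro!: derivative_eq_intros)
    have 2: "(\<phi> h has_vector_derivative chart_ode c (?z \<tau>)) (at (\<tau> - s) within (\<lambda>\<tau>. \<tau> - s) ` {s..t})"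
      by (rule has_vector_derivative_within_subset[OF ode[OF sh[OF \<tau>]]]) (use sh in blast)
    show ?thesis using vector_diff_chain_within[OF 1 2] by (simp add: comp_def)
  qed
  have "bounded_linear (\<lambda>z::'e \<times> 'e \<times> real. snd (snd z))"
    by (rule bounded_linear_compose[OF bounded_linear_snd bounded_linear_snd])
  from bounded_linear.has_vector_derivative[OF this z]
  have "((\<lambda>\<tau>. snd (snd (?z \<tau>))) has_vector_derivative 0) (at \<tau> within {s..t})" if "\<tau> \<in> {s..t}" for \<tau>
    using that by (simp add: chart_ode_def)
  then obtain C where "\<And>\<tau>. \<tau> \<in> {s..t} \<Longrightarrow> snd (snd (?z \<tau>)) = C"
    using has_vector_derivative_zero_constant[of "{s..t}" "\<lambda>\<tau>. snd (snd (?z \<tau>))"] by auto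
  moreover from this[of s] have "C = k" using st(1) h \<phi>0 by simp
  ultimately have k: "snd (snd (?z \<tau>)) = k" if "\<tau> \<in> {s..t}" for \<tau> using that by simp
  show ?thesis
  proof (rule chart_ode_motion[where z = ?z, OF c _ k z])
    show "fst (?z \<tau>) \<in> cmap c ` cdom c" if "\<tau> \<in> {s..t}" for \<tau>
      using W[OF sh[OF that]] by (simp add: mem_Times_iff)
  qed
qed

text \<open>A chart around the reference point at time \<open>x\<close> and the local flow in it serve all short intervals
\<open>[s, t]\<close> around \<open>x\<close> at once. Being differentiable, the states at time \<open>s\<close> depend continuously on \<open>q\<close>; hence for \<open>q\<close> near \<open>q0\<close>
they lie in the domain of the local flow, which continues the solutions to time \<open>t\<close>. The state at \<open>t\<close> is the
composition of the flow with the state at \<open>s\<close>. Uniqueness identifies the solution for \<open>q0\<close> with the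
reference motion, which is what keeps the construction inside the chart.\<close>

lemma flow_to_extend:
  assumes m0: "motion 0 {0..1} \<gamma>0 V0" and c0: "c0 \<in> charts_at A (\<gamma>0 0)" and x: "x \<in> {0..1}"
  shows "\<exists>d>0. \<forall>s t. 0 \<le> s \<longrightarrow> s \<le> x \<longrightarrow> x \<le> t \<longrightarrow> t \<le> 1 \<longrightarrow> t - s < d \<longrightarrow>
    (\<exists>\<Gamma> V. flow_to (\<gamma>0 0) c0 (0, V0 0 c0) s \<Gamma> V) \<longrightarrow> (\<exists>\<Gamma> V. flow_to (\<gamma>0 0) c0 (0, V0 0 c0) t \<Gamma> V)"
proof -
  let ?q0 = "(0 :: real, V0 0 c0)"
  obtain c where c: "c \<in> charts_at A (\<gamma>0 x)" using charts_at_nonempty[OF motionD(1)[OF m0 x]] by blast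
  then have cA: "c \<in> A" "\<gamma>0 x \<in> cdom c" by (simp_all add: charts_at_iff)
  let ?W = "(cmap c ` cdom c) \<times> (UNIV :: ('e \<times> real) set)"
  let ?z0 = "\<lambda>s. (cmap c (\<gamma>0 s), V0 s c, 0 :: real)"
  have W: "open ?W" by (intro open_Times chart_range_open cA open_UNIV)
  have w: "?z0 x \<in> ?W" using cA(2) by simp
  obtain r \<delta> \<phi> where r: "0 < r" "0 < \<delta>" and \<phi>0: "\<And>z. z \<in> ball (?z0 x) r \<Longrightarrow> \<phi> z 0 = z"
    and \<phi>W: "\<And>z t. z \<in> ball (?z0 x) r \<Longrightarrow> t \<in> {0..\<delta>} \<Longrightarrow> \<phi> z t \<in> ?W"
    and \<phi>': "\<And>z t. z \<in> ball (?z0 x) r \<Longrightarrow> t \<in> {0..\<delta>} \<Longrightarrow>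
      (\<phi> z has_vector_derivative chart_ode c (\<phi> z t)) (at t within {0..\<delta>})"
    and \<phi>d: "\<And>z t. z \<in> ball (?z0 x) r \<Longrightarrow> t \<in> {0..\<delta>} \<Longrightarrow> (\<lambda>z. \<phi> z t) differentiable (at z)"
    using ode_local_flow[OF W chart_ode_smooth[OF cA(1)] w] by blast
  have wb: "?z0 x \<in> ball (?z0 x) r" using r(1) by simp
  from motion_eventually_in_chart_ball[OF m0 x c open_ball wb]
  obtain e where e: "e > 0 \<and> (\<forall>s\<in>{0..1}. \<bar>s - x\<bar> < e \<longrightarrow> \<gamma>0 s \<in> cdom c \<and> ?z0 s \<in> ball (?z0 x) r)" ..
  have "\<exists>\<Gamma> V. flow_to (\<gamma>0 0) c0 ?q0 t \<Gamma> V"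
    if st: "0 \<le> s" "s \<le> x" "x \<le> t" "t \<le> 1" "t - s < min \<delta> e" and flow: "flow_to (\<gamma>0 0) c0 ?q0 s \<Gamma> V" for s t \<Gamma> V
  proof -
    have s: "s \<in> {0..1}" "\<bar>s - x\<bar> < e" "t - s \<le> \<delta>" "s \<le> t" "t - s \<in> {0..\<delta>}"
      and t: "t \<in> {0..1}" "\<bar>t - x\<bar> < e" "0 \<le> t" using st by auto
    have mot: "\<forall>\<^sub>F q in nhds ?q0. motion (fst q) {0..s} (\<Gamma> q) (V q) \<and> \<Gamma> q 0 = \<gamma>0 0 \<and> V q 0 = tvec_of A c0 (\<gamma>0 0) (snd q)"
      using flow unfolding flow_to_def by blast
    have V00: "tvec_of A c0 (\<gamma>0 0) (V0 0 c0) = V0 0"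
      by (rule tvec_of_component[OF motionD(2)[OF m0] c0]) simp
    have at0: "motion 0 {0..s} (\<Gamma> ?q0) (V ?q0)" "\<Gamma> ?q0 0 = \<gamma>0 0" "V ?q0 0 = V0 0"
      using eventually_nhds_x_imp_x[OF mot] V00 by simp_all
    have m0s: "motion 0 {0..s} \<gamma>0 V0" and m0t: "motion 0 {0..t} \<gamma>0 V0"
      using st by (auto intro: motion_subset[OF m0])
    have agree: "\<Gamma> ?q0 s = \<gamma>0 s" "V ?q0 s = V0 s"
      using motion_unique[OF at0(1) m0s at0(2,3), of s] st(1) by simp_all
    have cs: "\<gamma>0 s \<in> cdom c" "?z0 s \<in> ball (?z0 x) r" using e[THEN conjunct2, THEN bspec, OF s(1), THEN mp, OF s(2)] by blast+
    have ct: "\<gamma>0 t \<in> cdom c" by (rule e[THEN conjunct2, THEN bspec, OF t(1), THEN mp, OF t(2), THEN conjunct1])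
    have "c \<in> charts_at A (\<Gamma> ?q0 s)" using cs(1) cA(1) agree by (simp add: charts_at_iff)
    then have end_c: "\<forall>\<^sub>F q in nhds ?q0. \<Gamma> q s \<in> cdom c"
      and end_d: "(\<lambda>q. (cmap c (\<Gamma> q s), V q s c)) differentiable (at ?q0)"
      using flow unfolding flow_to_def by blast+
    \<comment> \<open>The initial states, with the parameter, for the local flow.\<close>
    define h where "h q = (cmap c (\<Gamma> q s), V q s c, fst q)" for q
    have h0: "h ?q0 = ?z0 s" by (simp add: h_def agree)
    have hd: "h differentiable (at ?q0)"
    proof -
      have 1: "(\<lambda>q. cmap c (\<Gamma> q s)) differentiable (at ?q0)"
        using bounded_linear_imp_differentiable[OF bounded_linear_fst, THEN differentiable_chain_at[OF end_d]]
        by (simp add: comp_def)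
      have 2: "(\<lambda>q. V q s c) differentiable (at ?q0)"
        using bounded_linear_imp_differentiable[OF bounded_linear_snd, THEN differentiable_chain_at[OF end_d]]
        by (simp add: comp_def)
      show ?thesis
        unfolding h_def[abs_def]
        by (intro differentiable_Pair 1 2 bounded_linear_imp_differentiable[OF bounded_linear_fst])
    qed
    have hb: "\<forall>\<^sub>F q in nhds ?q0. h q \<in> ball (?z0 x) r"
      by (rule isCont_eventually_nhds[OF differentiable_imp_continuous_within[OF hd] open_ball])
        (use h0 cs(2) in simp)
    define G where "G q \<tau> = cinv c (fst (\<phi> (h q) (\<tau> - s)))" for q \<tau>
    define U where "U q \<tau> = tvec_of A c (G q \<tau>) (fst (snd (\<phi> (h q) (\<tau> - s))))" for q \<tau>
    let ?\<Gamma> = "\<lambda>q \<tau>. if \<tau> \<le> s then \<Gamma> q \<tau> else G q \<tau>" and ?V = "\<lambda>q \<tau>. if \<tau> \<le> s then V q \<tau> else U q \<tau>"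
    have start: "\<Gamma> q s = G q s \<and> V q s = U q s"
      if "motion (fst q) {0..s} (\<Gamma> q) (V q)" "\<Gamma> q s \<in> cdom c" "h q \<in> ball (?z0 x) r" for q
    proof -
      have cq: "c \<in> charts_at A (\<Gamma> q s)" using that(2) cA(1) by (simp add: charts_at_iff)
      have p: "\<phi> (h q) (s - s) = (cmap c (\<Gamma> q s), V q s c, fst q)" using \<phi>0[OF that(3)] by (simp add: h_def)
      have g: "G q s = \<Gamma> q s" unfolding G_def p by (simp add: cinv_cmap[OF cA(1) that(2)])
      have "V q s \<in> tangent_space A (\<Gamma> q s)" by (rule motionD(2)[OF that(1)]) (use st in simp)
      from tvec_of_component[OF this cq] show ?thesis unfolding U_def p by (simp add: g)
    qed
    have mot': "\<forall>\<^sub>F q in nhds ?q0. motion (fst q) {0..t} (?\<Gamma> q) (?V q) \<and> ?\<Gamma> q 0 = \<gamma>0 0 \<and>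
        ?V q 0 = tvec_of A c0 (\<gamma>0 0) (snd q)"
      using mot end_c hb
    proof eventually_elim
      case (elim q)
      have m2: "motion (fst q) {s..t} (G q) (U q)"
        unfolding G_def[abs_def] U_def[abs_def]
        by (rule ode_solution_motion[where \<phi> = \<phi> and \<delta> = \<delta>, OF cA(1) s(4,3) _ \<phi>0[OF elim(3)] \<phi>W[OF elim(3)] \<phi>'[OF elim(3)]])
          (simp_all add: h_def)
      have m1: "motion (fst q) {0..s} (\<Gamma> q) (V q)" using elim(1) by blast
      have eqs: "\<Gamma> q s = G q s" "V q s = U q s" using start[OF m1 elim(2,3)] by simp_all
      show ?case
        using motion_glue[OF m1 m2 st(1) s(4) eqs] elim(1) st(1) by simp
    qed
    have "motion 0 {0..t} (?\<Gamma> ?q0) (?V ?q0)" "?\<Gamma> ?q0 0 = \<gamma>0 0" "?V ?q0 0 = V0 0"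
      using eventually_nhds_x_imp_x[OF mot'] V00 by simp_all
    from motion_unique[OF this(1) m0t this(2,3), of t] have agt: "?\<Gamma> ?q0 t = \<gamma>0 t" using t(3) by simp
    have cat: "c \<in> charts_at A (?\<Gamma> ?q0 t)" unfolding agt using ct cA(1) by (simp add: charts_at_iff)
    have zt: "?\<Gamma> q t \<in> cdom c \<and> \<phi> (h q) (t - s) = (cmap c (?\<Gamma> q t), ?V q t c, snd (snd (\<phi> (h q) (t - s))))"
      if q: "motion (fst q) {0..s} (\<Gamma> q) (V q)" "\<Gamma> q s \<in> cdom c" "h q \<in> ball (?z0 x) r" for q
    proof -
      have gt: "?\<Gamma> q t = G q t" "?V q t = U q t" using start[OF q] s(4) by (cases "t = s"; simp)+
      obtain p where p: "p \<in> cdom c" "fst (\<phi> (h q) (t - s)) = cmap c p"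
        using \<phi>W[OF q(3) s(5)] by (auto simp: mem_Times_iff)
      have G: "G q t = p" unfolding G_def p(2) by (rule cinv_cmap[OF cA(1) p(1)])
      have "c \<in> charts_at A p" using p(1) cA(1) by (simp add: charts_at_iff)
      then have U: "U q t c = fst (snd (\<phi> (h q) (t - s)))" unfolding U_def G by (rule tvec_of_self)
      show ?thesis unfolding gt unfolding U G using p by (simp add: prod_eq_iff)
    qed
    have evz: "\<forall>\<^sub>F q in nhds ?q0. ?\<Gamma> q t \<in> cdom c \<and>
        \<phi> (h q) (t - s) = (cmap c (?\<Gamma> q t), ?V q t c, snd (snd (\<phi> (h q) (t - s))))"
      using mot end_c hb by eventually_elim (rule zt, simp_all)
    have evc: "\<forall>\<^sub>F q in nhds ?q0. ?\<Gamma> q t \<in> cdom c" using evz by eventually_elim simp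
    have "(\<lambda>z. \<phi> z (t - s)) differentiable (at (h ?q0))" unfolding h0 by (rule \<phi>d[OF cs(2) s(5)])
    from differentiable_chain_at[OF hd this]
    have zd: "(\<lambda>q. \<phi> (h q) (t - s)) differentiable (at ?q0)" by (simp add: comp_def)
    have "bounded_linear (\<lambda>z::'e \<times> 'e \<times> real. (fst z, fst (snd z)))"
      by (intro bounded_linear_Pair bounded_linear_fst
          bounded_linear_compose[OF bounded_linear_fst bounded_linear_snd])
    from differentiable_chain_at[OF zd bounded_linear_imp_differentiable[OF this]]
    have "(\<lambda>q. (fst (\<phi> (h q) (t - s)), fst (snd (\<phi> (h q) (t - s))))) differentiable (at ?q0)"
      by (simp add: comp_def)
    then have cd: "(\<lambda>q. (cmap c (?\<Gamma> q t), ?V q t c)) differentiable (at ?q0)"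
    proof (rule differentiable_transform_eventually)
      show "\<forall>\<^sub>F q in nhds ?q0. (fst (\<phi> (h q) (t - s)), fst (snd (\<phi> (h q) (t - s)))) = (cmap c (?\<Gamma> q t), ?V q t c)"
        using evz
      proof eventually_elim
        case (elim q)
        then have "\<phi> (h q) (t - s) = (cmap c (?\<Gamma> q t), ?V q t c, snd (snd (\<phi> (h q) (t - s))))" by blast
        from arg_cong[OF this, of fst] arg_cong[OF this, of "\<lambda>z. fst (snd z)"]
        show ?case by (simp only: fst_conv snd_conv)
      qed
    qed
    have tan: "\<forall>\<^sub>F q in nhds ?q0. ?V q t \<in> tangent_space A (?\<Gamma> q t)"
      using mot'
    proof eventually_elim
      case (elim q)
      then have "motion (fst q) {0..t} (?\<Gamma> q) (?V q)" by blast
      then show ?case by (rule motionD(2)) (use t(3) in simp)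
    qed
    have "flow_to (\<gamma>0 0) c0 ?q0 t ?\<Gamma> ?V"
      unfolding flow_to_def
    proof (intro conjI ballI mot')
      fix d assume d: "d \<in> charts_at A (?\<Gamma> ?q0 t)"
      from state_chart_change[where p = "\<lambda>q. ?\<Gamma> q t" and v = "\<lambda>q. ?V q t", OF tan cat d evc cd]
      show "\<forall>\<^sub>F q in nhds ?q0. ?\<Gamma> q t \<in> cdom d" "(\<lambda>q. (cmap d (?\<Gamma> q t), ?V q t d)) differentiable (at ?q0)"
        by blast+
    qed
    then show ?thesis by blast
  qed
  then show ?thesis using r(2) e by (intro exI[of _ "min \<delta> e"]) auto
qed

lemma flow_to_one:
  assumes m0: "motion 0 {0..1} \<gamma>0 V0" and c0: "c0 \<in> charts_at A (\<gamma>0 0)"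
  shows "\<exists>\<Gamma> V. flow_to (\<gamma>0 0) c0 (0, V0 0 c0) 1 \<Gamma> V"
proof -
  define R where "R s \<longleftrightarrow> (\<exists>\<Gamma> V. flow_to (\<gamma>0 0) c0 (0, V0 0 c0) s \<Gamma> V)" for s
  define J where "J = {0..1::real}"
  have "(0::real) \<le> 1" by simp
  then have "0 \<in> J \<and> 1 \<in> J \<longrightarrow> R 0 \<longrightarrow> R 1"
  proof (induction rule: Bolzano)
    case (trans p q r)
    show ?case
    proof (intro impI)
      assume pr: "p \<in> J \<and> r \<in> J" and "R p"
      have "q \<in> J" using pr trans(3,4) by (simp add: J_def)
      then show "R r" using trans(1,2) pr \<open>R p\<close> by blast
    qed
  next
    case (local x)
    then have "x \<in> {0..1}" by simp
    from flow_to_extend[OF m0 c0 this, folded R_def] obtain d where d: "d > 0"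
      "\<And>s t. 0 \<le> s \<Longrightarrow> s \<le> x \<Longrightarrow> x \<le> t \<Longrightarrow> t \<le> 1 \<Longrightarrow> t - s < d \<Longrightarrow> R s \<Longrightarrow> R t" by blast
    show ?case
    proof (intro exI[of _ d] conjI[OF d(1)] allI impI)
      fix p q assume "p \<le> x \<and> x \<le> q \<and> q - p < d" "p \<in> J \<and> q \<in> J" "R p"
      then show "R q" using d(2)[of p q] by (simp add: J_def)
    qed
  qed
  moreover have "R 0" unfolding R_def by (intro exI) (rule flow_to_zero[OF c0])
  ultimately show ?thesis unfolding J_def R_def[symmetric] by simp
qed

end

section \<open>End points of solutions\<close>

lemma at_within_unit_interval: "t \<in> {0..1::real} \<Longrightarrow> at t within {0..1} \<noteq> bot"
  by (simp add: trivial_limit_within islimpt_Icc)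

context forced_connection
begin

lemma solution_from_motion:
  assumes "solution_from M A D F k p v \<gamma>"
  shows "motion k {0..1} \<gamma> (velocity A {0..1} \<gamma>)" "\<gamma> 0 = p" "velocity A {0..1} \<gamma> 0 = v"
  using assms curve_equation_motion[OF at_within_unit_interval]
  by (simp_all add: solution_from_def solution_iff)

lemma motion_solution_from:
  assumes "motion k {0..1} \<gamma> V"
  shows "solution_from M A D F k (\<gamma> 0) (V 0) \<gamma>"
  unfolding solution_from_def solution_iff
  using motion_curve_equation[OF assms at_within_unit_interval] motion_velocity[OF assms at_within_unit_interval, of 0]
  by simp

lemma Psi_eq:
  assumes s: "solution_from M A D F k p v \<gamma>"
  shows "Psi M A D F k p v = \<gamma> 1"
  unfolding Psi_def
proof (rule the_equality)
  show "\<exists>\<gamma>'. solution_from M A D F k p v \<gamma>' \<and> \<gamma>' 1 = \<gamma> 1" using s by blast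
  fix q assume "\<exists>\<gamma>'. solution_from M A D F k p v \<gamma>' \<and> \<gamma>' 1 = q"
  then obtain \<gamma>' where g: "solution_from M A D F k p v \<gamma>'" "\<gamma>' 1 = q" by blast
  note 1 = solution_from_motion[OF s] and 2 = solution_from_motion[OF g(1)]
  have "\<gamma>' 1 = \<gamma> 1" using motion_unique[OF 2(1) 1(1), of 1] 1(2,3) 2(2,3) by simp
  with g(2) show "q = \<gamma> 1" by simp
qed

lemma geodesic_solution_from:
  assumes "geodesic M A D UNIV \<gamma>"
  shows "solution_from M A D F 0 (\<gamma> 0) (velocity A UNIV \<gamma> 0) \<gamma>"
proof -
  have "motion 0 UNIV \<gamma> (velocity A UNIV \<gamma>)"
    by (rule curve_equation_motion) (use assms in \<open>simp_all add: geodesic_iff\<close>)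
  from motion_solution_from[OF motion_subset[OF this]] show ?thesis by simp
qed

text \<open>The restriction of a complete geodesic to \<open>[0,1]\<close> is a solution for \<open>k = 0\<close>. Uniqueness of solutions on \<open>[0,1]\<close>
therefore also makes the end point of the geodesic unique.\<close>

lemma Phi_eq_Psi:
  assumes complete: "geodesically_complete M A D" and p: "p \<in> topspace M" "v \<in> tangent_space A p"
  shows "Phi M A D 1 p v = Psi M A D F 0 p v"
proof -
  obtain \<gamma> where g: "geodesic M A D UNIV \<gamma>" "\<gamma> 0 = p" "velocity A UNIV \<gamma> 0 = v"
    using complete p unfolding geodesically_complete_def by blast
  have end_eq: "\<gamma>' 1 = Psi M A D F 0 p v"
    if "geodesic M A D UNIV \<gamma>'" "\<gamma>' 0 = p" "velocity A UNIV \<gamma>' 0 = v" for \<gamma>'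
    using Psi_eq[OF geodesic_solution_from[OF that(1)]] that(2,3) by simp
  show ?thesis
    unfolding Phi_def
  proof (rule the_equality)
    show "\<exists>\<gamma>. geodesic M A D UNIV \<gamma> \<and> \<gamma> 0 = p \<and> velocity A UNIV \<gamma> 0 = v \<and> \<gamma> 1 = Psi M A D F 0 p v"
      using g end_eq[OF g] by blast
  qed (use end_eq in blast)
qed

text \<open>Joint differentiability in \<open>(k, u)\<close>. Partial derivatives alone would not support the chain rule along
\<open>k \<mapsto> (k, X + Y k)\<close>.\<close>

lemma Psi_differentiable:
  assumes g: "geodesic M A D UNIV \<gamma>0" and c0: "c0 \<in> charts_at A (\<gamma>0 0)" and d: "d \<in> charts_at A (\<gamma>0 1)"
  shows "(\<lambda>q. cmap d (Psi M A D F (fst q) (\<gamma>0 0) (tvec_of A c0 (\<gamma>0 0) (snd q))))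
    differentiable (at (0, velocity A UNIV \<gamma>0 0 c0))"
proof -
  let ?a = "\<gamma>0 0" and ?X = "velocity A UNIV \<gamma>0 0"
  let ?q0 = "(0 :: real, ?X c0)"
  have s0: "solution_from M A D F 0 ?a ?X \<gamma>0" by (rule geodesic_solution_from[OF g])
  note m0 = solution_from_motion[OF s0]
  obtain \<Gamma> V where flow: "flow_to ?a c0 ?q0 1 \<Gamma> V"
    using flow_to_one[OF m0(1) c0] unfolding m0(3) by blast
  have ev: "\<forall>\<^sub>F q in nhds ?q0. Psi M A D F (fst q) ?a (tvec_of A c0 ?a (snd q)) = \<Gamma> q 1"
  proof -
    have "\<forall>\<^sub>F q in nhds ?q0. motion (fst q) {0..1} (\<Gamma> q) (V q) \<and> \<Gamma> q 0 = ?a \<and> V q 0 = tvec_of A c0 ?a (snd q)"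
      using flow unfolding flow_to_def by blast
    then show ?thesis
    proof eventually_elim
      case (elim q)
      then show ?case using Psi_eq[OF motion_solution_from, of "fst q" "\<Gamma> q" "V q"] by simp
    qed
  qed
  have X: "?X \<in> tangent_space A ?a" using motionD(2)[OF m0(1), of 0] m0(3) by simp
  have "\<Gamma> ?q0 1 = \<gamma>0 1"
    using eventually_nhds_x_imp_x[OF ev] Psi_eq[OF s0] by (simp add: tvec_of_component[OF X c0])
  then have "d \<in> charts_at A (\<Gamma> ?q0 1)" using d by simp
  then have "(\<lambda>q. (cmap d (\<Gamma> q 1), V q 1 d)) differentiable (at ?q0)"
    using flow unfolding flow_to_def by blast
  from differentiable_chain_at[OF this bounded_linear_imp_differentiable[OF bounded_linear_fst]]
  have "(\<lambda>q. cmap d (\<Gamma> q 1)) differentiable (at ?q0)" by (simp add: comp_def)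
  then show ?thesis
    by (rule differentiable_transform_eventually) (use ev in \<open>eventually_elim, simp\<close>)
qed

text \<open>The chain rule for the constant end point of the corrected solutions.\<close>

lemma dPhi1_neg_correction_derivative:
  assumes complete: "geodesically_complete M A D" and g: "geodesic M A D UNIV \<gamma>0"
    and Y: "velocity_correction M A D F (\<gamma>0 0) (\<gamma>0 1) (velocity A UNIV \<gamma>0 0) Y"
    and Y': "has_tangent_derivative A (\<gamma>0 0) Y Y' 0"
  shows "dPhi1 M A D (\<gamma>0 0) (velocity A UNIV \<gamma>0 0) (- Y') =
    velocity A UNIV (\<lambda>k. Psi M A D F k (\<gamma>0 0) (velocity A UNIV \<gamma>0 0)) 0"
proof
  fix d :: "('a, 'e) chart"
  define a b X where "a = \<gamma>0 0" and "b = \<gamma>0 1" and "X = velocity A UNIV \<gamma>0 0"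
  have s0: "solution_from M A D F 0 a X \<gamma>0" unfolding a_def X_def by (rule geodesic_solution_from[OF g])
  note m0 = solution_from_motion[OF s0]
  have X: "X \<in> tangent_space A a" and aM: "a \<in> topspace M"
    using motionD(1,2)[OF m0(1), of 0] m0(2,3) by simp_all
  have Psi0: "Psi M A D F 0 a X = b" using Psi_eq[OF s0] by (simp add: b_def)
  have Phi0: "Phi M A D 1 a X = b" using Phi_eq_Psi[OF complete aM X] Psi0 by simp
  \<comment> \<open>The chart in which \<open>differential\<close> represents vectors at \<open>a\<close>.\<close>
  define c0 where "c0 = (SOME c. c \<in> charts_at A a)"
  have c0: "c0 \<in> charts_at A a" unfolding c0_def using charts_at_nonempty[OF aM] by (rule someI_ex)
  let ?P = "\<lambda>q. cmap d (Psi M A D F (fst q) a (tvec_of A c0 a (snd q)))"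
  have dPhi: "dPhi1 M A D a X v d = (if d \<in> charts_at A b
      then frechet_derivative (\<lambda>u. cmap d (Phi M A D 1 a (tvec_of A c0 a u))) (at (X c0)) (v c0) else 0)" for v
    by (simp add: dPhi1_def differential_def Let_def Phi0 flip: c0_def)
  have vel: "velocity A UNIV (\<lambda>k. Psi M A D F k a X) 0 d = (if d \<in> charts_at A b
      then vector_derivative (\<lambda>k. cmap d (Psi M A D F k a X)) (at 0) else 0)"
    by (simp add: velocity_def Psi0 comp_def)
  have "dPhi1 M A D a X (- Y') d = velocity A UNIV (\<lambda>k. Psi M A D F k a X) 0 d"
  proof (cases "d \<in> charts_at A b")
    case True
    have "?P differentiable (at (0, X c0))"
      using Psi_differentiable[OF g, of c0 d] c0 True unfolding a_def b_def X_def by blast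
    then obtain L where L: "(?P has_derivative L) (at (0, X c0))" by (auto simp: differentiable_def)
    have lin: "linear L" by (rule has_derivative_linear[OF L])
    \<comment> \<open>Partial derivative in the initial velocity.\<close>
    have "((\<lambda>u. (0 :: real, u)) has_derivative (\<lambda>w. (0, w))) (at (X c0))"
      by (intro has_derivative_Pair has_derivative_const has_derivative_ident)
    from has_derivative_compose[OF this L]
    have "((\<lambda>u. cmap d (Psi M A D F 0 a (tvec_of A c0 a u))) has_derivative (\<lambda>w. L (0, w))) (at (X c0))" by simp
    moreover have "Phi M A D 1 a (tvec_of A c0 a u) = Psi M A D F 0 a (tvec_of A c0 a u)" for u
      by (rule Phi_eq_Psi[OF complete aM tvec_of_tangent[OF c0]])
    ultimately have "((\<lambda>u. cmap d (Phi M A D 1 a (tvec_of A c0 a u))) has_derivative (\<lambda>w. L (0, w))) (at (X c0))"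
      by simp
    from fun_cong[OF frechet_derivative_at[OF this], of "- Y' c0"]
    have 1: "dPhi1 M A D a X (- Y') d = L (0, - Y' c0)" unfolding dPhi using True by simp
    \<comment> \<open>Partial derivative in the parameter.\<close>
    have tX: "tvec_of A c0 a (X c0) = X" by (rule tvec_of_component[OF X c0])
    have "((\<lambda>k. (k, X c0)) has_vector_derivative (1, 0)) (at 0)"
      by (intro has_vector_derivative_Pair has_vector_derivative_id has_vector_derivative_const)
    from has_vector_derivative_chain[OF this, of ?P L] L
    have "((\<lambda>k. cmap d (Psi M A D F k a X)) has_vector_derivative L (1, 0)) (at 0)" by (simp add: tX)
    from vector_derivative_at[OF this]
    have 2: "velocity A UNIV (\<lambda>k. Psi M A D F k a X) 0 d = L (1, 0)" unfolding vel using True by simp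
    \<comment> \<open>Along the corrected velocities the end point is constant.\<close>
    have Y0: "Y 0 = 0" using Y unfolding velocity_correction_def by blast
    have Yk: "Y k \<in> tangent_space A a" "Psi M A D F k a (X + Y k) = b" for k
    proof -
      show "Y k \<in> tangent_space A a" using Y unfolding velocity_correction_def a_def by blast
      obtain \<gamma> where "solution_from M A D F k a (X + Y k) \<gamma>" "\<gamma> 1 = b"
        using Y unfolding velocity_correction_def a_def b_def X_def by blast
      then show "Psi M A D F k a (X + Y k) = b" using Psi_eq by simp
    qed
    have "((\<lambda>k. Y k c0) has_vector_derivative Y' c0) (at 0)"
      using Y' c0 unfolding has_tangent_derivative_def a_def by blast
    from has_vector_derivative_add[OF has_vector_derivative_const[of "X c0"] this]
    have "((\<lambda>k. X c0 + Y k c0) has_vector_derivative Y' c0) (at 0)" by simp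
    from has_vector_derivative_Pair[OF has_vector_derivative_id this]
    have "((\<lambda>k. (k, X c0 + Y k c0)) has_vector_derivative (1, Y' c0)) (at 0)" .
    from has_vector_derivative_chain[OF this, of ?P L] L
    have "((\<lambda>k. ?P (k, X c0 + Y k c0)) has_vector_derivative L (1, Y' c0)) (at 0)" by (simp add: Y0)
    moreover have "?P (k, X c0 + Y k c0) = cmap d b" for k
      using tvec_of_component[OF tangent_add[OF X Yk(1)] c0, of k] Yk(2)[of k] by simp
    ultimately have "((\<lambda>k::real. cmap d b) has_vector_derivative L (1, Y' c0)) (at 0)" by simp
    from vector_derivative_unique_at[OF this has_vector_derivative_const]
    have "L (1, Y' c0) = 0" .
    moreover have "L (1, Y' c0) = L (1, 0) - L (0, - Y' c0)"
      by (simp flip: linear_diff[OF lin])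
    ultimately show ?thesis unfolding 1 2 by simp
  next
    case False
    then show ?thesis unfolding dPhi vel by simp
  qed
  then show "dPhi1 M A D (\<gamma>0 0) (velocity A UNIV \<gamma>0 0) (- Y') d =
    velocity A UNIV (\<lambda>k. Psi M A D F k (\<gamma>0 0) (velocity A UNIV \<gamma>0 0)) 0 d"
    unfolding a_def X_def .
qed

end

section \<open>The linear approximation of the velocity correction\<close>

theorem theorem8:
  fixes M :: "'a topology"
    and A :: "('a, 'e::euclidean_space) chart set"
    and D :: "('a, 'e) connection"
    and F :: "'a \<Rightarrow> ('a, 'e) tvec \<Rightarrow> ('a, 'e) tvec"
    and a b :: 'a
    and X :: "('a, 'e) tvec"
    and \<gamma>0 :: "real \<Rightarrow> 'a"
  assumes "smooth_manifold M A"
    and "linear_connection M A D"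
    and "geodesically_complete M A D"
    and "tensor_field_1_1 M A F"
    and "everywhere_nonzero M A F"
    and "a \<in> topspace M"
    and "b \<in> topspace M"
    and "X \<in> tangent_space A a"
    and "geodesic M A D UNIV \<gamma>0"
    and "\<gamma>0 0 = a"
    and "velocity A UNIV \<gamma>0 0 = X"
    and "\<gamma>0 1 = b"
    and "bij_betw (dPhi1 M A D a X) (tangent_space A a) (tangent_space A b)"
  shows "((\<exists>Y. velocity_correction M A D F a b X Y) \<longrightarrow>
           (\<forall>k. \<exists>\<gamma>. solution M A D F k \<gamma> \<and> \<gamma> 0 = a \<and> \<gamma> 1 = b)) \<and>
         (\<forall>Y. velocity_correction M A D F a b X Y \<longrightarrow>
           has_tangent_derivative A a Y (- Y1 M A D F a X) 0)"
proof (intro conjI impI allI)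
  fix k assume "\<exists>Y. velocity_correction M A D F a b X Y"
  then show "\<exists>\<gamma>. solution M A D F k \<gamma> \<and> \<gamma> 0 = a \<and> \<gamma> 1 = b"
    unfolding velocity_correction_def solution_from_def by blast
next
  fix Y assume Y: "velocity_correction M A D F a b X Y"
  interpret forced_connection M A D F
    by unfold_locales (use assms in simp_all)
  obtain Y' where Y': "has_tangent_derivative A a Y Y' 0"
    using Y unfolding velocity_correction_def by blast
  have eq: "dPhi1 M A D a X (- Y') = velocity A UNIV (\<lambda>k. Psi M A D F k a X) 0"
    using dPhi1_neg_correction_derivative[OF assms(3,9), of Y Y'] Y Y' assms(10-12) by simp
  have "Y' \<in> tangent_space A a" using Y' unfolding has_tangent_derivative_def by blast
  from tangent_scaleR[OF this, of "- 1"] have T: "- Y' \<in> tangent_space A a" by simp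
  have "Y1 M A D F a X = - Y'"
    unfolding Y1_def eq[symmetric] by (rule inv_into_f_f[OF bij_betw_imp_inj_on[OF assms(13)] T])
  then show "has_tangent_derivative A a Y (- Y1 M A D F a X) 0" using Y' by simp
qed

end
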